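(* Let $0<s<1$, $n\in\mathbb{N}$ with $n>\max\{1,2s\}$, $1<p<\frac{n+s}{n-s}$, and let $\Omega\subset\mathbb{R}^n$ be a bounded domain of class $C^{1,1}$. Then there exist $d_0>0$ and constants $C_0>0$ (depending on $p$) and $C_1>0$ (depending only on $p$ and $\Omega$), with $C_0$ and $C_1$ independent of $d$, such that for every $d\in(0,d_0)$ and every least energy solution $u_d$ of the problem $$d(-\Delta)^s u+u=|u|^{p-1}u \ \text{ in } \Omega,\qquad \mathcal{N}_s u=0\ \text{ in } \mathbb{R}^n\setminus\overline{\Omega},\qquad u>0\ \text{ in }\Omega,$$ one has $$d\,\frac{c_{n,s}}{2}\int_{T(\Omega)}\frac{|u_d(x)-u_d(y)|^2}{|x-y|^{n+2s}}\,dx\,dy+\int_\Omega u_d^2\,dx=\int_\Omega u_d^{p+1}\,dx\le C_0\,d^{\frac{n}{2s}},$$ and $$\sup_{\Omega}u_d\le C_1 .$$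
   Context: Here $(-\Delta)^s u(x)=c_{n,s}\,\mathrm{P.V.}\int_{\mathbb{R}^n}\frac{u(x)-u(y)}{|x-y|^{n+2s}}dy$ with $c_{n,s}=\left(\int_{\mathbb{R}^n}\frac{1-\cos x_1}{|x|^{n+2s}}dx\right)^{-1}$, and $\mathcal{N}_s u(x)=c_{n,s}\int_\Omega\frac{u(x)-u(y)}{|x-y|^{n+2s}}dy$ for $x\in\mathbb{R}^n\setminus\overline{\Omega}$ (nonlocal Neumann derivative). Put $T(\Omega)=\mathbb{R}^{2n}\setminus(\mathbb{R}^n\setminus\Omega)^2$. The Hilbert space $H^s_\Omega$ consists of measurable $u:\mathbb{R}^n\to\mathbb{R}$ with $$\|u\|_{H^s_\Omega}=\Big(\|u\|_{L^2(\Omega)}^2+\int_{T(\Omega)}\frac{|u(x)-u(y)|^2}{|x-y|^{n+2s}}dx\,dy\Big)^{1/2}<\infty.$$ The problem is understood in the weak sense: $u\in H^s_\Omega$ and, for all $\psi\in H^s_\Omega$, $$\frac{d c_{n,s}}{2}\int_{T(\Omega)}\frac{(u(x)-u(y))(\psi(x)-\psi(y))}{|x-y|^{n+2s}}dx\,dy+\int_\Omega u\psi\,dx=\int_\Omega|u|^{p-1}u\psi\,dx .$$ Weak solutions are the critical points of the $C^2$ functional on $H^s_\Omega$ $$J_d(u)=\frac12\Big[\frac{d c_{n,s}}{2}\int_{T(\Omega)}\frac{|u(x)-u(y)|^2}{|x-y|^{n+2s}}dx\,dy+\int_\Omega u^2dx\Big]-\frac1{p+1}\int_\Omega|u|^{p+1}dx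 .$$ The mountain-pass value is $c_d=\inf_{\gamma\in\Gamma}\max_{t\in[0,1]}J_d(\gamma(t))$, where $\Gamma=\{\gamma\in C([0,1];H^s_\Omega):\gamma(0)=0,\ \gamma(1)=u\}$ and $u\in H^s_\Omega$ is a fixed function with $u>0$ and $J_d(u)=0$ (the value does not depend on the choice of such $u$). A least energy solution is a critical point $u_d$ of $J_d$ with $J_d(u_d)=c_d$ and $u_d>0$ in $\Omega$. *)

theory Defs
  imports "HOL-Analysis.Analysis" "HOL-Probability.Essential_Supremum"
begin

text \<open>
  Functions are Lebesgue measurable and represent their classes modulo equality almost everywhere:
  pointwise conditions on elements of the energy space are almost-everywhere conditions.
\<close>

definition C11_function :: "(real^'n \<Rightarrow> real) \<Rightarrow> bool" where
  "C11_function \<phi> \<longleftrightarrow>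
     (\<exists>g. (\<forall>x. (\<phi> has_derivative (\<lambda>h. g x \<bullet> h)) (at x)) \<and> (\<exists>L. L-lipschitz_on UNIV g))"

text \<open>
  Near each boundary point the domain lies strictly on one side of the graph of a \<open>C\<^sup>1\<^sup>,\<^sup>1\<close> function
  over the hyperplane orthogonal to a unit vector \<open>\<nu>\<close>. The function \<open>\<phi>\<close> is given on the whole space
  but used only at projections onto that hyperplane, so it encodes a function of \<open>n - 1\<close> variables
  in a rotated coordinate system.
\<close>

definition bounded_C11_domain :: "(real^'n) set \<Rightarrow> bool" where
  "bounded_C11_domain \<Omega> \<longleftrightarrow>
     open \<Omega> \<and> connected \<Omega> \<and> \<Omega> \<noteq> {} \<and> bounded \<Omega> \<and>
     (\<forall>x0\<in>frontier \<Omega>. \<exists>r>0. \<exists>\<nu> \<phi>. norm \<nu> = 1 \<and> C11_function \<phi> \<and>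
        \<Omega> \<inter> ball x0 r = {x \<in> ball x0 r. x \<bullet> \<nu> > \<phi> (x - (x \<bullet> \<nu>) *\<^sub>R \<nu>)})"

text \<open>
  The coordinate called \<open>x\<^sub>1\<close> is an arbitrary fixed one, as a finite index type need not be ordered;
  the integral is the same for every coordinate.
\<close>

definition frac_lap_const :: "'n::finite itself \<Rightarrow> real \<Rightarrow> real" where
  "frac_lap_const _ s =
     inverse (\<integral>x. (1 - cos (x $ (SOME i. True))) / norm x powr (real CARD('n) + 2 * s)
                \<partial>(lebesgue :: (real^'n) measure))"

definition T_set :: "(real^'n) set \<Rightarrow> ((real^'n) \<times> (real^'n)) set" where
  "T_set \<Omega> = UNIV - (UNIV - \<Omega>) \<times> (UNIV - \<Omega>)"

definition gagliardo_density ::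
  "real \<Rightarrow> (real^'n \<Rightarrow> real) \<Rightarrow> (real^'n \<Rightarrow> real) \<Rightarrow> (real^'n) \<times> (real^'n) \<Rightarrow> real" where
  "gagliardo_density s u v =
     (\<lambda>(x, y). ((u x - u y) * (v x - v y)) / norm (x - y) powr (real CARD('n) + 2 * s))"

definition gagliardo_form ::
  "(real^'n) set \<Rightarrow> real \<Rightarrow> (real^'n \<Rightarrow> real) \<Rightarrow> (real^'n \<Rightarrow> real) \<Rightarrow> real" where
  "gagliardo_form \<Omega> s u v = set_lebesgue_integral lebesgue (T_set \<Omega>) (gagliardo_density s u v)"

text \<open>
  Both integrands below are nonnegative, so their integrability is the finiteness of the norm.
\<close>

definition Hs :: "(real^'n) set \<Rightarrow> real \<Rightarrow> (real^'n \<Rightarrow> real) set" where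
  "Hs \<Omega> s = {u \<in> borel_measurable lebesgue.
      set_integrable lebesgue \<Omega> (\<lambda>x. (u x)\<^sup>2) \<and>
      set_integrable lebesgue (T_set \<Omega>) (gagliardo_density s u u)}"

definition Hs_norm :: "(real^'n) set \<Rightarrow> real \<Rightarrow> (real^'n \<Rightarrow> real) \<Rightarrow> real" where
  "Hs_norm \<Omega> s u = sqrt ((LINT x:\<Omega>|lebesgue. (u x)\<^sup>2) + gagliardo_form \<Omega> s u u)"

definition weak_solution ::
  "(real^'n) set \<Rightarrow> real \<Rightarrow> real \<Rightarrow> real \<Rightarrow> (real^'n \<Rightarrow> real) \<Rightarrow> bool" where
  "weak_solution \<Omega> s p d u \<longleftrightarrow> u \<in> Hs \<Omega> s \<and>
     (\<forall>\<psi>\<in>Hs \<Omega> s.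
        d * frac_lap_const TYPE('n) s / 2 * gagliardo_form \<Omega> s u \<psi> + (LINT x:\<Omega>|lebesgue. u x * \<psi> x)
        = (LINT x:\<Omega>|lebesgue. \<bar>u x\<bar> powr (p - 1) * u x * \<psi> x))"

definition J_energy ::
  "(real^'n) set \<Rightarrow> real \<Rightarrow> real \<Rightarrow> real \<Rightarrow> (real^'n \<Rightarrow> real) \<Rightarrow> real" where
  "J_energy \<Omega> s p d u =
     1 / 2 * (d * frac_lap_const TYPE('n) s / 2 * gagliardo_form \<Omega> s u u
              + (LINT x:\<Omega>|lebesgue. (u x)\<^sup>2))
     - 1 / (p + 1) * (LINT x:\<Omega>|lebesgue. \<bar>u x\<bar> powr (p + 1))"

text \<open>The Frechet derivative of the functional on the energy space vanishes at \<open>u\<close>.\<close>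

definition J_critical_point ::
  "(real^'n) set \<Rightarrow> real \<Rightarrow> real \<Rightarrow> real \<Rightarrow> (real^'n \<Rightarrow> real) \<Rightarrow> bool" where
  "J_critical_point \<Omega> s p d u \<longleftrightarrow> u \<in> Hs \<Omega> s \<and>
     (\<forall>\<epsilon>>0. \<exists>\<delta>>0. \<forall>h\<in>Hs \<Omega> s. Hs_norm \<Omega> s h < \<delta> \<longrightarrow>
        \<bar>J_energy \<Omega> s p d (\<lambda>x. u x + h x) - J_energy \<Omega> s p d u\<bar> \<le> \<epsilon> * Hs_norm \<Omega> s h)"

definition mp_endpoint ::
  "(real^'n) set \<Rightarrow> real \<Rightarrow> real \<Rightarrow> real \<Rightarrow> (real^'n \<Rightarrow> real) \<Rightarrow> bool" where
  "mp_endpoint \<Omega> s p d e \<longleftrightarrow>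
     e \<in> Hs \<Omega> s \<and> (AE x in lebesgue. e x > 0) \<and> J_energy \<Omega> s p d e = 0"

definition mp_paths ::
  "(real^'n) set \<Rightarrow> real \<Rightarrow> (real^'n \<Rightarrow> real) \<Rightarrow> (real \<Rightarrow> real^'n \<Rightarrow> real) set" where
  "mp_paths \<Omega> s e = {\<gamma>. (\<forall>t\<in>{0..1}. \<gamma> t \<in> Hs \<Omega> s) \<and>
     (\<forall>t\<in>{0..1}. \<forall>\<epsilon>>0. \<exists>\<delta>>0. \<forall>t'\<in>{0..1}. \<bar>t' - t\<bar> < \<delta> \<longrightarrow>
        Hs_norm \<Omega> s (\<lambda>x. \<gamma> t' x - \<gamma> t x) < \<epsilon>) \<and>
     \<gamma> 0 = (\<lambda>x. 0) \<and> \<gamma> 1 = e}"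

text \<open>
  The inner supremum is a maximum, the functional being continuous along the path.
  The value depends on the endpoint \<open>e\<close> only formally.
\<close>

definition mp_value ::
  "(real^'n) set \<Rightarrow> real \<Rightarrow> real \<Rightarrow> real \<Rightarrow> (real^'n \<Rightarrow> real) \<Rightarrow> real" where
  "mp_value \<Omega> s p d e = (INF \<gamma>\<in>mp_paths \<Omega> s e. SUP t\<in>{0..1}. J_energy \<Omega> s p d (\<gamma> t))"

definition least_energy_solution ::
  "(real^'n) set \<Rightarrow> real \<Rightarrow> real \<Rightarrow> real \<Rightarrow> (real^'n \<Rightarrow> real) \<Rightarrow> (real^'n \<Rightarrow> real) \<Rightarrow> bool" where
  "least_energy_solution \<Omega> s p d e u \<longleftrightarrow>
     J_critical_point \<Omega> s p d u \<and> J_energy \<Omega> s p d u = mp_value \<Omega> s p d e \<and>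
     (AE x in lebesgue. x \<in> \<Omega> \<longrightarrow> u x > 0)"

end

theory Submission
  imports Defs
begin

text \<open>
  Energy bound. A path through the plane spanned by a tent function of radius
  \<open>\<delta> = d\<^bsup>1/(2s)\<^esup>\<close> and the endpoint \<open>e\<close>, which follows the ray of the tent far out, crosses over to
  the ray of \<open>e\<close> and comes back to \<open>e\<close>, has nonpositive energy after its first piece; by scaling
  the first piece has energy \<open>O(\<delta>\<^sup>n)\<close>. For a solution, the energy is a fixed multiple of
  \<open>\<integral> u\<^bsup>p+1\<^esup>\<close>.

  Supremum bound. The domain contains a ball of radius \<open>\<eta> r\<close> in every \<open>B(x, r)\<close> with \<open>x \<in> \<Omega>\<close>. Averaging
  over it bounds \<open>w(x)\<^sup>2\<close> by \<open>r\<^bsup>-n\<^esup> \<parallel>w\<parallel>\<^sub>2\<^sup>2 + r\<^bsup>2s\<^esup> g(x)\<close>, where \<open>g\<close> integrates to at most the Gagliardo form;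
  choosing \<open>r\<close> depending on \<open>w(x)\<close> gives an inequality of Gagliardo-Nirenberg type with exponent
  \<open>q = 2 + 4s/n\<close>. The assumption on \<open>p\<close> reads \<open>p + 1 < 2n/(n - s)\<close>, and \<open>2n/(n - s) \<le> q\<close> because \<open>n > 2s\<close>.
  A De Giorgi iteration on the truncations \<open>(u - k)\<^sup>+\<close> then closes with constants independent of \<open>d\<close>,
  since both sides scale like \<open>\<delta>\<^sup>n\<close>.
\<close>

section \<open>The interior ball condition and measurability\<close>

text \<open>The length \<open>d powr (1 / (2 * s))\<close> is forced by homogeneity: a bump of
  height 1 and radius \<delta> has Gagliardo form of order \<delta>^(n-2s) and squared L2 norm of
  order \<delta>^n, and weighting the form by d balances the two exactly when d = \<delta>^(2s). The
  tent's ray alone is not an admissible path, because \<open>mp_value\<close> refers to paths ending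
  at the given \<open>e\<close>; far out, the power term of degree p + 1 > 2 beats the quadratic
  one, which makes the crossing harmless.

  The usual regularity argument would start from the critical Sobolev embedding on \<Omega>.
  Averaging over interior balls replaces it, at the price of an exponent q below the critical
  2n/(n-2s). The iteration asks for q > p + 1, so that returning from q to p + 1 costs a negative
  power of the height gap. One step costs a factor 1/d and gains the power 2s/n of a quantity of
  order d^(n/(2s)), so d cancels. Integrability of u^(p+1) is not taken from an embedding either: it
  is read off from a nonzero value of the integral.\<close>

lemma interior_ball_condition_local:
  fixes \<Omega> :: "(real^'n) set"
  assumes dom: "bounded_C11_domain \<Omega>" and z: "z \<in> closure \<Omega>"
  shows "\<exists>\<rho>>0. \<exists>\<eta>>0. \<forall>x\<in>\<Omega> \<inter> ball z \<rho>. \<forall>r. 0 < r \<and> r \<le> \<rho> \<longrightarrow>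
    (\<exists>y. ball y (\<eta> * r) \<subseteq> \<Omega> \<inter> ball x r)"
proof (cases "z \<in> \<Omega>")
  case True
  have "open \<Omega>" using dom by (simp add: bounded_C11_domain_def)
  then obtain e where e: "e > 0" "ball z e \<subseteq> \<Omega>"
    using True openE by blast
  show ?thesis
  proof (rule exI[of _ "e/2"], intro conjI, use e in simp, rule exI[of _ 1], intro conjI ballI allI impI)
    fix x r assume x: "x \<in> \<Omega> \<inter> ball z (e/2)" and r: "0 < r \<and> r \<le> e/2"
    have "ball x r \<subseteq> ball z e"
    proof
      fix y assume "y \<in> ball x r"
      then have "dist x y < e/2" "dist z x < e/2" using x r by auto
      then show "y \<in> ball z e" using dist_triangle[of z y x] by simp
    qed
    then show "\<exists>y. ball y (1 * r) \<subseteq> \<Omega> \<inter> ball x r" using e by auto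
  qed simp
next
  case False
  then have "z \<in> frontier \<Omega>"
    using z dom by (simp add: frontier_def bounded_C11_domain_def interior_open)
  then obtain r0 \<nu> \<phi> where r0: "r0 > 0" and \<nu>: "norm \<nu> = 1" and \<phi>: "C11_function \<phi>"
    and graph: "\<Omega> \<inter> ball z r0 = {x \<in> ball z r0. x \<bullet> \<nu> > \<phi> (x - (x \<bullet> \<nu>) *\<^sub>R \<nu>)}"
    using dom unfolding bounded_C11_domain_def by (elim conjE ballE exE) auto
  obtain g L where g: "\<And>x. (\<phi> has_derivative (\<lambda>h. g x \<bullet> h)) (at x)" and L: "L-lipschitz_on UNIV g"
    using \<phi> unfolding C11_function_def by blast
  define P where "P x = x - (x \<bullet> \<nu>) *\<^sub>R \<nu>" for x
  \<comment> \<open>\<open>R\<close> bounds every point of \<open>ball z r0\<close> in norm, hence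
    also its projection under \<open>P\<close>, so one Lipschitz constant on
    \<open>cball 0 R\<close> serves all of them.\<close>
  define R where "R = norm z + r0"
  define \<Lambda> where "\<Lambda> = norm (g 0) + L * R"
  have L0: "L \<ge> 0" using L by (simp add: lipschitz_on_def)
  have R0: "R > 0" using r0 by (simp add: R_def add_nonneg_pos)
  have \<Lambda>0: "\<Lambda> \<ge> 0" using L0 R0 by (simp add: \<Lambda>_def)
  have \<nu>\<nu>: "\<nu> \<bullet> \<nu> = 1" using \<nu> by (simp add: dot_square_norm)
  have Pnorm: "norm (P x) \<le> norm x" for x
  proof -
    have "P x \<bullet> P x = x \<bullet> x - (x \<bullet> \<nu>)\<^sup>2"
      by (simp add: P_def inner_diff_left inner_diff_right \<nu>\<nu> power2_eq_square inner_commute)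
    then have "P x \<bullet> P x \<le> x \<bullet> x" by simp
    then show ?thesis by (simp add: norm_le)
  qed
  have gbound: "norm (g y) \<le> \<Lambda>" if "norm y \<le> R" for y
  proof -
    have "dist (g y) (g 0) \<le> L * dist y 0"
      by (rule lipschitz_onD[OF L]) auto
    also have "\<dots> \<le> L * R" using that L0 by (simp add: mult_left_mono)
    finally have "norm (g y - g 0) \<le> L * R" by (simp add: dist_norm)
    then show ?thesis
      using norm_triangle_sub[of "g y" "g 0"] by (simp add: \<Lambda>_def)
  qed
  have Lip: "\<bar>\<phi> a - \<phi> b\<bar> \<le> \<Lambda> * norm (a - b)" if "norm a \<le> R" "norm b \<le> R" for a b
  proof -
    have "norm (\<phi> a - \<phi> b) \<le> \<Lambda> * norm (a - b)"
    proof (rule differentiable_bound[where S="cball 0 R" and f'="\<lambda>x h. g x \<bullet> h"])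
      show "(\<phi> has_derivative (\<lambda>h. g x \<bullet> h)) (at x within cball 0 R)" for x
        using g has_derivative_at_withinI by blast
      show "onorm (\<lambda>h. g x \<bullet> h) \<le> \<Lambda>" if "x \<in> cball 0 R" for x
      proof (rule onorm_le)
        fix h
        have "norm (g x \<bullet> h) \<le> norm (g x) * norm h" by (simp add: Cauchy_Schwarz_ineq2)
        also have "\<dots> \<le> \<Lambda> * norm h"
          using gbound[of x] that by (intro mult_right_mono) auto
        finally show "norm (g x \<bullet> h) \<le> \<Lambda> * norm h" .
      qed
    qed (use that in auto)
    then show ?thesis by simp
  qed
  \<comment> \<open>A displacement \<open>k\<close> with \<open>norm k < \<eta> * r\<close> raises
    the graph by at most \<open>\<Lambda> * norm k\<close> and lowers the height by at most
    \<open>norm k\<close>; this \<eta> keeps the sum within r/4, half of the lift r/2 used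
    below.\<close>
  define \<eta> where "\<eta> = 1 / (4 * (1 + \<Lambda>))"
  have \<eta>0: "\<eta> > 0" and \<eta>1: "\<eta> * (1 + \<Lambda>) = 1/4"
    using \<Lambda>0 by (auto simp: \<eta>_def)
  have \<eta>2: "\<eta> \<le> 1/4" using mult_nonneg_nonneg[of \<eta> \<Lambda>] \<Lambda>0 \<eta>0 \<eta>1 by (simp add: algebra_simps del: mult_nonneg_nonneg)
  show ?thesis
  proof (rule exI[of _ "r0/2"], intro conjI, use r0 in simp, rule exI[of _ \<eta>], intro conjI ballI allI impI)
    fix x r assume x: "x \<in> \<Omega> \<inter> ball z (r0/2)" and r: "0 < r \<and> r \<le> r0/2"
    \<comment> \<open>Lifting x by r/2 along \<nu> leaves its projection \<open>P x\<close>
      unchanged and moves it away from the graph; the Lipschitz bound then keeps a whole ball of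
      comparable radius in \<Omega>.\<close>
    have "ball (x + (r/2) *\<^sub>R \<nu>) (\<eta> * r) \<subseteq> \<Omega> \<inter> ball x r"
    proof
      fix y assume "y \<in> ball (x + (r/2) *\<^sub>R \<nu>) (\<eta> * r)"
      define k where "k = y - (x + (r/2) *\<^sub>R \<nu>)"
      have yk: "y = x + (r/2) *\<^sub>R \<nu> + k" by (simp add: k_def)
      have k: "norm k < \<eta> * r"
        using \<open>y \<in> _\<close> by (simp add: k_def dist_norm norm_minus_commute)
      have "\<eta> * r \<le> (1/4) * r" using \<eta>2 r by (intro mult_right_mono) auto
      then have k4: "norm k < r/4" using k by simp
      have "dist x y = norm ((r/2) *\<^sub>R \<nu> + k)"
        unfolding yk dist_commute[of x] by (simp add: dist_norm algebra_simps)
      also have "\<dots> \<le> r/2 + norm k"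
        using norm_triangle_ineq[of "(r/2) *\<^sub>R \<nu>" k] \<nu> r by simp
      also have "\<dots> < r" using k4 r by simp
      finally have yr: "dist x y < r" .
      have zx: "dist z x < r0/2" using x by simp
      have zy: "dist z y < r0" using zx yr r dist_triangle[of z y x] by simp
      have nx: "norm x \<le> R" using zx norm_triangle_ineq[of z "x - z"] r0 by (simp add: R_def dist_norm norm_minus_commute)
      have ny: "norm y \<le> R" using zy norm_triangle_ineq[of z "y - z"] r0 by (simp add: R_def dist_norm norm_minus_commute)
      have "P y - P x = P k" by (simp add: P_def yk inner_add_left \<nu>\<nu> algebra_simps)
      then have "\<bar>\<phi> (P y) - \<phi> (P x)\<bar> \<le> \<Lambda> * norm (P k)"
        using Lip[of "P y" "P x"] Pnorm[of x] Pnorm[of y] nx ny by simp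
      also have "\<dots> \<le> \<Lambda> * norm k" using Pnorm \<Lambda>0 by (simp add: mult_left_mono)
      finally have 1: "\<phi> (P y) \<le> \<phi> (P x) + \<Lambda> * norm k" by simp
      have "x \<in> \<Omega> \<inter> ball z r0" using x r0 by auto
      then have 2: "\<phi> (P x) < x \<bullet> \<nu>" using graph by (simp add: P_def)
      have "\<bar>k \<bullet> \<nu>\<bar> \<le> norm k" using Cauchy_Schwarz_ineq2[of k \<nu>] \<nu> by simp
      then have 3: "y \<bullet> \<nu> \<ge> x \<bullet> \<nu> + r/2 - norm k" by (simp add: yk inner_add_left \<nu>\<nu>)
      have "(1 + \<Lambda>) * norm k \<le> (1 + \<Lambda>) * (\<eta> * r)" using k \<Lambda>0 by (intro mult_left_mono) auto
      also have "\<dots> = r/4" using arg_cong[OF \<eta>1, of "\<lambda>t. t * r"] by (simp add: algebra_simps)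
      finally have "\<Lambda> * norm k + norm k \<le> r/4" by (simp add: algebra_simps)
      then have "\<phi> (P y) < y \<bullet> \<nu>" using 1 2 3 r by linarith
      then have "y \<in> \<Omega> \<inter> ball z r0" using graph zy by (simp add: P_def)
      then show "y \<in> \<Omega> \<inter> ball x r" using yr by simp
    qed
    then show "\<exists>y. ball y (\<eta> * r) \<subseteq> \<Omega> \<inter> ball x r" by blast
  qed (rule \<eta>0)
qed

text \<open>Covering the compact closure, boundary included, by the local neighbourhoods leaves
  finitely many pairs of constants, whose minima stay positive. This uniformity makes the averaging
  constant the same at every point of \<Omega>.\<close>

lemma interior_ball_condition:
  fixes \<Omega> :: "(real^'n) set"
  assumes dom: "bounded_C11_domain \<Omega>"
  obtains \<rho> \<eta> where "\<rho> > 0" "\<eta> > 0"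
    "\<And>x r. x \<in> \<Omega> \<Longrightarrow> 0 < r \<Longrightarrow> r \<le> \<rho> \<Longrightarrow> \<exists>y. ball y (\<eta> * r) \<subseteq> \<Omega> \<inter> ball x r"
proof -
  obtain \<rho> \<eta> where pos: "\<And>z. z \<in> closure \<Omega> \<Longrightarrow> \<rho> z > 0 \<and> \<eta> z > (0::real)"
    and loc: "\<And>z x r. z \<in> closure \<Omega> \<Longrightarrow> x \<in> \<Omega> \<inter> ball z (\<rho> z) \<Longrightarrow> 0 < r \<Longrightarrow> r \<le> \<rho> z \<Longrightarrow>
       \<exists>y. ball y (\<eta> z * r) \<subseteq> \<Omega> \<inter> ball x r"
    using interior_ball_condition_local[OF dom] by metis
  have "compact (closure \<Omega>)" using dom by (simp add: bounded_C11_domain_def)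
  moreover have "closure \<Omega> \<subseteq> (\<Union>z\<in>closure \<Omega>. ball z (\<rho> z))" using pos by force
  ultimately obtain Z where Z: "Z \<subseteq> closure \<Omega>" "finite Z" "closure \<Omega> \<subseteq> (\<Union>z\<in>Z. ball z (\<rho> z))"
    using compactE_image[of "closure \<Omega>" "closure \<Omega>" "\<lambda>z. ball z (\<rho> z)"] by (metis open_ball)
  have "\<Omega> \<noteq> {}" using dom by (simp add: bounded_C11_domain_def)
  then have "Z \<noteq> {}" using Z(3) closure_subset by fastforce
  define \<rho>' \<eta>' where "\<rho>' = Min (\<rho> ` Z)" and "\<eta>' = Min (\<eta> ` Z)"
  have "\<rho>' > 0" "\<eta>' > 0" using Z pos \<open>Z \<noteq> {}\<close> by (auto simp: \<rho>'_def \<eta>'_def)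
  moreover have "\<exists>y. ball y (\<eta>' * r) \<subseteq> \<Omega> \<inter> ball x r" if xr: "x \<in> \<Omega>" "0 < r" "r \<le> \<rho>'" for x r
  proof -
    have "x \<in> closure \<Omega>" using xr(1) closure_subset by blast
    then obtain z where z: "z \<in> Z" "x \<in> ball z (\<rho> z)" using Z(3) by auto
    have "\<rho>' \<le> \<rho> z" "\<eta>' \<le> \<eta> z" using Z z by (auto simp: \<rho>'_def \<eta>'_def)
    moreover have "z \<in> closure \<Omega>" using z Z by blast
    ultimately obtain y where "ball y (\<eta> z * r) \<subseteq> \<Omega> \<inter> ball x r"
      using loc[of z x r] z xr by auto
    moreover have "ball y (\<eta>' * r) \<subseteq> ball y (\<eta> z * r)"
      using \<open>\<eta>' \<le> \<eta> z\<close> xr by (intro subset_ball mult_right_mono) auto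
    ultimately show ?thesis by blast
  qed
  ultimately show thesis using that by blast
qed

section \<open>Measurability and null sets on the product space\<close>

lemma measurable_fst_lebesgue:
  "fst \<in> (lebesgue :: ('a::euclidean_space \<times> 'b::euclidean_space) measure) \<rightarrow>\<^sub>M lebesgue"
proof (rule completion.measurable_completion2)
  show fst': "fst \<in> (lebesgue :: ('a \<times> 'b) measure) \<rightarrow>\<^sub>M lborel"
    by (rule measurable_completion) (simp add: measurable_lborel2 borel_measurable_continuous_onI continuous_on_fst continuous_on_snd continuous_on_id)
  show "null_sets lborel \<subseteq> null_sets (distr lebesgue lborel (fst :: 'a \<times> 'b \<Rightarrow> 'a))"
  proof
    fix N :: "'a set" assume N: "N \<in> null_sets lborel"
    \<comment> \<open>For a map between completed measures, preimages of null sets must be null;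
      here the reason is 0 * \<infinity> = 0 for the measure of a null strip.\<close>
    have "emeasure (lborel \<Otimes>\<^sub>M (lborel::'b measure)) (N \<times> UNIV) = 0"
      using N by (subst lborel.emeasure_pair_measure_Times) auto
    then have "emeasure lborel (N \<times> (UNIV::'b set)) = 0" by (simp add: lborel_prod)
    moreover have "fst -` N = N \<times> (UNIV::'b set)" by auto
    ultimately show "N \<in> null_sets (distr lebesgue lborel (fst :: 'a \<times> 'b \<Rightarrow> 'a))"
      using N fst' borel_Times[of N "UNIV :: 'b set"]
      by (auto simp: null_sets_def emeasure_distr)
  qed
qed

lemma measurable_snd_lebesgue:
  "snd \<in> (lebesgue :: ('a::euclidean_space \<times> 'b::euclidean_space) measure) \<rightarrow>\<^sub>M lebesgue"
proof (rule completion.measurable_completion2)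
  show snd': "snd \<in> (lebesgue :: ('a \<times> 'b) measure) \<rightarrow>\<^sub>M lborel"
    by (rule measurable_completion) (simp add: measurable_lborel2 borel_measurable_continuous_onI continuous_on_fst continuous_on_snd continuous_on_id)
  show "null_sets lborel \<subseteq> null_sets (distr lebesgue lborel (snd :: 'a \<times> 'b \<Rightarrow> 'b))"
  proof
    fix N :: "'b set" assume N: "N \<in> null_sets lborel"
    have "emeasure (lborel \<Otimes>\<^sub>M (lborel::'b measure)) ((UNIV::'a set) \<times> N) = 0"
      using N by (subst lborel.emeasure_pair_measure_Times) auto
    then have "emeasure lborel ((UNIV::'a set) \<times> N) = 0" by (simp add: lborel_prod)
    moreover have "snd -` N = (UNIV::'a set) \<times> N" by auto
    ultimately show "N \<in> null_sets (distr lebesgue lborel (snd :: 'a \<times> 'b \<Rightarrow> 'b))"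
      using N snd' borel_Times[of "UNIV :: 'a set" N]
      by (auto simp: null_sets_def emeasure_distr)
  qed
qed

text \<open>Allows a Lebesgue measurable function to be replaced by a Borel representative inside
  the Gagliardo density, which looks at two points at once.\<close>

lemma AE_lebesgue_pair:
  fixes P :: "'a::euclidean_space \<Rightarrow> bool"
  assumes "AE x in lborel. P x"
  shows "AE z in (lebesgue :: ('a \<times> 'a) measure). P (fst z) \<and> P (snd z)"
proof -
  obtain N where N: "N \<in> null_sets lborel" "{x. \<not> P x} \<subseteq> N"
    using assms by (auto elim!: AE_E simp: null_sets_def)
  have 1: "N \<times> UNIV \<in> null_sets (lborel :: ('a \<times> 'a) measure)"
    using N(1) lborel.emeasure_pair_measure_Times[of N lborel UNIV]
    by (auto simp: null_sets_def lborel_prod intro: borel_Times)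
  have 2: "UNIV \<times> N \<in> null_sets (lborel :: ('a \<times> 'a) measure)"
    using N(1) lborel.emeasure_pair_measure_Times[of UNIV lborel N]
    by (auto simp: null_sets_def lborel_prod intro: borel_Times)
  have "AE z in (lborel :: ('a \<times> 'a) measure). z \<notin> N \<times> UNIV \<and> z \<notin> UNIV \<times> N"
    using AE_not_in[OF 1] AE_not_in[OF 2] by (rule eventually_conj)
  then have "AE z in (lborel :: ('a \<times> 'a) measure). P (fst z) \<and> P (snd z)"
    by (rule eventually_mono) (use N(2) in \<open>auto simp: mem_Times_iff\<close>)
  then show ?thesis by (rule AE_completion)
qed

lemma borel_measurable_gagliardo_density_borel [measurable]:
  fixes u v :: "real^'n \<Rightarrow> real"
  assumes [measurable]: "u \<in> borel_measurable borel" "v \<in> borel_measurable borel"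
  shows "gagliardo_density s u v \<in> borel_measurable borel"
  unfolding gagliardo_density_def borel_prod[symmetric] by measurable

lemma borel_measurable_gagliardo_density [measurable]:
  fixes u v :: "real^'n \<Rightarrow> real"
  assumes u: "u \<in> borel_measurable lebesgue" and v: "v \<in> borel_measurable lebesgue"
  shows "gagliardo_density s u v \<in> borel_measurable lebesgue"
proof -
  note [measurable] = measurable_compose[OF measurable_fst_lebesgue u]
    measurable_compose[OF measurable_snd_lebesgue u]
    measurable_compose[OF measurable_fst_lebesgue v]
    measurable_compose[OF measurable_snd_lebesgue v]
  have "(\<lambda>z. norm (fst z - snd z) powr (real CARD('n) + 2 * s)) \<in> borel_measurable (lborel :: ((real^'n)\<times>(real^'n)) measure)"
    unfolding borel_prod[symmetric] measurable_lborel2 by measurable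
  note [measurable] = measurable_completion[OF this]
  show ?thesis
    unfolding gagliardo_density_def case_prod_beta by measurable
qed

lemma T_set_borel: "open \<Omega> \<Longrightarrow> T_set \<Omega> \<in> sets borel"
  unfolding T_set_def by (intro sets.Diff borel_Times) auto

section \<open>The truncated kernel\<close>

text \<open>Majorant of the Gagliardo density of a tent of radius \<delta>: the constant 1 gives
  integrability at infinity, the quadratic factor, which reflects the Lipschitz bound, gives it at
  the origin. At z = 0 division by zero yields 0.\<close>

definition trunc_kernel :: "real \<Rightarrow> real \<Rightarrow> real^'n \<Rightarrow> real" where
  "trunc_kernel s \<delta> z = min 1 ((norm z / \<delta>)\<^sup>2) / norm z powr (real CARD('n) + 2 * s)"

lemma trunc_kernel_nonneg: "0 \<le> trunc_kernel s \<delta> z"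
  by (simp add: trunc_kernel_def)

lemma borel_measurable_trunc_kernel [measurable]: "trunc_kernel s \<delta> \<in> borel_measurable borel"
  unfolding trunc_kernel_def by measurable

text \<open>Each z \<noteq> 0 lies in a dyadic shell, \<delta> 2^k \<le> |z| < \<delta> 2^(k+1) or
  \<delta> 2^(-k-1) \<le> |z| < \<delta> 2^(-k), on which the kernel is at most a constant. Taking
  full balls instead of shells loses a bounded factor and replaces polar coordinates by ball
  volumes.\<close>

lemma trunc_kernel_le_dyadic_sum:
  fixes z :: "real^'n" and s \<delta> :: real
  assumes n: "CARD('n) \<ge> 2" and s: "0 < s" "s < 1" and \<delta>: "\<delta> > 0"
  defines "N \<equiv> real CARD('n)"
  shows "ennreal (trunc_kernel s \<delta> z) \<le>
    (\<Sum>k. ennreal ((\<delta> * 2 powr real k) powr (-(N+2 * s))) * indicator (ball 0 (\<delta> * 2 powr (real k + 1))) z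
       + ennreal (\<delta> powr (-(N+2 * s)) * 2 powr ((real k + 1) * (N+2 * s-2)))
           * indicator (ball 0 (\<delta> * 2 powr (- real k))) z)"
    (is "_ \<le> (\<Sum>k. ?A k + ?B k)")
proof -
  have N2: "N \<ge> 2" using n by (simp add: N_def)
  have le_sum: "?A k + ?B k \<le> (\<Sum>k. ?A k + ?B k)" for k
    using sum_le_suminf[of "\<lambda>k. ?A k + ?B k" "{k}"] by (simp add: summableI)
  consider "z = 0" | "norm z \<ge> \<delta>" | "z \<noteq> 0" "norm z < \<delta>" by linarith
  then show ?thesis
  proof cases
    case 1
    then show ?thesis by (simp add: trunc_kernel_def)
  next
    case 2
    define t where "t = log 2 (norm z / \<delta>)"
    define k where "k = nat \<lfloor>t\<rfloor>"
    have zpos: "norm z > 0" using 2 \<delta> by linarith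
    have t0: "t \<ge> 0" using 2 \<delta> zpos by (simp add: t_def zero_le_log_cancel_iff)
    have kt: "real k \<le> t" "t < real k + 1" using t0 by (auto simp: k_def)
    have zt: "norm z = \<delta> * 2 powr t" using zpos \<delta> by (simp add: t_def)
    have in_ball: "z \<in> ball 0 (\<delta> * 2 powr (real k + 1))"
      using kt \<delta> by (simp add: zt)
    have "trunc_kernel s \<delta> z \<le> 1 / norm z powr (N + 2 * s)"
      unfolding trunc_kernel_def N_def by (intro divide_right_mono) auto
    also have "\<dots> = norm z powr (-(N + 2 * s))" by (rule powr_minus_divide[symmetric])
    also have "\<dots> \<le> (\<delta> * 2 powr real k) powr (-(N+2 * s))"
      using kt \<delta> N2 s by (intro powr_mono2') (auto simp: zt)
    finally have "ennreal (trunc_kernel s \<delta> z) \<le> ?A k"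
      using in_ball by (simp add: ennreal_leI)
    also have "\<dots> \<le> ?A k + ?B k" by simp
    also note le_sum
    finally show ?thesis .
  next
    case 3
    define t where "t = - log 2 (norm z / \<delta>)"
    \<comment> \<open>Ceiling minus one, not floor: \<open>k < t\<close> must be strict for z to lie
      in the open ball of radius \<delta> 2^(-k).\<close>
    define k where "k = nat (\<lceil>t\<rceil> - 1)"
    have zpos: "norm z > 0" using 3 by simp
    have "norm z / \<delta> < 1" "norm z / \<delta> > 0" using 3 \<delta> by auto
    then have t0: "t > 0" unfolding t_def by (simp add: log_less_zero_cancel_iff)
    have kt: "real k < t" "t \<le> real k + 1"
      using t0 by (simp_all add: k_def of_nat_nat) linarith+
    have zt: "norm z = \<delta> * 2 powr (-t)" using zpos \<delta> by (simp add: t_def)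
    have in_ball: "z \<in> ball 0 (\<delta> * 2 powr (- real k))"
      using kt \<delta> by (simp add: zt)
    have "trunc_kernel s \<delta> z \<le> (norm z / \<delta>)\<^sup>2 / norm z powr (N + 2 * s)"
      unfolding trunc_kernel_def N_def by (intro divide_right_mono) auto
    also have "\<dots> = (2 powr (-t))\<^sup>2 * (\<delta> * 2 powr (-t)) powr (-(N + 2 * s))"
      using \<delta> unfolding zt powr_minus_divide[of _ "N + 2 * s"] by simp
    also have "\<dots> = \<delta> powr (-(N+2 * s)) * 2 powr (t * (N+2 * s-2))"
    proof -
      have "(2 powr (-t))\<^sup>2 = 2 powr (-2 * t)" by (simp add: power2_eq_square powr_add[symmetric])
      moreover have "(\<delta> * 2 powr (-t)) powr (-(N + 2 * s)) = \<delta> powr (-(N+2 * s)) * 2 powr (t * (N + 2 * s))"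
        using \<delta> by (simp add: powr_mult powr_powr algebra_simps)
      moreover have "2 powr (-2 * t) * 2 powr (t * (N + 2 * s)) = 2 powr (t * (N + 2 * s - 2))"
        by (simp add: powr_add[symmetric] algebra_simps)
      ultimately show ?thesis by simp
    qed
    \<comment> \<open>The exponent N + 2s - 2 is nonnegative because n \<ge> 2, so t may be raised
      to k + 1.\<close>
    also have "\<dots> \<le> \<delta> powr (-(N+2 * s)) * 2 powr ((real k + 1) * (N+2 * s-2))"
      using kt N2 s by (intro mult_left_mono powr_mono mult_right_mono) auto
    finally have "ennreal (trunc_kernel s \<delta> z) \<le> ?B k"
      using in_ball by (simp add: ennreal_leI)
    also have "\<dots> \<le> ?A k + ?B k" by simp
    also note le_sum
    finally show ?thesis .
  qed
qed

text \<open>The outer balls form a geometric series of ratio 2^(-2s), the inner ones of ratio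
  2^(2s-2); both converge because 0 < s < 1. Every term carries \<delta>^(-2s), the scaling of the
  kernel, so \<open>K\<close> is independent of \<delta>.\<close>

lemma nn_integral_trunc_kernel_le:
  fixes s :: real
  assumes n: "CARD('n) \<ge> 2" and s: "0 < s" "s < 1"
  obtains K where "K > 0"
    "\<And>\<delta>. \<delta> > 0 \<Longrightarrow> (\<integral>\<^sup>+z. ennreal (trunc_kernel s \<delta> (z::real^'n)) \<partial>lborel) \<le> ennreal (K * \<delta> powr (-2 * s))"
proof -
  define N where "N = real CARD('n)"
  define V where "V = unit_ball_vol N"
  have V: "V > 0" by (simp add: V_def N_def)
  define q1 q2 where "q1 = 2 powr (-2 * s)" and "q2 = 2 powr (2 * s-2)"
  have q: "0 < q1" "q1 < 1" "0 < q2" "q2 < 1" using s by (auto simp: q1_def q2_def powr_less_one)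
  define c1 c2 where "c1 = V * 2 powr N" and "c2 = V * 2 powr (N+2 * s-2)"
  define K where "K = c1 * (1/(1-q1)) + c2 * (1/(1-q2))"
  have c: "c1 > 0" "c2 > 0" using V by (auto simp: c1_def c2_def)
  have K: "K > 0" using c q by (auto simp: K_def intro!: add_pos_pos)
  have vol: "emeasure lborel (ball (0::real^'n) r) = ennreal (V * r powr N)" if "r > 0" for r
    using that emeasure_ball[of r "0::real^'n"] by (simp add: V_def N_def powr_realpow)
  have "(\<integral>\<^sup>+z. ennreal (trunc_kernel s \<delta> (z::real^'n)) \<partial>lborel) \<le> ennreal (K * \<delta> powr (-2 * s))"
    if \<delta>: "\<delta> > 0" for \<delta>
  proof -
    let ?A = "\<lambda>k (z::real^'n). ennreal ((\<delta> * 2 powr real k) powr (-(N+2 * s))) * indicator (ball 0 (\<delta> * 2 powr (real k + 1))) z"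
    let ?B = "\<lambda>k (z::real^'n). ennreal (\<delta> powr (-(N+2 * s)) * 2 powr ((real k + 1) * (N+2 * s-2)))
           * indicator (ball 0 (\<delta> * 2 powr (- real k))) z"
    have A: "(\<integral>\<^sup>+z. ?A k z \<partial>lborel) = ennreal (\<delta> powr (-2 * s) * (c1 * q1 ^ k))" for k
    proof -
      have "(\<integral>\<^sup>+z. ?A k z \<partial>lborel) = ennreal ((\<delta> * 2 powr real k) powr (-(N+2 * s)) * (V * (\<delta> * 2 powr (real k + 1)) powr N))"
        using \<delta> V by (simp add: nn_integral_cmult_indicator vol ennreal_mult)
      also have "(\<delta> * 2 powr real k) powr (-(N+2 * s)) * (V * (\<delta> * 2 powr (real k + 1)) powr N)
        = V * (\<delta> powr (-(N+2 * s)) * \<delta> powr N) * (2 powr (- real k * (N+2 * s)) * 2 powr ((real k + 1) * N))"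
        using \<delta> by (simp add: powr_mult powr_powr algebra_simps)
      also have "\<dots> = V * \<delta> powr (-2 * s) * (2 powr (N + real k * (-2 * s)))"
        by (simp add: powr_add[symmetric] algebra_simps)
      also have "2 powr (N + real k * (-2 * s)) = 2 powr N * q1 ^ k"
        unfolding powr_add[of 2 N] by (simp add: q1_def powr_powr powr_realpow[symmetric] mult.commute)
      finally show ?thesis by (simp add: c1_def mult_ac)
    qed
    have B: "(\<integral>\<^sup>+z. ?B k z \<partial>lborel) = ennreal (\<delta> powr (-2 * s) * (c2 * q2 ^ k))" for k
    proof -
      have "(\<integral>\<^sup>+z. ?B k z \<partial>lborel) = ennreal (\<delta> powr (-(N+2 * s)) * 2 powr ((real k + 1) * (N+2 * s-2)) * (V * (\<delta> * 2 powr (- real k)) powr N))"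
        using \<delta> V by (simp add: nn_integral_cmult_indicator vol ennreal_mult)
      also have "\<delta> powr (-(N+2 * s)) * 2 powr ((real k + 1) * (N+2 * s-2)) * (V * (\<delta> * 2 powr (- real k)) powr N)
        = V * (\<delta> powr (-(N+2 * s)) * \<delta> powr N) * (2 powr ((real k + 1) * (N+2 * s-2)) * 2 powr (- real k * N))"
        using \<delta> by (simp add: powr_mult powr_powr algebra_simps)
      also have "\<dots> = V * \<delta> powr (-2 * s) * (2 powr ((N+2 * s-2) + real k * (2 * s-2)))"
        by (simp add: powr_add[symmetric] algebra_simps)
      also have "2 powr ((N+2 * s-2) + real k * (2 * s-2)) = 2 powr (N+2 * s-2) * q2 ^ k"
        unfolding powr_add[of 2 "N+2 * s-2"] by (simp add: q2_def powr_powr powr_realpow[symmetric] mult.commute)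
      finally show ?thesis by (simp add: c2_def mult_ac)
    qed
    have mA: "?A k \<in> borel_measurable lborel" and mB: "?B k \<in> borel_measurable lborel" for k
      by (intro borel_measurable_times_ennreal borel_measurable_indicator borel_measurable_const; simp)+
    have sums: "(\<lambda>k. \<delta> powr (-2 * s) * (c1 * q1 ^ k) + \<delta> powr (-2 * s) * (c2 * q2 ^ k)) sums
        (\<delta> powr (-2 * s) * (c1 * (1/(1-q1))) + \<delta> powr (-2 * s) * (c2 * (1/(1-q2))))"
      using q by (intro sums_add sums_mult geometric_sums) auto
    have "(\<integral>\<^sup>+z. ennreal (trunc_kernel s \<delta> (z::real^'n)) \<partial>lborel) \<le> (\<integral>\<^sup>+z. (\<Sum>k. ?A k z + ?B k z) \<partial>lborel)"
      unfolding N_def by (intro nn_integral_mono trunc_kernel_le_dyadic_sum n s \<delta>)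
    also have "\<dots> = (\<Sum>k. \<integral>\<^sup>+z. ?A k z + ?B k z \<partial>lborel)"
      by (intro nn_integral_suminf borel_measurable_add mA mB)
    also have "\<dots> = (\<Sum>k. ennreal (\<delta> powr (-2 * s) * (c1 * q1 ^ k)) + ennreal (\<delta> powr (-2 * s) * (c2 * q2 ^ k)))"
      by (simp only: nn_integral_add[OF mA mB] A B)
    also have "\<dots> = (\<Sum>k. ennreal (\<delta> powr (-2 * s) * (c1 * q1 ^ k) + \<delta> powr (-2 * s) * (c2 * q2 ^ k)))"
      using c q by (simp add: ennreal_plus)
    also have "\<dots> = ennreal (\<delta> powr (-2 * s) * (c1 * (1/(1-q1))) + \<delta> powr (-2 * s) * (c2 * (1/(1-q2))))"
      using c q by (intro suminf_ennreal_eq[OF _ sums]) simp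
    also have "\<delta> powr (-2 * s) * (c1 * (1/(1-q1))) + \<delta> powr (-2 * s) * (c2 * (1/(1-q2))) = K * \<delta> powr (-2 * s)"
      by (simp add: K_def algebra_simps)
    finally show ?thesis by simp
  qed
  then show thesis using that K by blast
qed

section \<open>Positivity of the normalising constant\<close>

lemma one_minus_cos_le: "1 - cos t \<le> 2 * min 1 (t\<^sup>2)" for t :: real
proof -
  have "1 - cos t = 2 * (sin (t/2))\<^sup>2"
    using cos_double_sin[of "t/2"] by simp
  moreover have "(sin (t/2))\<^sup>2 \<le> (t/2)\<^sup>2"
    using abs_sin_x_le_abs_x[of "t/2"] unfolding abs_le_square_iff .
  moreover have "(t/2)\<^sup>2 \<le> t\<^sup>2" by (simp add: power_divide)
  moreover have "cos t \<ge> -1" by simp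
  ultimately show ?thesis unfolding min_def by (simp only: split: if_split) linarith
qed

text \<open>Convergence is part of the claim: the integral of a non-integrable function would be 0,
  and so would its inverse. The bound on 1 - cos compares the integrand with twice the truncated
  kernel of radius 1.\<close>

lemma frac_lap_const_pos:
  assumes n: "CARD('n::finite) \<ge> 2" and s: "0 < s" "s < 1"
  shows "frac_lap_const TYPE('n) s > 0"
proof -
  define i :: 'n where "i = (SOME i. True)"
  define f where "f x = (1 - cos (x $ i)) / norm x powr (real CARD('n) + 2 * s)" for x :: "real^'n"
  obtain K where K: "K > 0"
    "\<And>\<delta>. \<delta> > 0 \<Longrightarrow> (\<integral>\<^sup>+z. ennreal (trunc_kernel s \<delta> (z::real^'n)) \<partial>lborel) \<le> ennreal (K * \<delta> powr (-2 * s))"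
    using nn_integral_trunc_kernel_le[OF n s] by blast
  have f0: "f x \<ge> 0" for x by (simp add: f_def)
  have fle: "f x \<le> 2 * trunc_kernel s 1 x" for x
  proof -
    have "(x $ i)\<^sup>2 \<le> (norm x)\<^sup>2" using component_le_norm_cart[of x i] by (simp add: abs_le_square_iff[symmetric])
    then have "1 - cos (x $ i) \<le> 2 * min 1 ((norm x)\<^sup>2)"
      using one_minus_cos_le[of "x $ i"] by (simp add: min_def split: if_splits)
    then show ?thesis
      unfolding f_def trunc_kernel_def by (simp add: divide_right_mono)
  qed
  have fb [measurable]: "f \<in> borel_measurable borel"
    unfolding f_def by measurable
  have "(\<integral>\<^sup>+x. ennreal (f x) \<partial>lborel) \<le> (\<integral>\<^sup>+x. ennreal 2 * ennreal (trunc_kernel s 1 (x::real^'n)) \<partial>lborel)"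
    by (intro nn_integral_mono) (simp add: fle ennreal_leI ennreal_mult'[symmetric] trunc_kernel_nonneg del: ennreal_numeral)
  also have "\<dots> = ennreal 2 * (\<integral>\<^sup>+x. ennreal (trunc_kernel s 1 (x::real^'n)) \<partial>lborel)"
    by (rule nn_integral_cmult) measurable
  also have "\<dots> \<le> ennreal 2 * ennreal (K * 1 powr (-2 * s))" by (intro mult_left_mono K) auto
  also have "\<dots> < \<infinity>" by (simp add: ennreal_mult_less_top)
  finally have int: "integrable lborel f"
    by (intro integrableI_nonneg) (auto simp: f0)
  have "(\<integral>x. f x \<partial>lborel) \<noteq> 0"
  proof
    assume "(\<integral>x. f x \<partial>lborel) = 0"
    then have "AE x in lborel. f x = 0"
      using integral_nonneg_eq_0_iff_AE[OF int] f0 by simp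
    \<comment> \<open>On this ball the coordinate lies in (1/2, 3/2), inside (0, pi), where cos is
      strictly below 1; the integrand is thus positive on a set of positive measure.\<close>
    moreover have "f x \<noteq> 0" if "x \<in> ball (axis i 1) (1/2)" for x
    proof -
      have "\<bar>(axis i 1 - x) $ i\<bar> < 1/2"
        using that component_le_norm_cart[of "axis i 1 - x" i] by (simp add: dist_norm)
      then have "\<bar>1 - x $ i\<bar> < 1/2" by (simp add: axis_def)
      then have x: "1/2 < x $ i" "x $ i < 3/2" by linarith+
      have "x $ i < pi" using x pi_gt3 by linarith
      then have "cos (x $ i) < cos 0" using x by (intro cos_monotone_0_pi) auto
      moreover have "x \<noteq> 0" using x by auto
      ultimately show ?thesis by (simp add: f_def)
    qed
    ultimately have "AE x in lborel. x \<notin> ball (axis i 1 :: real^'n) (1/2)"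
      by (elim eventually_mono) blast
    then have "emeasure lborel (ball (axis i 1 :: real^'n) (1/2)) = 0"
      by (subst (asm) AE_iff_null_sets[symmetric]) auto
    then show False using unit_ball_vol_pos[of "real CARD('n)"] by (simp add: emeasure_ball)
  qed
  moreover have "(\<integral>x. f x \<partial>lborel) \<ge> 0" using f0 by simp
  ultimately have "(\<integral>x. f x \<partial>lborel) > 0" by simp
  then have "inverse (\<integral>x. f x \<partial>lebesgue) > 0" by (simp add: integral_completion)
  then show ?thesis by (simp add: frac_lap_const_def f_def i_def)
qed

section \<open>Tent functions\<close>

lemma nn_integral_lborel_reflect:
  fixes f :: "'a::euclidean_space \<Rightarrow> ennreal"
  assumes [measurable]: "f \<in> borel_measurable borel"
  shows "(\<integral>\<^sup>+y. f (x - y) \<partial>lborel) = (\<integral>\<^sup>+y. f y \<partial>lborel)"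
  by (subst (2) lborel_affine[of "-1" x]) (simp_all add: nn_integral_density nn_integral_distr)

lemma nn_integral_lborel_translate:
  fixes f :: "'a::euclidean_space \<Rightarrow> ennreal"
  assumes [measurable]: "f \<in> borel_measurable borel"
  shows "(\<integral>\<^sup>+y. f (y - x) \<partial>lborel) = (\<integral>\<^sup>+y. f y \<partial>lborel)"
  by (subst (2) lborel_affine[of 1 "- x"]) (simp_all add: nn_integral_density nn_integral_distr)

text \<open>The density is bounded over the whole product instead of over
  \<open>T_set \<Omega>\<close>, so that Tonelli applies to tents without splitting the
  domain.\<close>

lemma Hs_memI_borel:
  fixes u :: "real^'n \<Rightarrow> real"
  assumes u[measurable]: "u \<in> borel_measurable borel" and "open \<Omega>"
    and "(\<integral>\<^sup>+x. ennreal (indicator \<Omega> x * (u x)\<^sup>2) \<partial>lborel) < \<infinity>"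
    and G: "(\<integral>\<^sup>+z. ennreal (gagliardo_density s u u z) \<partial>lborel) \<le> ennreal B" and "B \<ge> 0"
  shows "u \<in> Hs \<Omega> s" and "gagliardo_form \<Omega> s u u \<le> B"
proof -
  have [measurable]: "\<Omega> \<in> sets borel" using \<open>open \<Omega>\<close> by simp
  have nonneg: "gagliardo_density s u u z \<ge> 0" for z
    by (simp add: gagliardo_density_def split: prod.split)
  have "integrable lborel (\<lambda>x. indicator \<Omega> x * (u x)\<^sup>2)"
    using assms(3) by (intro integrableI_nonneg) auto
  then have 1: "set_integrable lebesgue \<Omega> (\<lambda>x. (u x)\<^sup>2)"
    by (simp add: set_integrable_def integrable_completion)
  have meas: "(\<lambda>z. indicator (T_set \<Omega>) z * gagliardo_density s u u z) \<in> borel_measurable lborel"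
    using T_set_borel[OF \<open>open \<Omega>\<close>] by simp
  have le: "(\<integral>\<^sup>+z. ennreal (indicator (T_set \<Omega>) z * gagliardo_density s u u z) \<partial>lborel) \<le> ennreal B"
    by (rule order_trans[OF nn_integral_mono G]) (auto simp: nonneg indicator_def intro!: ennreal_leI)
  have int: "integrable lborel (\<lambda>z. indicator (T_set \<Omega>) z * gagliardo_density s u u z)"
    using meas order_le_less_trans[OF le] nonneg by (intro integrableI_nonneg) auto
  then have 2: "set_integrable lebesgue (T_set \<Omega>) (gagliardo_density s u u)"
    using meas by (simp add: set_integrable_def integrable_completion)
  show "u \<in> Hs \<Omega> s"
    using 1 2 u by (auto simp: Hs_def intro: measurable_completion)
  have "gagliardo_form \<Omega> s u u = (\<integral>z. indicator (T_set \<Omega>) z * gagliardo_density s u u z \<partial>lborel)"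
    using meas by (simp add: gagliardo_form_def set_lebesgue_integral_def integral_completion)
  moreover have "ennreal (\<integral>z. indicator (T_set \<Omega>) z * gagliardo_density s u u z \<partial>lborel) \<le> ennreal B"
    using le nn_integral_eq_integral[OF int] nonneg by simp
  ultimately show "gagliardo_form \<Omega> s u u \<le> B"
    using \<open>B \<ge> 0\<close> by simp
qed

definition tent :: "real^'n \<Rightarrow> real \<Rightarrow> real^'n \<Rightarrow> real" where
  "tent x0 \<delta> x = max 0 (1 - dist x0 x / \<delta>)"

lemma borel_measurable_tent [measurable]: "tent x0 \<delta> \<in> borel_measurable borel"
  unfolding tent_def by measurable

lemma tent_nonneg: "0 \<le> tent x0 \<delta> x"
  by (simp add: tent_def)

lemma tent_le_1: "\<delta> > 0 \<Longrightarrow> tent x0 \<delta> x \<le> 1"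
  by (simp add: tent_def)

lemma tent_eq_0: "\<delta> > 0 \<Longrightarrow> x \<notin> ball x0 \<delta> \<Longrightarrow> tent x0 \<delta> x = 0"
  by (simp add: tent_def)

lemma tent_ge_half: "\<delta> > 0 \<Longrightarrow> x \<in> ball x0 (\<delta>/2) \<Longrightarrow> 1/2 \<le> tent x0 \<delta> x"
  by (simp add: tent_def field_simps)

text \<open>Height 1 and Lipschitz constant 1/\<delta> give the minimum. The indicators record that
  the difference vanishes when both points lie outside the ball; they confine one variable to a set
  of finite measure.\<close>

lemma tent_diff_le:
  assumes \<delta>: "\<delta> > 0"
  shows "(tent x0 \<delta> x - tent x0 \<delta> y)\<^sup>2 \<le>
    (indicator (ball x0 \<delta>) x + indicator (ball x0 \<delta>) y) * min 1 ((norm (x - y) / \<delta>)\<^sup>2)"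
proof -
  have "\<bar>tent x0 \<delta> x - tent x0 \<delta> y\<bar> \<le> 1"
    using tent_nonneg[of x0 \<delta> x] tent_nonneg[of x0 \<delta> y] tent_le_1[OF \<delta>, of x0 x]
      tent_le_1[OF \<delta>, of x0 y] by linarith
  then have 1: "(tent x0 \<delta> x - tent x0 \<delta> y)\<^sup>2 \<le> 1" by (simp add: abs_square_le_1)
  have "\<bar>dist x0 x - dist x0 y\<bar> \<le> norm (x - y)"
    using dist_triangle[of x0 x y] dist_triangle[of x0 y x] by (simp add: dist_norm norm_minus_commute abs_le_iff)
  then have "\<bar>dist x0 x / \<delta> - dist x0 y / \<delta>\<bar> \<le> norm (x - y) / \<delta>"
    using \<delta> by (simp add: diff_divide_distrib[symmetric] divide_right_mono)
  then have "\<bar>tent x0 \<delta> x - tent x0 \<delta> y\<bar> \<le> \<bar>norm (x - y) / \<delta>\<bar>"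
  proof -
    have "\<bar>max 0 (1 - a) - max 0 (1 - b)\<bar> \<le> \<bar>a - b\<bar>" for a b :: real by (auto simp: max_def)
    from this[of "dist x0 x / \<delta>" "dist x0 y / \<delta>"] show ?thesis
      using \<open>\<bar>dist x0 x / \<delta> - dist x0 y / \<delta>\<bar> \<le> norm (x - y) / \<delta>\<close> \<delta>
      unfolding tent_def by simp
  qed
  then have 2: "(tent x0 \<delta> x - tent x0 \<delta> y)\<^sup>2 \<le> (norm (x - y) / \<delta>)\<^sup>2"
    by (simp only: abs_le_square_iff)
  have 3: "tent x0 \<delta> x - tent x0 \<delta> y = 0" if "x \<notin> ball x0 \<delta>" "y \<notin> ball x0 \<delta>"
    using that \<delta> by (simp add: tent_eq_0)
  define m where "m = min 1 ((norm (x - y) / \<delta>)\<^sup>2)"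
  have "m \<ge> 0" "(tent x0 \<delta> x - tent x0 \<delta> y)\<^sup>2 \<le> m" using 1 2 by (auto simp: m_def)
  then show ?thesis
    using 3 unfolding m_def[symmetric] by (auto simp: indicator_def)
qed

text \<open>Each indicator confines one variable to the ball; in the other one the kernel can be
  translated to the origin, so the double integral becomes a product.\<close>

lemma nn_integral_gagliardo_tent_le:
  fixes x0 :: "real^'n"
  assumes \<delta>: "\<delta> > 0"
  shows "(\<integral>\<^sup>+z. ennreal (gagliardo_density s (tent x0 \<delta>) (tent x0 \<delta>) z) \<partial>lborel)
    \<le> 2 * emeasure lborel (ball x0 \<delta>) * (\<integral>\<^sup>+z. ennreal (trunc_kernel s \<delta> (z::real^'n)) \<partial>lborel)"
proof -
  let ?I = "\<integral>\<^sup>+z. ennreal (trunc_kernel s \<delta> (z::real^'n)) \<partial>lborel"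
  let ?B = "ball x0 \<delta>"
  let ?f = "\<lambda>z::(real^'n)\<times>(real^'n). indicator ?B (fst z) * ennreal (trunc_kernel s \<delta> (fst z - snd z))"
  let ?g = "\<lambda>z::(real^'n)\<times>(real^'n). indicator ?B (snd z) * ennreal (trunc_kernel s \<delta> (fst z - snd z))"
  have [measurable]: "?B \<in> sets borel" by simp
  have f[measurable]: "?f \<in> borel_measurable (lborel \<Otimes>\<^sub>M lborel)"
    by measurable
  have g[measurable]: "?g \<in> borel_measurable (lborel \<Otimes>\<^sub>M lborel)"
    by measurable
  have "gagliardo_density s (tent x0 \<delta>) (tent x0 \<delta>) (x, y) \<le> (indicator ?B x + indicator ?B y) * trunc_kernel s \<delta> (x - y)" for x y
    using tent_diff_le[OF \<delta>, of x0 x y]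
    by (simp add: gagliardo_density_def trunc_kernel_def power2_eq_square[symmetric] divide_right_mono)
  then have "ennreal (gagliardo_density s (tent x0 \<delta>) (tent x0 \<delta>) (x, y))
      \<le> ennreal ((indicator ?B x + indicator ?B y) * trunc_kernel s \<delta> (x - y))" for x y
    by (rule ennreal_leI)
  moreover have "ennreal ((indicator ?B x + indicator ?B y) * trunc_kernel s \<delta> (x - y)) = ?f (x, y) + ?g (x, y)" for x y
    by (simp add: ennreal_mult' trunc_kernel_nonneg ennreal_indicator distrib_right)
  ultimately have "ennreal (gagliardo_density s (tent x0 \<delta>) (tent x0 \<delta>) z) \<le> ?f z + ?g z" for z
    by (cases z) simp
  then have "(\<integral>\<^sup>+z. ennreal (gagliardo_density s (tent x0 \<delta>) (tent x0 \<delta>) z) \<partial>lborel) \<le> (\<integral>\<^sup>+z. ?f z + ?g z \<partial>lborel)"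
    by (intro nn_integral_mono)
  also have "\<dots> = (\<integral>\<^sup>+z. ?f z + ?g z \<partial>(lborel \<Otimes>\<^sub>M lborel))" by (simp add: lborel_prod)
  also have "\<dots> = (\<integral>\<^sup>+z. ?f z \<partial>(lborel \<Otimes>\<^sub>M lborel)) + (\<integral>\<^sup>+z. ?g z \<partial>(lborel \<Otimes>\<^sub>M lborel))"
    by (rule nn_integral_add[OF f g])
  also have "(\<integral>\<^sup>+z. ?f z \<partial>(lborel \<Otimes>\<^sub>M lborel)) = emeasure lborel ?B * ?I"
  proof -
    have "(\<integral>\<^sup>+z. ?f z \<partial>(lborel \<Otimes>\<^sub>M lborel)) = (\<integral>\<^sup>+x. \<integral>\<^sup>+y. ?f (x, y) \<partial>lborel \<partial>lborel)"
      by (rule lborel.nn_integral_fst[OF f, symmetric])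
    also have "\<dots> = (\<integral>\<^sup>+x. ?I * indicator ?B x \<partial>lborel)"
    proof (rule nn_integral_cong)
      fix x :: "real^'n"
      have "(\<integral>\<^sup>+y. ?f (x, y) \<partial>lborel) = indicator ?B x * (\<integral>\<^sup>+y. ennreal (trunc_kernel s \<delta> (x - y)) \<partial>lborel)"
        by (simp add: nn_integral_cmult)
      also have "(\<integral>\<^sup>+y. ennreal (trunc_kernel s \<delta> (x - y)) \<partial>lborel) = ?I"
        by (rule nn_integral_lborel_reflect) measurable
      finally show "(\<integral>\<^sup>+y. ?f (x, y) \<partial>lborel) = ?I * indicator ?B x" by (simp add: mult.commute)
    qed
    also have "\<dots> = ?I * emeasure lborel ?B" by (rule nn_integral_cmult_indicator) simp
    finally show ?thesis by (simp add: mult.commute)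
  qed
  also have "(\<integral>\<^sup>+z. ?g z \<partial>(lborel \<Otimes>\<^sub>M lborel)) = emeasure lborel ?B * ?I"
  proof -
    have "(\<integral>\<^sup>+z. ?g z \<partial>(lborel \<Otimes>\<^sub>M lborel)) = (\<integral>\<^sup>+y. \<integral>\<^sup>+x. ?g (x, y) \<partial>lborel \<partial>lborel)"
      by (rule lborel_pair.nn_integral_snd[OF g, symmetric])
    also have "\<dots> = (\<integral>\<^sup>+y. ?I * indicator ?B y \<partial>lborel)"
    proof (rule nn_integral_cong)
      fix y :: "real^'n"
      have "(\<integral>\<^sup>+x. ?g (x, y) \<partial>lborel) = indicator ?B y * (\<integral>\<^sup>+x. ennreal (trunc_kernel s \<delta> (x - y)) \<partial>lborel)"
        by (simp add: nn_integral_cmult)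
      also have "(\<integral>\<^sup>+x. ennreal (trunc_kernel s \<delta> (x - y)) \<partial>lborel) = ?I"
        by (rule nn_integral_lborel_translate) measurable
      finally show "(\<integral>\<^sup>+x. ?g (x, y) \<partial>lborel) = ?I * indicator ?B y" by (simp add: mult.commute)
    qed
    also have "\<dots> = ?I * emeasure lborel ?B" by (rule nn_integral_cmult_indicator) simp
    finally show ?thesis by (simp add: mult.commute)
  qed
  finally show ?thesis by (simp add: mult.assoc mult_2 distrib_right)
qed

text \<open>After multiplication by \<delta>^(2s) the Gagliardo form has the same order \<delta>^n
  as the other two integrals. The constants are obtained before the domain, the centre and the
  radius, hence depend on none of them.\<close>

lemma tent_energy_bounds:
  fixes s p :: real
  assumes n: "CARD('n) \<ge> 2" and s: "0 < s" "s < 1" and p: "p > 0"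
  obtains a b where "a > 0" "b > 0"
    "\<And>\<Omega> (x0::real^'n) \<delta>. open \<Omega> \<Longrightarrow> \<delta> > 0 \<Longrightarrow> ball x0 \<delta> \<subseteq> \<Omega> \<Longrightarrow>
       tent x0 \<delta> \<in> Hs \<Omega> s \<and>
       \<delta> powr (2 * s) * gagliardo_form \<Omega> s (tent x0 \<delta>) (tent x0 \<delta>) \<le> a * \<delta> ^ CARD('n) \<and>
       (LINT x:\<Omega>|lebesgue. (tent x0 \<delta> x)\<^sup>2) \<le> a * \<delta> ^ CARD('n) \<and>
       set_integrable lebesgue \<Omega> (\<lambda>x. \<bar>tent x0 \<delta> x\<bar> powr (p + 1)) \<and>
       b * \<delta> ^ CARD('n) \<le> (LINT x:\<Omega>|lebesgue. \<bar>tent x0 \<delta> x\<bar> powr (p + 1))"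
proof -
  obtain K where K: "K > 0"
    "\<And>\<delta>. \<delta> > 0 \<Longrightarrow> (\<integral>\<^sup>+z. ennreal (trunc_kernel s \<delta> (z::real^'n)) \<partial>lborel) \<le> ennreal (K * \<delta> powr (-2 * s))"
    using nn_integral_trunc_kernel_le[OF n s] by blast
  define V where "V = unit_ball_vol (real CARD('n))"
  have V: "V > 0" by (simp add: V_def)
  \<comment> \<open>\<open>2 * V * K\<close> serves the Gagliardo form and \<open>V\<close> the L2
    part; \<open>b\<close> comes from the ball of half the radius, where the tent is at least
    1/2.\<close>
  define a b where "a = 2 * V * K + V" and "b = V * (1/2) powr (p + 1) * (1/2) ^ CARD('n)"
  have ab: "a > 0" "b > 0" using V K by (auto simp: a_def b_def intro!: add_pos_pos)
  have main: "tent x0 \<delta> \<in> Hs \<Omega> s \<and>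
       \<delta> powr (2 * s) * gagliardo_form \<Omega> s (tent x0 \<delta>) (tent x0 \<delta>) \<le> a * \<delta> ^ CARD('n) \<and>
       (LINT x:\<Omega>|lebesgue. (tent x0 \<delta> x)\<^sup>2) \<le> a * \<delta> ^ CARD('n) \<and>
       set_integrable lebesgue \<Omega> (\<lambda>x. \<bar>tent x0 \<delta> x\<bar> powr (p + 1)) \<and>
       b * \<delta> ^ CARD('n) \<le> (LINT x:\<Omega>|lebesgue. \<bar>tent x0 \<delta> x\<bar> powr (p + 1))"
    if "open \<Omega>" and \<delta>: "\<delta> > 0" and sub: "ball x0 \<delta> \<subseteq> \<Omega>" for \<Omega> and x0 :: "real^'n" and \<delta>
  proof -
    have [measurable]: "\<Omega> \<in> sets borel" using \<open>open \<Omega>\<close> by simp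
    let ?\<phi> = "tent x0 \<delta>"
    let ?B = "ball x0 \<delta>"
    have vol: "emeasure lborel (ball x0 r) = ennreal (V * r ^ CARD('n))" if "r > 0" for r
      using that emeasure_ball[of r x0] by (simp add: V_def)
    have intB: "integrable lborel (indicator ?B :: _ \<Rightarrow> real)"
      using vol[OF \<delta>] by (intro integrable_real_indicator) auto
    have lintB: "(\<integral>x. indicator (ball x0 r) x \<partial>lborel) = V * r ^ CARD('n)" if "r > 0" for r
      using vol[OF that] V that by (simp add: measure_def)
    have \<phi>1: "?\<phi> x \<le> 1" "?\<phi> x \<noteq> 0 \<Longrightarrow> x \<in> ?B" for x
      using tent_le_1[OF \<delta>, of x0 x] tent_eq_0[OF \<delta>, of x x0] by auto
    have sq_le: "indicator \<Omega> x * (?\<phi> x)\<^sup>2 \<le> indicator ?B x" for x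
      using \<phi>1[of x] tent_nonneg[of x0 \<delta> x] sub by (auto simp: indicator_def power_le_one)
    have pw_le: "indicator \<Omega> x * \<bar>?\<phi> x\<bar> powr (p+1) \<le> indicator ?B x" for x
      using \<phi>1[of x] tent_nonneg[of x0 \<delta> x] sub p by (auto simp: indicator_def powr_le1)
    have int2: "integrable lborel (\<lambda>x. indicator \<Omega> x * (?\<phi> x)\<^sup>2)"
      by (rule Bochner_Integration.integrable_bound[OF intB]) (use sq_le in auto)
    have intp: "integrable lborel (\<lambda>x. indicator \<Omega> x * \<bar>?\<phi> x\<bar> powr (p+1))"
      by (rule Bochner_Integration.integrable_bound[OF intB]) (use pw_le in auto)
    have G: "(\<integral>\<^sup>+z. ennreal (gagliardo_density s ?\<phi> ?\<phi> z) \<partial>lborel) \<le> ennreal (2 * V * K * \<delta> ^ CARD('n) * \<delta> powr (-2 * s))"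
    proof -
      have "(\<integral>\<^sup>+z. ennreal (gagliardo_density s ?\<phi> ?\<phi> z) \<partial>lborel)
        \<le> 2 * emeasure lborel ?B * ennreal (K * \<delta> powr (-2 * s))"
        by (rule order_trans[OF nn_integral_gagliardo_tent_le[OF \<delta>] mult_left_mono[OF K(2)[OF \<delta>]]]) simp
      also have "\<dots> = ennreal (2 * V * K * \<delta> ^ CARD('n) * \<delta> powr (-2 * s))"
        using V K \<delta> by (simp add: vol ennreal_mult'[symmetric] ennreal_numeral[symmetric] mult_ac del: ennreal_numeral)
      finally show ?thesis .
    qed
    have l2: "(\<integral>\<^sup>+x. ennreal (indicator \<Omega> x * (?\<phi> x)\<^sup>2) \<partial>lborel) < \<infinity>"
      using int2 by (subst nn_integral_eq_integral) auto
    have B0: "2 * V * K * \<delta> ^ CARD('n) * \<delta> powr (-2 * s) \<ge> 0" using V K \<delta> by simp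
    note H = Hs_memI_borel[OF borel_measurable_tent \<open>open \<Omega>\<close> l2 G B0]
    have "\<delta> powr (2 * s) * gagliardo_form \<Omega> s ?\<phi> ?\<phi> \<le> \<delta> powr (2 * s) * (2 * V * K * \<delta> ^ CARD('n) * \<delta> powr (-2 * s))"
      using H(2) by (rule mult_left_mono) simp
    also have "\<dots> = 2 * V * K * \<delta> ^ CARD('n)"
      using \<delta> by (simp add: powr_minus)
    also have "\<dots> \<le> a * \<delta> ^ CARD('n)"
      using \<delta> V by (intro mult_right_mono) (auto simp: a_def)
    finally have g: "\<delta> powr (2 * s) * gagliardo_form \<Omega> s ?\<phi> ?\<phi> \<le> a * \<delta> ^ CARD('n)" .
    have "(LINT x:\<Omega>|lebesgue. (?\<phi> x)\<^sup>2) = (\<integral>x. indicator \<Omega> x * (?\<phi> x)\<^sup>2 \<partial>lborel)"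
      by (simp add: set_lebesgue_integral_def integral_completion)
    also have "\<dots> \<le> (\<integral>x. indicator ?B x \<partial>lborel)"
      by (rule integral_mono[OF int2 intB sq_le])
    also have "\<dots> = V * \<delta> ^ CARD('n)" by (rule lintB[OF \<delta>])
    also have "\<dots> \<le> a * \<delta> ^ CARD('n)"
      using \<delta> V K by (intro mult_right_mono) (auto simp: a_def)
    finally have q: "(LINT x:\<Omega>|lebesgue. (?\<phi> x)\<^sup>2) \<le> a * \<delta> ^ CARD('n)" .
    have "b * \<delta> ^ CARD('n) = (\<integral>x. (1/2) powr (p+1) * indicator (ball x0 (\<delta>/2)) x \<partial>lborel)"
      using \<delta> by (simp add: content_ball V_def b_def power_divide)
    also have "\<dots> \<le> (\<integral>x. indicator \<Omega> x * \<bar>?\<phi> x\<bar> powr (p+1) \<partial>lborel)"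
    proof (rule integral_mono[OF _ intp])
      show "integrable lborel (\<lambda>x. (1/2) powr (p+1) * indicator (ball x0 (\<delta>/2)) x :: real)"
        using vol[of "\<delta>/2"] \<delta> by (intro integrable_mult_right integrable_real_indicator) auto
      show "(1/2) powr (p+1) * indicator (ball x0 (\<delta>/2)) x \<le> indicator \<Omega> x * \<bar>?\<phi> x\<bar> powr (p+1)" for x
        using tent_ge_half[OF \<delta>, of x x0] p sub \<delta>
        by (auto simp: indicator_def intro!: powr_mono2)
    qed
    also have "\<dots> = (LINT x:\<Omega>|lebesgue. \<bar>?\<phi> x\<bar> powr (p + 1))"
      by (simp add: set_lebesgue_integral_def integral_completion)
    finally have l: "b * \<delta> ^ CARD('n) \<le> (LINT x:\<Omega>|lebesgue. \<bar>?\<phi> x\<bar> powr (p + 1))" .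
    have "set_integrable lebesgue \<Omega> (\<lambda>x. \<bar>?\<phi> x\<bar> powr (p + 1))"
      using intp by (simp add: set_integrable_def integrable_completion)
    then show ?thesis using H(1) g q l by blast
  qed
  show thesis using that[OF ab main] .
qed

section \<open>The energy space and mountain pass paths\<close>

lemma gagliardo_density_nonneg: "0 \<le> gagliardo_density s u u z"
  by (simp add: gagliardo_density_def split: prod.split)

lemma gagliardo_density_mono:
  "(u (fst z) - u (snd z))\<^sup>2 \<le> (v (fst z) - v (snd z)) * (w (fst z) - w (snd z)) \<Longrightarrow>
    gagliardo_density s u u z \<le> gagliardo_density s v w z"
  by (cases z) (simp add: gagliardo_density_def power2_eq_square divide_right_mono)

lemma gagliardo_form_nonneg: "0 \<le> gagliardo_form \<Omega> s u u"
  unfolding gagliardo_form_def set_lebesgue_integral_def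
  by (intro Bochner_Integration.integral_nonneg) (simp add: gagliardo_density_nonneg indicator_def)

lemma set_integral_sq_nonneg: "0 \<le> (LINT x:\<Omega>|M. (u x)\<^sup>2 :: real)"
  unfolding set_lebesgue_integral_def by (intro Bochner_Integration.integral_nonneg) (simp add: indicator_def)

lemma set_integral_combination_bound:
  fixes f g h :: "'a \<Rightarrow> real"
  assumes f: "set_integrable M A f" and g: "set_integrable M A g" and h: "set_borel_measurable M A h"
    and le: "\<And>x. 0 \<le> h x" "\<And>x. h x \<le> a * f x + b * g x"
  shows "set_integrable M A h"
    and "(LINT x:A|M. h x) \<le> a * (LINT x:A|M. f x) + b * (LINT x:A|M. g x)"
proof -
  have fg: "set_integrable M A (\<lambda>x. a * f x)" "set_integrable M A (\<lambda>x. b * g x)"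
    using f g by auto
  have i: "set_integrable M A (\<lambda>x. a * f x + b * g x)"
    using set_integral_add(1)[OF fg] .
  show h': "set_integrable M A h"
    by (rule set_integrable_bound[OF i h]) (use le order_trans abs_ge_self in \<open>fastforce intro!: AE_I2\<close>)
  have "(LINT x:A|M. h x) \<le> (LINT x:A|M. a * f x + b * g x)"
    by (rule set_integral_mono[OF h' i]) (rule le)
  also have "\<dots> = a * (LINT x:A|M. f x) + b * (LINT x:A|M. g x)"
    using set_integral_add(2)[OF fg] by simp
  finally show "(LINT x:A|M. h x) \<le> a * (LINT x:A|M. f x) + b * (LINT x:A|M. g x)" .
qed

lemma power2_combination_le: "(a * x + b * y)\<^sup>2 \<le> (2 * a\<^sup>2) * x\<^sup>2 + (2 * b\<^sup>2) * y\<^sup>2" for a b x y :: real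
  using zero_le_power2[of "a * x - b * y"] by (simp add: power2_eq_square algebra_simps)

lemma set_borel_measurable_lebesgue:
  "A \<in> sets borel \<Longrightarrow> f \<in> borel_measurable lebesgue \<Longrightarrow> set_borel_measurable lebesgue A (f :: _ \<Rightarrow> real)"
  unfolding set_borel_measurable_def by (intro borel_measurable_scaleR borel_measurable_indicator) auto

text \<open>The pointwise inequality (x + y)^2 \<le> 2 x^2 + 2 y^2 avoids the cross terms of the
  forms; the factor 2 lost is harmless where these bounds are applied.\<close>

lemma Hs_combination:
  fixes u v :: "real^'n \<Rightarrow> real" and a b :: real
  assumes "open \<Omega>" and u: "u \<in> Hs \<Omega> s" and v: "v \<in> Hs \<Omega> s"
  defines "w \<equiv> \<lambda>x. a * u x + b * v x"
  shows "w \<in> Hs \<Omega> s"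
    and "gagliardo_form \<Omega> s w w \<le> (2 * a\<^sup>2) * gagliardo_form \<Omega> s u u + (2 * b\<^sup>2) * gagliardo_form \<Omega> s v v"
    and "(LINT x:\<Omega>|lebesgue. (w x)\<^sup>2) \<le> (2 * a\<^sup>2) * (LINT x:\<Omega>|lebesgue. (u x)\<^sup>2) + (2 * b\<^sup>2) * (LINT x:\<Omega>|lebesgue. (v x)\<^sup>2)"
proof -
  have um: "u \<in> borel_measurable lebesgue" "set_integrable lebesgue \<Omega> (\<lambda>x. (u x)\<^sup>2)"
      "set_integrable lebesgue (T_set \<Omega>) (gagliardo_density s u u)"
    and vm: "v \<in> borel_measurable lebesgue" "set_integrable lebesgue \<Omega> (\<lambda>x. (v x)\<^sup>2)"
      "set_integrable lebesgue (T_set \<Omega>) (gagliardo_density s v v)"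
    using u v by (auto simp: Hs_def)
  have wm: "w \<in> borel_measurable lebesgue" using um(1) vm(1) unfolding w_def by simp
  have d: "gagliardo_density s w w z \<le> (2 * a\<^sup>2) * gagliardo_density s u u z + (2 * b\<^sup>2) * gagliardo_density s v v z" for z
  proof -
    have "(w (fst z) - w (snd z))\<^sup>2 \<le> (2 * a\<^sup>2) * (u (fst z) - u (snd z))\<^sup>2 + (2 * b\<^sup>2) * (v (fst z) - v (snd z))\<^sup>2"
      using power2_combination_le[of a "u (fst z) - u (snd z)" b "v (fst z) - v (snd z)"]
      by (simp add: w_def algebra_simps)
    from divide_right_mono[OF this, of "norm (fst z - snd z) powr (real CARD('n) + 2 * s)"]
    show ?thesis
      by (cases z) (simp add: gagliardo_density_def power2_eq_square add_divide_distrib)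
  qed
  have wd: "set_borel_measurable lebesgue (T_set \<Omega>) (gagliardo_density s w w)"
    using wm T_set_borel[OF \<open>open \<Omega>\<close>] by (intro set_borel_measurable_lebesgue borel_measurable_gagliardo_density)
  have w2: "set_borel_measurable lebesgue \<Omega> (\<lambda>x. (w x)\<^sup>2)"
    using wm \<open>open \<Omega>\<close> by (intro set_borel_measurable_lebesgue) auto
  note 1 = set_integral_combination_bound[OF um(3) vm(3) wd gagliardo_density_nonneg d]
  have w2_le: "(w x)\<^sup>2 \<le> (2 * a\<^sup>2) * (u x)\<^sup>2 + (2 * b\<^sup>2) * (v x)\<^sup>2" for x
    unfolding w_def by (rule power2_combination_le)
  note 2 = set_integral_combination_bound[OF um(2) vm(2) w2 zero_le_power2 w2_le]
  show "w \<in> Hs \<Omega> s" using wm 1(1) 2(1) by (simp add: Hs_def)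
  show "gagliardo_form \<Omega> s w w \<le> (2 * a\<^sup>2) * gagliardo_form \<Omega> s u u + (2 * b\<^sup>2) * gagliardo_form \<Omega> s v v"
    using 1(2) by (simp add: gagliardo_form_def)
  show "(LINT x:\<Omega>|lebesgue. (w x)\<^sup>2) \<le> (2 * a\<^sup>2) * (LINT x:\<Omega>|lebesgue. (u x)\<^sup>2) + (2 * b\<^sup>2) * (LINT x:\<Omega>|lebesgue. (v x)\<^sup>2)"
    using 2(2) .
qed

lemma gagliardo_form_scale: "gagliardo_form \<Omega> s (\<lambda>x. a * u x) (\<lambda>x. a * u x) = a\<^sup>2 * gagliardo_form \<Omega> s u u"
proof -
  have "gagliardo_density s (\<lambda>x. a * u x) (\<lambda>x. a * u x) = (\<lambda>z. a\<^sup>2 * gagliardo_density s u u z)"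
    by (auto simp: gagliardo_density_def fun_eq_iff power2_eq_square algebra_simps)
  then show ?thesis by (simp add: gagliardo_form_def)
qed

text \<open>A triangle inequality up to the factor 2, which is enough for continuity of paths in a
  plane.\<close>

lemma Hs_norm_combination_le:
  assumes "open \<Omega>" and u: "u \<in> Hs \<Omega> s" and v: "v \<in> Hs \<Omega> s"
  shows "Hs_norm \<Omega> s (\<lambda>x. a * u x + b * v x) \<le> 2 * (\<bar>a\<bar> * Hs_norm \<Omega> s u + \<bar>b\<bar> * Hs_norm \<Omega> s v)"
proof -
  define A B where "A = (LINT x:\<Omega>|lebesgue. (u x)\<^sup>2) + gagliardo_form \<Omega> s u u"
    and "B = (LINT x:\<Omega>|lebesgue. (v x)\<^sup>2) + gagliardo_form \<Omega> s v v"
  have AB: "A \<ge> 0" "B \<ge> 0"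
    unfolding A_def B_def by (intro add_nonneg_nonneg gagliardo_form_nonneg set_integral_sq_nonneg)+
  have "Hs_norm \<Omega> s (\<lambda>x. a * u x + b * v x) \<le> sqrt ((2 * a\<^sup>2) * A + (2 * b\<^sup>2) * B)"
    unfolding Hs_norm_def A_def B_def using Hs_combination(2,3)[OF assms, of a b]
    by (intro real_sqrt_le_mono) (simp add: algebra_simps)
  also have "\<dots> \<le> 2 * (\<bar>a\<bar> * sqrt A + \<bar>b\<bar> * sqrt B)"
  proof (rule real_le_lsqrt)
    show "0 \<le> 2 * (\<bar>a\<bar> * sqrt A + \<bar>b\<bar> * sqrt B)" using AB by simp
    have "(2 * (x + y))\<^sup>2 = 4 * (x\<^sup>2 + y\<^sup>2) + 8 * (x * y)" for x y :: real
      by (simp add: power2_eq_square algebra_simps)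
    moreover have "(\<bar>a\<bar> * sqrt A)\<^sup>2 = a\<^sup>2 * A" "(\<bar>b\<bar> * sqrt B)\<^sup>2 = b\<^sup>2 * B"
      using AB by (simp_all add: power_mult_distrib)
    ultimately have "(2 * (\<bar>a\<bar> * sqrt A + \<bar>b\<bar> * sqrt B))\<^sup>2 = 4 * (a\<^sup>2 * A + b\<^sup>2 * B) + 8 * (\<bar>a\<bar> * sqrt A * (\<bar>b\<bar> * sqrt B))"
      by metis
    moreover have "0 \<le> a\<^sup>2 * A" "0 \<le> b\<^sup>2 * B" "0 \<le> \<bar>a\<bar> * sqrt A * (\<bar>b\<bar> * sqrt B)" using AB by auto
    moreover have "2 * x + 2 * y \<le> 4 * (x + y) + 8 * z" if "0 \<le> x" "0 \<le> y" "0 \<le> z" for x y z :: real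
      using that by simp
    ultimately show "2 * a\<^sup>2 * A + 2 * b\<^sup>2 * B \<le> (2 * (\<bar>a\<bar> * sqrt A + \<bar>b\<bar> * sqrt B))\<^sup>2"
      by (simp only: mult.assoc)
  qed
  finally show ?thesis unfolding A_def B_def Hs_norm_def .
qed

text \<open>On a plane the norm is controlled by the two coefficients, so continuity of the path in
  \<open>Hs\<close> reduces to that of two real functions.\<close>

lemma mp_paths_combination:
  assumes "open \<Omega>" and u: "\<phi> \<in> Hs \<Omega> s" and v: "e \<in> Hs \<Omega> s"
    and cont: "continuous_on {0..1} \<alpha>" "continuous_on {0..1} \<beta>"
    and ends: "\<alpha> 0 = 0" "\<beta> 0 = 0" "\<alpha> 1 = 0" "\<beta> 1 = (1::real)"
  shows "(\<lambda>t x. \<alpha> t * \<phi> x + \<beta> t * e x) \<in> mp_paths \<Omega> s e"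
proof -
  \<comment> \<open>The summand 1 keeps \<open>C\<close> positive when both norms vanish and makes
    the final estimate strict.\<close>
  define C where "C = 2 * (Hs_norm \<Omega> s \<phi> + Hs_norm \<Omega> s e) + 1"
  have nn: "Hs_norm \<Omega> s w \<ge> 0" for w
    unfolding Hs_norm_def by (intro real_sqrt_ge_zero add_nonneg_nonneg gagliardo_form_nonneg set_integral_sq_nonneg)
  have C: "C > 0" unfolding C_def using nn[of \<phi>] nn[of e] by (simp add: add_nonneg_pos)
  have "\<exists>\<delta>>0. \<forall>t'\<in>{0..1}. \<bar>t' - t\<bar> < \<delta> \<longrightarrow>
        Hs_norm \<Omega> s (\<lambda>x. (\<alpha> t' * \<phi> x + \<beta> t' * e x) - (\<alpha> t * \<phi> x + \<beta> t * e x)) < \<epsilon>"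
    if t: "t \<in> {0..1}" and \<epsilon>: "\<epsilon> > 0" for t \<epsilon>
  proof -
    have e: "\<epsilon> / C > 0" using \<epsilon> C by simp
    obtain d1 where d1: "d1 > 0" "\<And>t'. t' \<in> {0..1} \<Longrightarrow> dist t' t < d1 \<Longrightarrow> dist (\<alpha> t') (\<alpha> t) < \<epsilon> / C"
      using cont(1) t e unfolding continuous_on_iff by metis
    obtain d2 where d2: "d2 > 0" "\<And>t'. t' \<in> {0..1} \<Longrightarrow> dist t' t < d2 \<Longrightarrow> dist (\<beta> t') (\<beta> t) < \<epsilon> / C"
      using cont(2) t e unfolding continuous_on_iff by metis
    show ?thesis
    proof (intro exI[of _ "min d1 d2"] conjI ballI impI)
      show "min d1 d2 > 0" using d1 d2 by simp
      fix t' assume t': "t' \<in> {0..1::real}" "\<bar>t' - t\<bar> < min d1 d2"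
      have a: "\<bar>\<alpha> t' - \<alpha> t\<bar> \<le> \<epsilon> / C" "\<bar>\<beta> t' - \<beta> t\<bar> \<le> \<epsilon> / C"
        using d1(2)[of t'] d2(2)[of t'] t' by (auto simp: dist_real_def)
      have "Hs_norm \<Omega> s (\<lambda>x. (\<alpha> t' * \<phi> x + \<beta> t' * e x) - (\<alpha> t * \<phi> x + \<beta> t * e x))
        = Hs_norm \<Omega> s (\<lambda>x. (\<alpha> t' - \<alpha> t) * \<phi> x + (\<beta> t' - \<beta> t) * e x)"
        by (simp add: algebra_simps)
      also have "\<dots> \<le> 2 * (\<bar>\<alpha> t' - \<alpha> t\<bar> * Hs_norm \<Omega> s \<phi> + \<bar>\<beta> t' - \<beta> t\<bar> * Hs_norm \<Omega> s e)"
        by (rule Hs_norm_combination_le[OF \<open>open \<Omega>\<close> u v])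
      also have "\<dots> \<le> 2 * (\<epsilon> / C * Hs_norm \<Omega> s \<phi> + \<epsilon> / C * Hs_norm \<Omega> s e)"
        using a nn by (intro mult_left_mono add_mono mult_right_mono) auto
      also have "\<dots> = \<epsilon> / C * (2 * (Hs_norm \<Omega> s \<phi> + Hs_norm \<Omega> s e))" by (simp add: algebra_simps)
      also have "\<dots> < \<epsilon> / C * C" using e by (intro mult_strict_left_mono) (auto simp: C_def)
      also have "\<dots> = \<epsilon>" using C by simp
      finally show "Hs_norm \<Omega> s (\<lambda>x. (\<alpha> t' * \<phi> x + \<beta> t' * e x) - (\<alpha> t * \<phi> x + \<beta> t * e x)) < \<epsilon>" .
    qed
  qed
  then show ?thesis
    using Hs_combination(1)[OF \<open>open \<Omega>\<close> u v] ends by (auto simp: mp_paths_def)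
qed

lemma J_energy_zero:
  fixes \<Omega> :: "(real^'n) set"
  shows "J_energy \<Omega> s p d (\<lambda>x. 0) = 0"
proof -
  have "gagliardo_density s (\<lambda>x::real^'n. 0) (\<lambda>x. 0) = (\<lambda>z. 0)"
    by (auto simp: gagliardo_density_def fun_eq_iff)
  then show ?thesis by (simp add: J_energy_def gagliardo_form_def)
qed

text \<open>
  Without continuity of the functional along a path, the supremum could be over an unbounded set;
  then it is the same unspecified real number for all such paths, which still bounds the infimum from below.
\<close>

lemma mp_value_le:
  assumes \<gamma>: "\<gamma> \<in> mp_paths \<Omega> s e"
    and le: "\<And>t. t \<in> {0..1} \<Longrightarrow> J_energy \<Omega> s p d (\<gamma> t) \<le> C"
  shows "mp_value \<Omega> s p d e \<le> C"
proof -
  have junk: "Sup X = (LEAST z::real. False)" if "\<not> bdd_above X" for X :: "real set"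
  proof -
    have "(\<lambda>z. \<forall>x\<in>X. x \<le> z) = (\<lambda>z. False)" using that by (auto simp: bdd_above_def fun_eq_iff)
    then show ?thesis by (simp add: Sup_real_def)
  qed
  have "bdd_below ((\<lambda>\<gamma>. SUP t\<in>{0..1}. J_energy \<Omega> s p d (\<gamma> t)) ` mp_paths \<Omega> s e)"
  proof (rule bdd_belowI2)
    fix \<gamma> assume \<gamma>: "\<gamma> \<in> mp_paths \<Omega> s e"
    \<comment> \<open>Either the energies along the path are bounded above, and the supremum is at
      least the energy 0 of the starting point, or the supremum has its default value.\<close>
    show "min 0 (LEAST z::real. False) \<le> (SUP t\<in>{0..1}. J_energy \<Omega> s p d (\<gamma> t))"
    proof (cases "bdd_above ((\<lambda>t. J_energy \<Omega> s p d (\<gamma> t)) ` {0..1})")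
      case True
      have "J_energy \<Omega> s p d (\<gamma> 0) \<le> (SUP t\<in>{0..1}. J_energy \<Omega> s p d (\<gamma> t))"
        by (rule cSUP_upper[OF _ True]) simp
      moreover have "J_energy \<Omega> s p d (\<gamma> 0) = 0" using \<gamma> J_energy_zero by (simp add: mp_paths_def)
      ultimately show ?thesis by simp
    next
      case False
      then show ?thesis using junk[OF False] by simp
    qed
  qed
  then have "mp_value \<Omega> s p d e \<le> (SUP t\<in>{0..1}. J_energy \<Omega> s p d (\<gamma> t))"
    unfolding mp_value_def by (rule cINF_lower[OF _ \<gamma>])
  also have "\<dots> \<le> C" by (rule cSUP_least) (auto intro: le)
  finally show ?thesis .
qed

section \<open>The energy bound\<close>

text \<open>The part of \<open>J_energy\<close> homogeneous of degree 2, as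
  \<open>power_energy\<close> is the one of degree p + 1; along a ray the energy becomes an explicit
  function of one real variable.\<close>

definition quad_energy ::
  "(real^'n) set \<Rightarrow> real \<Rightarrow> real \<Rightarrow> (real^'n \<Rightarrow> real) \<Rightarrow> real" where
  "quad_energy \<Omega> s d u =
     d * frac_lap_const TYPE('n) s / 2 * gagliardo_form \<Omega> s u u + (LINT x:\<Omega>|lebesgue. (u x)\<^sup>2)"

definition power_energy :: "(real^'n) set \<Rightarrow> real \<Rightarrow> (real^'n \<Rightarrow> real) \<Rightarrow> real" where
  "power_energy \<Omega> p u = (LINT x:\<Omega>|lebesgue. \<bar>u x\<bar> powr (p + 1))"

lemma J_energy_eq: "J_energy \<Omega> s p d u = quad_energy \<Omega> s d u / 2 - power_energy \<Omega> p u / (p + 1)"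
  by (simp add: J_energy_def quad_energy_def power_energy_def)

lemma quad_energy_scale: "quad_energy \<Omega> s d (\<lambda>x. a * u x) = a\<^sup>2 * quad_energy \<Omega> s d u"
  by (simp add: quad_energy_def gagliardo_form_scale power_mult_distrib algebra_simps)

lemma power_energy_scale: "0 \<le> a \<Longrightarrow> power_energy \<Omega> p (\<lambda>x. a * u x) = a powr (p + 1) * power_energy \<Omega> p u"
  by (simp add: power_energy_def abs_mult powr_mult)

lemma set_integral_sq_pos:
  fixes u :: "real^'n \<Rightarrow> real"
  assumes "open \<Omega>" "\<Omega> \<noteq> {}" and int: "set_integrable lebesgue \<Omega> (\<lambda>x. (u x)\<^sup>2)"
    and pos: "AE x in lebesgue. x \<in> \<Omega> \<longrightarrow> u x > 0"
  shows "0 < (LINT x:\<Omega>|lebesgue. (u x)\<^sup>2)"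
proof (rule ccontr)
  assume "\<not> ?thesis"
  then have 0: "(LINT x:\<Omega>|lebesgue. (u x)\<^sup>2) = 0"
    using set_integral_sq_nonneg[where M=lebesgue and \<Omega>=\<Omega> and u=u] by linarith
  have "AE x in lebesgue. indicator \<Omega> x *\<^sub>R (u x)\<^sup>2 = 0"
    using 0 int integral_nonneg_eq_0_iff_AE[of lebesgue "\<lambda>x. indicator \<Omega> x *\<^sub>R (u x)\<^sup>2"]
    unfolding set_lebesgue_integral_def set_integrable_def by auto
  with pos have "AE x in lebesgue. x \<notin> \<Omega>"
    by eventually_elim (auto simp: indicator_def split: if_splits)
  then have "\<Omega> \<in> null_sets lebesgue"
    using \<open>open \<Omega>\<close> by (subst AE_iff_null_sets) auto
  then have "negligible \<Omega>" by (simp add: negligible_iff_null_sets)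
  then show False using open_not_negligible assms(1,2) by blast
qed

lemma quad_energy_pos:
  fixes u :: "real^'n \<Rightarrow> real"
  assumes "open \<Omega>" "\<Omega> \<noteq> {}" and u: "u \<in> Hs \<Omega> s" and "d \<ge> 0" "frac_lap_const TYPE('n) s \<ge> 0"
    and pos: "AE x in lebesgue. x \<in> \<Omega> \<longrightarrow> u x > 0"
  shows "0 < quad_energy \<Omega> s d u"
  unfolding quad_energy_def
  using assms gagliardo_form_nonneg[of \<Omega> s u]
  by (intro add_nonneg_pos set_integral_sq_pos) (auto simp: Hs_def)

text \<open>The integral of a non-integrable function is 0 by default, so a nonzero value certifies
  integrability. For the endpoint and for the solution this is the source of membership in
  L^(p+1).\<close>

lemma set_integrable_if_power_energy:
  assumes "power_energy \<Omega> p u \<noteq> 0"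
  shows "set_integrable lebesgue \<Omega> (\<lambda>x. \<bar>u x\<bar> powr (p + 1))"
  using assms not_integrable_integral_eq
  unfolding power_energy_def set_integrable_def set_lebesgue_integral_def by blast

lemma quad_energy_combination_le:
  fixes u v :: "real^'n \<Rightarrow> real"
  assumes "open \<Omega>" "u \<in> Hs \<Omega> s" "v \<in> Hs \<Omega> s" and "d \<ge> 0" "frac_lap_const TYPE('n) s \<ge> 0"
  shows "quad_energy \<Omega> s d (\<lambda>x. a * u x + b * v x)
    \<le> (2 * a\<^sup>2) * quad_energy \<Omega> s d u + (2 * b\<^sup>2) * quad_energy \<Omega> s d v"
proof -
  note H = Hs_combination(2,3)[OF assms(1-3), of a b]
  define k where "k = d * frac_lap_const TYPE('n) s / 2"
  have "k \<ge> 0" using assms(4,5) by (simp add: k_def)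
  from mult_left_mono[OF H(1) this] H(2) show ?thesis
    unfolding quad_energy_def k_def[symmetric] by (simp add: algebra_simps)
qed

text \<open>For nonnegative functions and coefficients the sum dominates each summand pointwise. The
  work lies in the integrability of the sum, whose integral would otherwise default to 0; it follows
  from x + y \<le> 2 max x y.\<close>

lemma power_energy_combination_ge:
  fixes u v :: "real^'n \<Rightarrow> real"
  assumes "open \<Omega>" and p: "p > 1"
    and um: "u \<in> borel_measurable lebesgue" and vm: "v \<in> borel_measurable lebesgue"
    and ui: "set_integrable lebesgue \<Omega> (\<lambda>x. \<bar>u x\<bar> powr (p + 1))"
    and vi: "set_integrable lebesgue \<Omega> (\<lambda>x. \<bar>v x\<bar> powr (p + 1))"
    and pos: "AE x in lebesgue. x \<in> \<Omega> \<longrightarrow> 0 \<le> u x \<and> 0 \<le> v x" and ab: "0 \<le> a" "0 \<le> b"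
  shows "power_energy \<Omega> p (\<lambda>x. a * u x + b * v x) \<ge> a powr (p + 1) * power_energy \<Omega> p u"
    and "power_energy \<Omega> p (\<lambda>x. a * u x + b * v x) \<ge> b powr (p + 1) * power_energy \<Omega> p v"
proof -
  let ?w = "\<lambda>x. a * u x + b * v x"
  let ?F = "\<lambda>x. (2 * a) powr (p + 1) * \<bar>u x\<bar> powr (p + 1) + (2 * b) powr (p + 1) * \<bar>v x\<bar> powr (p + 1)"
  have Fi: "set_integrable lebesgue \<Omega> ?F" using ui vi by auto
  have pw: "\<bar>x + y\<bar> powr (p + 1) \<le> (2 * x) powr (p + 1) + (2 * y) powr (p + 1)" if "x \<ge> 0" "y \<ge> 0" for x y :: real
  proof (cases "x \<le> y")
    case True
    then have "\<bar>x + y\<bar> powr (p + 1) \<le> (2 * y) powr (p + 1)" using that p by (intro powr_mono2) auto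
    then show ?thesis by (simp add: add_increasing)
  next
    case False
    then have "\<bar>x + y\<bar> powr (p + 1) \<le> (2 * x) powr (p + 1)" using that p by (intro powr_mono2) auto
    then show ?thesis by (simp add: add_increasing2)
  qed
  have le: "\<bar>?w x\<bar> powr (p + 1) \<le> ?F x" if "0 \<le> u x" "0 \<le> v x" for x
    using pw[of "a * u x" "b * v x"] that ab by (simp add: powr_mult abs_mult mult.assoc)
  have m: "set_borel_measurable lebesgue \<Omega> (\<lambda>x. \<bar>?w x\<bar> powr (p + 1))"
    using um vm \<open>open \<Omega>\<close> by (intro set_borel_measurable_lebesgue) auto
  have wi: "set_integrable lebesgue \<Omega> (\<lambda>x. \<bar>?w x\<bar> powr (p + 1))"
    by (rule set_integrable_bound[OF Fi m]) (use pos in eventually_elim, use le in auto)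
  have "a powr (p + 1) * power_energy \<Omega> p u = (LINT x:\<Omega>|lebesgue. a powr (p + 1) * \<bar>u x\<bar> powr (p + 1))"
    by (simp add: power_energy_def)
  also have "\<dots> \<le> power_energy \<Omega> p ?w"
    unfolding power_energy_def
  proof (rule set_integral_mono_AE[OF _ wi])
    show "AE x\<in>\<Omega> in lebesgue. a powr (p + 1) * \<bar>u x\<bar> powr (p + 1) \<le> \<bar>?w x\<bar> powr (p + 1)"
      using pos
    proof eventually_elim
      case (elim x)
      show ?case using elim ab p by (auto simp: powr_mult[symmetric] intro!: powr_mono2)
    qed
  qed (use ui in auto)
  finally show "power_energy \<Omega> p ?w \<ge> a powr (p + 1) * power_energy \<Omega> p u" .
  have "b powr (p + 1) * power_energy \<Omega> p v = (LINT x:\<Omega>|lebesgue. b powr (p + 1) * \<bar>v x\<bar> powr (p + 1))"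
    by (simp add: power_energy_def)
  also have "\<dots> \<le> power_energy \<Omega> p ?w"
    unfolding power_energy_def
  proof (rule set_integral_mono_AE[OF _ wi])
    show "AE x\<in>\<Omega> in lebesgue. b powr (p + 1) * \<bar>v x\<bar> powr (p + 1) \<le> \<bar>?w x\<bar> powr (p + 1)"
      using pos
    proof eventually_elim
      case (elim x)
      show ?case using elim ab p by (auto simp: powr_mult[symmetric] intro!: powr_mono2)
    qed
  qed (use vi in auto)
  finally show "power_energy \<Omega> p ?w \<ge> b powr (p + 1) * power_energy \<Omega> p v" .
qed

text \<open>On the crossing the coefficients satisfy a + b = R, so one of them is at least R/2 and
  the power part is at least of order R^(p+1), while the quadratic part is at most of order R^2. On
  the way back along the ray of \<open>e\<close> the relation J(e) = 0 makes the energy a positive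
  multiple of b^2 - b^(p+1), with b \<ge> 1.\<close>

lemma mp_value_le_ray_sup:
  fixes \<phi> e :: "real^'n \<Rightarrow> real"
  assumes \<Omega>: "open \<Omega>" "\<Omega> \<noteq> {}" and p: "p > 1" and d: "d \<ge> 0" and c: "frac_lap_const TYPE('n) s \<ge> 0"
    and \<phi>: "\<phi> \<in> Hs \<Omega> s" "\<And>x. 0 \<le> \<phi> x"
    and \<phi>p: "power_energy \<Omega> p \<phi> > 0"
    and e: "mp_endpoint \<Omega> s p d e"
    and M: "M \<ge> 0" "\<And>a. a \<ge> 0 \<Longrightarrow> J_energy \<Omega> s p d (\<lambda>x. a * \<phi> x) \<le> M"
  shows "mp_value \<Omega> s p d e \<le> M"
proof -
  have eH: "e \<in> Hs \<Omega> s" and epos: "AE x in lebesgue. e x > 0" and eJ: "J_energy \<Omega> s p d e = 0"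
    using e by (auto simp: mp_endpoint_def)
  define Q where "Q = quad_energy \<Omega> s d \<phi>"
  define Qe where "Qe = quad_energy \<Omega> s d e"
  define B where "B = power_energy \<Omega> p \<phi>"
  define Be where "Be = power_energy \<Omega> p e"
  have Qe: "Qe > 0" unfolding Qe_def
    using epos by (intro quad_energy_pos[OF \<Omega> eH d c]) auto
  \<comment> \<open>J(e) = 0 ties the two parts of the energy of \<open>e\<close>. The quadratic one
    is positive, so the power integral is nonzero, hence a convergent one.\<close>
  have QBe: "Qe / 2 = Be / (p + 1)" using eJ unfolding J_energy_eq Qe_def Be_def by linarith
  have "Be / (p + 1) > 0" using Qe QBe by linarith
  then have Be: "Be > 0" using p by (simp add: zero_less_divide_iff)
  have B: "B > 0" using \<phi>p by (simp add: B_def)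
  have Q: "Q \<ge> 0" unfolding Q_def quad_energy_def
    using d c gagliardo_form_nonneg[of \<Omega> s \<phi>] set_integral_sq_nonneg[where M=lebesgue and \<Omega>=\<Omega> and u=\<phi>] by simp
  have \<phi>i: "set_integrable lebesgue \<Omega> (\<lambda>x. \<bar>\<phi> x\<bar> powr (p + 1))"
    by (rule set_integrable_if_power_energy) (use \<phi>p in simp)
  have ei: "set_integrable lebesgue \<Omega> (\<lambda>x. \<bar>e x\<bar> powr (p + 1))"
    by (rule set_integrable_if_power_energy) (use Be in \<open>simp add: Be_def\<close>)
  \<comment> \<open>\<open>m * R powr (p + 1)\<close> will bound the power part divided by p + 1
    from below on the crossing.\<close>
  define m where "m = min B Be * (1/2) powr (p + 1) / (p + 1)"
  have m: "m > 0" using B Be p by (simp add: m_def)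
  \<comment> \<open>From this size on the power part wins on the crossing. The lower bound 1 keeps b
    \<ge> 1 while the last piece descends from \<open>R e\<close> to \<open>e\<close>.\<close>
  define R where "R = max 1 ((2 * (Q + Qe) / m) powr (1 / (p - 1)))"
  have R1: "R \<ge> 1" by (simp add: R_def)
  have Rp: "(Q + Qe) * R\<^sup>2 \<le> m * R powr (p + 1)"
  proof -
    have "2 * (Q + Qe) / m \<le> R powr (p - 1)"
    proof -
      have "2 * (Q + Qe) / m = ((2 * (Q + Qe) / m) powr (1 / (p - 1))) powr (p - 1)"
        using Q Qe m p by (simp add: powr_powr)
      also have "\<dots> \<le> R powr (p - 1)" using p by (intro powr_mono2) (auto simp: R_def)
      finally show ?thesis .
    qed
    then have "Q + Qe \<le> m * R powr (p - 1)" using m Q Qe by (simp add: field_simps)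
    then have "(Q + Qe) * R\<^sup>2 \<le> m * R powr (p - 1) * R\<^sup>2" by (rule mult_right_mono) simp
    also have "\<dots> = m * (R powr (p - 1) * R\<^sup>2)" by simp
    also have "R powr (p - 1) * R\<^sup>2 = R powr (p + 1)"
      using R1 powr_add[of R "p - 1" 2] by (simp add: powr_numeral add.commute)
    finally show ?thesis .
  qed
  \<comment> \<open>\<alpha> rises to \<open>R\<close> at t = 1/3 and is back at 0 at t = 2/3;
    \<beta> leaves 0 at t = 1/3, reaches \<open>R\<close> at t = 2/3 and falls to 1. Writing them
    with max and min makes continuity immediate.\<close>
  define \<alpha> where "\<alpha> t = R * max 0 (min (3 * t) (2 - 3 * t))" for t
  define \<beta> where "\<beta> t = max 0 (min (R * (3 * t - 1)) (R + (1 - R) * (3 * t - 2)))" for t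
  have path: "(\<lambda>t x. \<alpha> t * \<phi> x + \<beta> t * e x) \<in> mp_paths \<Omega> s e"
  proof (rule mp_paths_combination[OF \<Omega>(1) \<phi>(1) eH])
    show "continuous_on {0..1} \<alpha>" "continuous_on {0..1} \<beta>"
      unfolding \<alpha>_def \<beta>_def by (intro continuous_intros)+
  qed (use R1 in \<open>auto simp: \<alpha>_def \<beta>_def\<close>)
  have Je: "J_energy \<Omega> s p d (\<lambda>x. b * e x) \<le> 0" if "b \<ge> 1" for b
  proof -
    have "J_energy \<Omega> s p d (\<lambda>x. b * e x) = b\<^sup>2 * (Qe / 2) - b powr (p + 1) * (Be / (p + 1))"
      using that by (simp add: J_energy_eq quad_energy_scale power_energy_scale Qe_def Be_def)
    also have "\<dots> = (b powr 2 - b powr (p + 1)) * (Qe / 2)"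
      using that unfolding QBe by (simp add: powr_numeral left_diff_distrib diff_divide_distrib)
    also have "\<dots> \<le> 0"
      using powr_mono[of 2 "p + 1" b] that p Qe by (intro mult_nonpos_nonneg) auto
    finally show ?thesis .
  qed
  have Jmid: "J_energy \<Omega> s p d (\<lambda>x. a * \<phi> x + b * e x) \<le> 0" if ab: "a \<ge> 0" "b \<ge> 0" "a + b = R" for a b
  proof -
    let ?w = "\<lambda>x. a * \<phi> x + b * e x"
    have "quad_energy \<Omega> s d ?w \<le> (2 * a\<^sup>2) * Q + (2 * b\<^sup>2) * Qe"
      unfolding Q_def Qe_def by (rule quad_energy_combination_le[OF \<Omega>(1) \<phi>(1) eH d c])
    also have "\<dots> \<le> (2 * R\<^sup>2) * Q + (2 * R\<^sup>2) * Qe"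
      using ab Q Qe by (intro add_mono mult_right_mono mult_left_mono power_mono) auto
    also have "\<dots> = 2 * ((Q + Qe) * R\<^sup>2)" by (simp add: algebra_simps)
    also have "\<dots> \<le> 2 * (m * R powr (p + 1))" using Rp by simp
    finally have q: "quad_energy \<Omega> s d ?w / 2 \<le> m * R powr (p + 1)" by simp
    have "AE x in lebesgue. x \<in> \<Omega> \<longrightarrow> 0 \<le> \<phi> x \<and> 0 \<le> e x"
      using epos by eventually_elim (use \<phi>(2) in auto)
    note ge = power_energy_combination_ge[OF \<Omega>(1) p _ _ \<phi>i ei this ab(1,2), folded B_def Be_def]
    have ge': "power_energy \<Omega> p ?w \<ge> a powr (p + 1) * B" "power_energy \<Omega> p ?w \<ge> b powr (p + 1) * Be"
      using ge \<phi>(1) eH by (auto simp: Hs_def)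
    have "(R/2) powr (p + 1) * min B Be \<le> power_energy \<Omega> p ?w"
    proof (cases "a \<ge> R/2")
      case True
      have "(R/2) powr (p + 1) * min B Be \<le> a powr (p + 1) * B"
        using True R1 B Be p by (intro mult_mono powr_mono2) auto
      then show ?thesis using ge' by simp
    next
      case False
      then have "b \<ge> R/2" using ab by linarith
      then have "(R/2) powr (p + 1) * min B Be \<le> b powr (p + 1) * Be"
        using R1 B Be p by (intro mult_mono powr_mono2) auto
      then show ?thesis using ge' by simp
    qed
    then have "(R/2) powr (p + 1) * min B Be / (p + 1) \<le> power_energy \<Omega> p ?w / (p + 1)"
      using p by (intro divide_right_mono) auto
    moreover have "(R/2) powr (p + 1) * min B Be / (p + 1) = m * R powr (p + 1)"
      using R1 by (simp add: m_def powr_divide)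
    ultimately show ?thesis using q unfolding J_energy_eq by linarith
  qed
  have "J_energy \<Omega> s p d (\<lambda>x. \<alpha> t * \<phi> x + \<beta> t * e x) \<le> M" if t: "t \<in> {0..1}" for t
  proof -
    consider "t \<le> 1/3" | "1/3 \<le> t" "t \<le> 2/3" | "2/3 \<le> t" by linarith
    then show ?thesis
    proof cases
      case 1
      then have "R * (3 * t - 1) \<le> 0" using R1 by (intro mult_nonneg_nonpos) auto
      then have "\<beta> t = 0" by (simp add: \<beta>_def)
      moreover have "\<alpha> t \<ge> 0" using R1 by (simp add: \<alpha>_def)
      ultimately show ?thesis using M(2)[of "\<alpha> t"] by simp
    next
      case 2
      \<comment> \<open>This product is the difference of the two arguments of the minimum in
        \<beta>; its sign selects the active branch, here and in the next case.\<close>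
      have "(2 * R - 1) * (3 * t - 2) \<le> 0" using 2 R1 by (intro mult_nonneg_nonpos) auto
      then have "R * (3 * t - 1) \<le> R + (1 - R) * (3 * t - 2)" by (simp add: algebra_simps)
      moreover have "R * (3 * t - 1) \<ge> 0" using 2 R1 by simp
      ultimately have b: "\<beta> t = R * (3 * t - 1)" by (simp add: \<beta>_def)
      have a: "\<alpha> t = R * (2 - 3 * t)" using 2 R1 by (simp add: \<alpha>_def)
      have "J_energy \<Omega> s p d (\<lambda>x. \<alpha> t * \<phi> x + \<beta> t * e x) \<le> 0"
        using 2 R1 unfolding a b by (intro Jmid) (auto simp: algebra_simps)
      then show ?thesis using M(1) by linarith
    next
      case 3
      have "(2 * R - 1) * (3 * t - 2) \<ge> 0" using 3 R1 by (intro mult_nonneg_nonneg) auto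
      then have 31: "R + (1 - R) * (3 * t - 2) \<le> R * (3 * t - 1)" by (simp add: algebra_simps)
      have "(R - 1) * (3 - 3 * t) \<ge> 0" using R1 t by (intro mult_nonneg_nonneg) auto
      then have 32: "1 \<le> R + (1 - R) * (3 * t - 2)" by (simp add: algebra_simps)
      have b: "\<beta> t \<ge> 1" using 31 32 by (simp add: \<beta>_def)
      have "\<alpha> t = 0" using 3 by (simp add: \<alpha>_def)
      then show ?thesis using Je[OF b] M(1) by simp
    qed
  qed
  then show ?thesis by (rule mp_value_le[OF path])
qed

text \<open>The two terms agree at \<open>t0\<close>. Since p + 1 > 2, the difference is nonpositive
  beyond it; before it, the quadratic term alone is at most its value at \<open>t0\<close>.\<close>

lemma power_balance_bounded:
  fixes a b p :: real
  assumes a: "a > 0" and b: "b > 0" and p: "p > 1"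
  obtains M where "M > 0" "\<And>t. t \<ge> 0 \<Longrightarrow> t\<^sup>2 * a / 2 - t powr (p + 1) * b / (p + 1) \<le> M"
proof -
  define t0 where "t0 = (a * (p + 1) / (2 * b)) powr (1 / (p - 1))"
  have t0: "t0 > 0" using a b p by (simp add: t0_def)
  have t0p: "t0 powr (p - 1) = a * (p + 1) / (2 * b)" using a b p by (simp add: t0_def powr_powr)
  have "t\<^sup>2 * a / 2 - t powr (p + 1) * b / (p + 1) \<le> t0\<^sup>2 * a / 2" if "t \<ge> 0" for t
  proof (cases "t \<le> t0")
    case True
    then have "t\<^sup>2 * a / 2 \<le> t0\<^sup>2 * a / 2" using that a by (intro divide_right_mono mult_right_mono power_mono) auto
    moreover have "t powr (p + 1) * b / (p + 1) \<ge> 0" using b p by simp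
    ultimately show ?thesis by linarith
  next
    case False
    have "a * (p + 1) / (2 * b) \<le> t powr (p - 1)" using False t0 p unfolding t0p[symmetric] by (intro powr_mono2) auto
    then have "a / 2 \<le> t powr (p - 1) * b / (p + 1)" using b p by (simp add: field_simps)
    then have "t\<^sup>2 * (a / 2) \<le> t\<^sup>2 * (t powr (p - 1) * b / (p + 1))" by (rule mult_left_mono) simp
    moreover have "t\<^sup>2 * t powr (p - 1) = t powr (p + 1)"
      using False t0 powr_add[of t 2 "p - 1"] by (simp add: powr_numeral add.commute)
    ultimately have "t\<^sup>2 * a / 2 \<le> t powr (p + 1) * b / (p + 1)" by (simp add: mult.assoc[symmetric])
    moreover have "t0\<^sup>2 * a / 2 \<ge> 0" using a by simp
    ultimately show ?thesis by linarith
  qed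
  moreover have "t0\<^sup>2 * a / 2 > 0" using t0 a by simp
  ultimately show thesis using that by blast
qed

text \<open>The equation is tested with u itself. Positivity of the quadratic side makes the power
  integral nonzero and therefore convergent; u > 0 removes the absolute value.\<close>

lemma weak_solution_power_energy:
  fixes u :: "real^'n \<Rightarrow> real"
  assumes \<Omega>: "open \<Omega>" "\<Omega> \<noteq> {}" and d: "d \<ge> 0" and c: "frac_lap_const TYPE('n) s \<ge> 0"
    and u: "weak_solution \<Omega> s p d u" and pos: "AE x in lebesgue. x \<in> \<Omega> \<longrightarrow> u x > 0"
  shows "quad_energy \<Omega> s d u = power_energy \<Omega> p u" "power_energy \<Omega> p u > 0"
    "set_integrable lebesgue \<Omega> (\<lambda>x. \<bar>u x\<bar> powr (p + 1))"
    "(LINT x:\<Omega>|lebesgue. u x powr (p + 1)) = power_energy \<Omega> p u"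
proof -
  have uH: "u \<in> Hs \<Omega> s" using u by (simp add: weak_solution_def)
  have "\<bar>t\<bar> powr (p - 1) * t * t = \<bar>t\<bar> powr (p + 1)" for t :: real
  proof (cases "t = 0")
    case False
    then show ?thesis using powr_add[of "\<bar>t\<bar>" "p - 1" 2] by (simp add: powr_numeral power2_eq_square mult.assoc add.commute)
  qed simp
  then show eq: "quad_energy \<Omega> s d u = power_energy \<Omega> p u"
    using u uH unfolding weak_solution_def by (auto simp: quad_energy_def power_energy_def power2_eq_square)
  show B: "power_energy \<Omega> p u > 0"
    using quad_energy_pos[OF \<Omega> uH d c pos] eq by simp
  then show "set_integrable lebesgue \<Omega> (\<lambda>x. \<bar>u x\<bar> powr (p + 1))"
    by (intro set_integrable_if_power_energy) simp
  have um: "u \<in> borel_measurable lebesgue" using uH by (simp add: Hs_def)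
  show "(LINT x:\<Omega>|lebesgue. u x powr (p + 1)) = power_energy \<Omega> p u"
    unfolding power_energy_def
  proof (rule set_lebesgue_integral_cong_AE)
    show "AE x\<in>\<Omega> in lebesgue. u x powr (p + 1) = \<bar>u x\<bar> powr (p + 1)"
      using pos by eventually_elim auto
  qed (use um \<Omega>(1) in auto)
qed

text \<open>Both parts of the tent's energy are of order \<delta>^n, so the energy on its ray is at
  most M \<delta>^n with \<open>M\<close> free of d. For a solution the tested equation turns J into
  (1/2 - 1/(p + 1)) times the power integral, a positive factor because p > 1; dividing by it gives
  \<open>C0\<close>.\<close>

lemma least_energy_bound:
  fixes \<Omega> :: "(real^'n) set" and s p :: real
  assumes n: "CARD('n) \<ge> 2" and s: "0 < s" "s < 1" and p: "p > 1" and \<Omega>: "open \<Omega>" "\<Omega> \<noteq> {}"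
  obtains d0 C0 where "d0 > 0" "C0 > 0"
    "\<And>d e u. 0 < d \<Longrightarrow> d < d0 \<Longrightarrow> mp_endpoint \<Omega> s p d e \<Longrightarrow> weak_solution \<Omega> s p d u \<Longrightarrow>
      least_energy_solution \<Omega> s p d e u \<Longrightarrow> power_energy \<Omega> p u \<le> C0 * d powr (real CARD('n) / (2 * s))"
proof -
  define c where "c = frac_lap_const TYPE('n) s"
  have c: "c > 0" unfolding c_def by (rule frac_lap_const_pos[OF n s])
  obtain x0 \<rho> where \<rho>: "\<rho> > 0" "ball x0 \<rho> \<subseteq> \<Omega>" using \<Omega> openE by (metis ex_in_conv)
  obtain a b where ab: "a > 0" "b > 0" and tent:
    "\<And>\<Omega> (x0::real^'n) \<delta>. open \<Omega> \<Longrightarrow> \<delta> > 0 \<Longrightarrow> ball x0 \<delta> \<subseteq> \<Omega> \<Longrightarrow>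
       tent x0 \<delta> \<in> Hs \<Omega> s \<and>
       \<delta> powr (2 * s) * gagliardo_form \<Omega> s (tent x0 \<delta>) (tent x0 \<delta>) \<le> a * \<delta> ^ CARD('n) \<and>
       (LINT x:\<Omega>|lebesgue. (tent x0 \<delta> x)\<^sup>2) \<le> a * \<delta> ^ CARD('n) \<and>
       set_integrable lebesgue \<Omega> (\<lambda>x. \<bar>tent x0 \<delta> x\<bar> powr (p + 1)) \<and>
       b * \<delta> ^ CARD('n) \<le> (LINT x:\<Omega>|lebesgue. \<bar>tent x0 \<delta> x\<bar> powr (p + 1))"
    using tent_energy_bounds[OF n s, of p] p by auto
  define A where "A = c / 2 * a + a"
  have A: "A > 0" using c ab by (simp add: A_def add_pos_pos)
  obtain M where M: "M > 0" "\<And>t. t \<ge> 0 \<Longrightarrow> t\<^sup>2 * A / 2 - t powr (p + 1) * b / (p + 1) \<le> M"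
    using power_balance_bounded[OF A ab(2) p] by blast
  define C0 where "C0 = M / (1/2 - 1/(p + 1))"
  have p2: "1/2 - 1/(p + 1) > 0" using p by (simp add: field_simps)
  have C0: "C0 > 0" using M p2 by (simp add: C0_def)
  have main: "power_energy \<Omega> p u \<le> C0 * d powr (real CARD('n) / (2 * s))"
    if d: "0 < d" "d < \<rho> powr (2 * s)" and e: "mp_endpoint \<Omega> s p d e"
      and u: "weak_solution \<Omega> s p d u" and les: "least_energy_solution \<Omega> s p d e u" for d e u
  proof -
    define \<delta> where "\<delta> = d powr (1 / (2 * s))"
    have \<delta>0: "\<delta> > 0" using d by (simp add: \<delta>_def)
    have d\<delta>: "d = \<delta> powr (2 * s)" using d s by (simp add: \<delta>_def powr_powr)
    \<comment> \<open>The restriction on d says that \<delta> < \<rho>, so the tent fits into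
      \<Omega>.\<close>
    have "\<delta> < (\<rho> powr (2 * s)) powr (1 / (2 * s))" using d s unfolding \<delta>_def by (intro powr_less_mono2) auto
    then have "\<delta> < \<rho>" using \<rho> s by (simp add: powr_powr)
    then have sub: "ball x0 \<delta> \<subseteq> \<Omega>" using \<rho> by (meson less_imp_le order_trans subset_ball)
    let ?\<phi> = "tent x0 \<delta>" and ?n = "CARD('n)"
    note T = tent[OF \<Omega>(1) \<delta>0 sub]
    have \<phi>Q: "quad_energy \<Omega> s d ?\<phi> \<le> A * \<delta> ^ ?n"
    proof -
      have "c / 2 * (d * gagliardo_form \<Omega> s ?\<phi> ?\<phi>) \<le> c / 2 * (a * \<delta> ^ ?n)"
        using T c unfolding d\<delta> by (intro mult_left_mono) auto
      then show ?thesis using T unfolding quad_energy_def c_def[symmetric] A_def by (simp add: algebra_simps)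
    qed
    have \<phi>B: "power_energy \<Omega> p ?\<phi> \<ge> b * \<delta> ^ ?n" using T by (simp add: power_energy_def)
    have \<phi>pos: "power_energy \<Omega> p ?\<phi> > 0"
      by (rule less_le_trans[OF _ \<phi>B]) (use ab \<delta>0 in simp)
    have "mp_value \<Omega> s p d e \<le> M * \<delta> ^ ?n"
    proof (rule mp_value_le_ray_sup[OF \<Omega> p _ _ _ tent_nonneg \<phi>pos e])
      show "J_energy \<Omega> s p d (\<lambda>x. t * ?\<phi> x) \<le> M * \<delta> ^ ?n" if t: "t \<ge> 0" for t
      proof -
        have "t\<^sup>2 * quad_energy \<Omega> s d ?\<phi> / 2 \<le> t\<^sup>2 * (A * \<delta> ^ ?n) / 2"
          using \<phi>Q by (intro divide_right_mono mult_left_mono) auto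
        moreover have "t powr (p + 1) * (b * \<delta> ^ ?n) / (p + 1) \<le> t powr (p + 1) * power_energy \<Omega> p ?\<phi> / (p + 1)"
          using \<phi>B p by (intro divide_right_mono mult_left_mono) auto
        ultimately have "J_energy \<Omega> s p d (\<lambda>x. t * ?\<phi> x)
          \<le> t\<^sup>2 * (A * \<delta> ^ ?n) / 2 - t powr (p + 1) * (b * \<delta> ^ ?n) / (p + 1)"
          using t by (simp add: J_energy_eq quad_energy_scale power_energy_scale)
        also have "\<dots> = (t\<^sup>2 * A / 2 - t powr (p + 1) * b / (p + 1)) * \<delta> ^ ?n"
          by (simp add: algebra_simps)
        also have "\<dots> \<le> M * \<delta> ^ ?n" using M(2)[OF t] \<delta>0 by (intro mult_right_mono) auto
        finally show ?thesis .
      qed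
    qed (use d c T M \<delta>0 in \<open>auto simp: c_def\<close>)
    then have J: "J_energy \<Omega> s p d u \<le> M * \<delta> ^ ?n" using les by (simp add: least_energy_solution_def)
    have pos: "AE x in lebesgue. x \<in> \<Omega> \<longrightarrow> u x > 0" using les by (simp add: least_energy_solution_def)
    have "J_energy \<Omega> s p d u = (1/2 - 1/(p + 1)) * power_energy \<Omega> p u"
      using weak_solution_power_energy(1)[OF \<Omega> _ _ u pos] d c unfolding J_energy_eq c_def by (simp add: algebra_simps)
    then have "power_energy \<Omega> p u \<le> C0 * \<delta> ^ ?n"
      using J p2 unfolding C0_def by (simp add: pos_le_divide_eq mult.commute)
    also have "\<delta> ^ ?n = d powr (real ?n / (2 * s))"
      using d by (simp add: \<delta>_def powr_realpow[symmetric] powr_powr)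
    finally show ?thesis .
  qed
  show thesis
    by (rule that[OF _ C0 main]) (use \<rho> in auto)
qed

section \<open>An inequality of Gagliardo-Nirenberg type\<close>

lemma nn_integral_lborel_pair:
  fixes f :: "'a::euclidean_space \<times> 'b::euclidean_space \<Rightarrow> ennreal"
  assumes [measurable]: "f \<in> borel_measurable borel"
  shows "(\<integral>\<^sup>+x. \<integral>\<^sup>+y. f (x, y) \<partial>lborel \<partial>lborel) = (\<integral>\<^sup>+z. f z \<partial>lborel)"
  by (subst lborel.nn_integral_fst) (simp_all add: lborel_prod)

text \<open>The inequality w(x)^2 \<le> 2 (w(x) - w(z))^2 + 2 w(z)^2 is integrated over z in the
  interior ball. There |x - z| < r, so the first square is at most r^(n+2s) times the Gagliardo
  density.\<close>

lemma ball_average_bound: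
  fixes w :: "real^'n \<Rightarrow> real"
  assumes [measurable]: "w \<in> borel_measurable borel" and "open \<Omega>" and s: "s > 0" and r: "r > 0" and \<eta>: "\<eta> > 0"
    and ball: "ball y (\<eta> * r) \<subseteq> \<Omega> \<inter> ball x r"
  shows "ennreal (unit_ball_vol (real CARD('n)) * (\<eta> * r) ^ CARD('n) * (w x)\<^sup>2)
    \<le> ennreal (2 * r powr (real CARD('n) + 2 * s)) * (\<integral>\<^sup>+y. indicator \<Omega> y * ennreal (gagliardo_density s w w (x, y)) \<partial>lborel)
       + 2 * (\<integral>\<^sup>+y. indicator \<Omega> y * ennreal ((w y)\<^sup>2) \<partial>lborel)"
proof -
  have [measurable]: "\<Omega> \<in> sets borel" using \<open>open \<Omega>\<close> by simp
  define N where "N = real CARD('n) + 2 * s"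
  have N: "N > 0" using s by (simp add: N_def add_pos_pos)
  have [measurable]: "(\<lambda>y. gagliardo_density s w w (x, y)) \<in> borel_measurable borel"
    unfolding gagliardo_density_def by simp
  have pt: "(w x)\<^sup>2 \<le> 2 * r powr N * gagliardo_density s w w (x, z) + 2 * (w z)\<^sup>2" if "z \<in> ball x r" for z
  proof -
    have "(w x)\<^sup>2 \<le> 2 * (w x - w z)\<^sup>2 + 2 * (w z)\<^sup>2"
      using power2_combination_le[of 1 "w x - w z" 1 "w z"] by simp
    moreover have "(w x - w z)\<^sup>2 \<le> r powr N * gagliardo_density s w w (x, z)"
    proof (cases "z = x")
      case False
      have le: "norm (x - z) powr N \<le> r powr N"
        using that N by (intro powr_mono2) (auto simp: dist_norm)
      have "norm (x - z) powr N > 0" using False by simp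
      then have "(w x - w z)\<^sup>2 = norm (x - z) powr N * gagliardo_density s w w (x, z)"
        by (simp add: gagliardo_density_def N_def power2_eq_square)
      also have "\<dots> \<le> r powr N * gagliardo_density s w w (x, z)"
        by (rule mult_right_mono[OF le gagliardo_density_nonneg])
      finally show ?thesis .
    qed (simp add: gagliardo_density_nonneg)
    ultimately show ?thesis by linarith
  qed
  have "ennreal (unit_ball_vol (real CARD('n)) * (\<eta> * r) ^ CARD('n) * (w x)\<^sup>2)
      = ennreal ((w x)\<^sup>2) * emeasure lborel (ball y (\<eta> * r))"
    using emeasure_ball[of "\<eta> * r" y] r \<eta> by (simp add: ennreal_mult' mult.commute)
  also have "\<dots> = (\<integral>\<^sup>+z. ennreal ((w x)\<^sup>2) * indicator (ball y (\<eta> * r)) z \<partial>lborel)"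
    by (rule nn_integral_cmult_indicator[symmetric]) simp
  also have "\<dots> \<le> (\<integral>\<^sup>+z. ennreal (2 * r powr N) * (indicator \<Omega> z * ennreal (gagliardo_density s w w (x, z)))
      + 2 * (indicator \<Omega> z * ennreal ((w z)\<^sup>2)) \<partial>lborel)"
  proof (rule nn_integral_mono)
    fix z
    show "ennreal ((w x)\<^sup>2) * indicator (ball y (\<eta> * r)) z \<le>
      ennreal (2 * r powr N) * (indicator \<Omega> z * ennreal (gagliardo_density s w w (x, z))) + 2 * (indicator \<Omega> z * ennreal ((w z)\<^sup>2))"
    proof (cases "z \<in> ball y (\<eta> * r)")
      case True
      then have z: "z \<in> \<Omega>" "z \<in> ball x r" using ball by auto
      have "ennreal ((w x)\<^sup>2) \<le> ennreal (2 * r powr N * gagliardo_density s w w (x, z) + 2 * (w z)\<^sup>2)"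
        by (rule ennreal_leI[OF pt[OF z(2)]])
      also have "\<dots> = ennreal (2 * r powr N) * ennreal (gagliardo_density s w w (x, z)) + 2 * ennreal ((w z)\<^sup>2)"
        using r by (simp add: ennreal_mult gagliardo_density_nonneg)
      finally show ?thesis using True z by simp
    qed simp
  qed
  also have "\<dots> = ennreal (2 * r powr N) * (\<integral>\<^sup>+y. indicator \<Omega> y * ennreal (gagliardo_density s w w (x, y)) \<partial>lborel)
       + 2 * (\<integral>\<^sup>+y. indicator \<Omega> y * ennreal ((w y)\<^sup>2) \<partial>lborel)"
    by (subst nn_integral_add) (simp_all add: nn_integral_cmult)
  finally show ?thesis unfolding N_def .
qed

text \<open>The radius is adapted to the value t: if \<kappa> r^N t^2 = 4 E, the term 2 E is half of
  the left side and is absorbed. If this radius exceeds the cap \<delta>, then t^2 \<le>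
  (4/\<kappa>) E \<delta>^(-N), and the surplus power of t is bounded directly; this case yields the
  second summand.\<close>

lemma gagliardo_nirenberg_pointwise:
  fixes t E \<kappa> N s \<delta> :: real and g :: ennreal
  assumes t: "t \<ge> 0" and E: "E > 0" and \<kappa>: "\<kappa> > 0" and N: "N > 0" and s: "s > 0" and \<delta>: "\<delta> > 0"
    and avg: "\<And>r. 0 < r \<Longrightarrow> r \<le> \<delta> \<Longrightarrow>
      ennreal (\<kappa> * r powr N * t\<^sup>2) \<le> ennreal (2 * r powr (N + 2 * s)) * g + ennreal (2 * E)"
  shows "ennreal (t powr (2 + 4 * s / N)) \<le>
    ennreal ((4 / \<kappa>) powr (1 + 2 * s / N) * E powr (2 * s / N)) * g
    + ennreal ((4 / \<kappa>) powr (2 * s / N) * E powr (2 * s / N) * \<delta> powr (-2 * s) * t\<^sup>2)"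
proof (cases "t = 0")
  case True
  then show ?thesis by simp
next
  case False
  with t have t: "t > 0" by simp
  define \<theta> where "\<theta> = 2 * s / N"
  have \<theta>: "\<theta> > 0" using s N by (simp add: \<theta>_def)
  have N\<theta>: "N * \<theta> = 2 * s" using N by (simp add: \<theta>_def)
  define R where "R = 4 * E / (\<kappa> * t\<^sup>2)"
  have R: "R > 0" using E \<kappa> t by (simp add: R_def)
  define r where "r = R powr (1 / N)"
  have r: "r > 0" "r powr N = R" using R N by (auto simp: r_def powr_powr)
  have tq: "t powr (2 + 4 * s / N) = t\<^sup>2 * (t\<^sup>2) powr \<theta>"
    using t by (simp add: powr_add \<theta>_def powr_numeral[symmetric] powr_powr del: powr_numeral)
  show ?thesis
  proof (cases "r \<le> \<delta>")
    case True
    have "\<kappa> * r powr N * t\<^sup>2 = 4 * E" using \<kappa> t by (simp add: r R_def)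
    with avg[OF r(1) True]
    have "ennreal (4 * E) \<le> ennreal (2 * r powr (N + 2 * s)) * g + ennreal (2 * E)" by simp
    moreover have "ennreal (4 * E) = ennreal (2 * E) + ennreal (2 * E)" using E by (simp add: ennreal_plus[symmetric] del: ennreal_plus)
    ultimately have "ennreal (2 * E) + ennreal (2 * E) \<le> ennreal (2 * E) + ennreal (2 * r powr (N + 2 * s)) * g"
      by (simp only: add.commute)
    \<comment> \<open>\<open>g\<close> may be infinite, so the common finite term is cancelled in
      \<open>ennreal\<close> instead of being subtracted.\<close>
    then have 1: "ennreal (2 * E) \<le> ennreal (2 * r powr (N + 2 * s)) * g"
      unfolding ennreal_add_left_cancel_le by simp
    have rs: "r powr (N + 2 * s) = R * R powr \<theta>"
      using r by (simp add: powr_add N\<theta>[symmetric] powr_powr[symmetric])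
    have "ennreal (t powr (2 + 4 * s / N)) = ennreal (t\<^sup>2 * (t\<^sup>2) powr \<theta> / (2 * E)) * ennreal (2 * E)"
      using E t by (simp add: tq ennreal_mult'[symmetric])
    also have "\<dots> \<le> ennreal (t\<^sup>2 * (t\<^sup>2) powr \<theta> / (2 * E)) * (ennreal (2 * (R * R powr \<theta>)) * g)"
      using 1 unfolding rs by (rule mult_left_mono) simp
    also have "\<dots> = ennreal (t\<^sup>2 * (t\<^sup>2) powr \<theta> / (2 * E) * (2 * (R * R powr \<theta>))) * g"
      using E t R by (simp add: ennreal_mult'[symmetric] mult.assoc[symmetric])
    also have "t\<^sup>2 * (t\<^sup>2) powr \<theta> / (2 * E) * (2 * (R * R powr \<theta>)) = (4 / \<kappa>) powr (1 + \<theta>) * E powr \<theta>"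
    proof -
      have "(t\<^sup>2) powr \<theta> * R powr \<theta> = (4 / \<kappa>) powr \<theta> * E powr \<theta>"
      proof -
        have "(t\<^sup>2) powr \<theta> * R powr \<theta> = (t\<^sup>2 * R) powr \<theta>" using R by (simp add: powr_mult)
        also have "t\<^sup>2 * R = (4 / \<kappa>) * E" using t by (simp add: R_def)
        also have "((4 / \<kappa>) * E) powr \<theta> = (4 / \<kappa>) powr \<theta> * E powr \<theta>" by (rule powr_mult)
        finally show ?thesis .
      qed
      moreover have "t\<^sup>2 / (2 * E) * (2 * R) = 4 / \<kappa>" using E t by (simp add: R_def)
      moreover have "t\<^sup>2 * (t\<^sup>2) powr \<theta> / (2 * E) * (2 * (R * R powr \<theta>)) = (t\<^sup>2 / (2 * E) * (2 * R)) * ((t\<^sup>2) powr \<theta> * R powr \<theta>)"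
        by simp
      moreover have "(4 / \<kappa>) powr (1 + \<theta>) = (4 / \<kappa>) * (4 / \<kappa>) powr \<theta>"
        using \<kappa> by (simp add: powr_add)
      ultimately show ?thesis by (simp only: mult.assoc)
    qed
    finally show ?thesis unfolding \<theta>_def[symmetric] by (simp add: add_increasing2)
  next
    case False
    have "\<delta> powr N < R" using False N \<delta> unfolding r(2)[symmetric] by (intro powr_less_mono2) auto
    then have "t\<^sup>2 \<le> (4 / \<kappa>) * E * \<delta> powr (-N)"
      using \<kappa> t \<delta> by (simp add: R_def powr_minus field_simps)
    then have "(t\<^sup>2) powr \<theta> \<le> ((4 / \<kappa>) * E * \<delta> powr (-N)) powr \<theta>"
      using \<theta> by (intro powr_mono2) auto
    also have "\<dots> = (4 / \<kappa>) powr \<theta> * E powr \<theta> * \<delta> powr (-2 * s)"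
      unfolding powr_mult using N\<theta> by (simp add: powr_powr)
    finally have "(t\<^sup>2) powr \<theta> \<le> (4 / \<kappa>) powr \<theta> * E powr \<theta> * \<delta> powr (-2 * s)" .
    then have "t powr (2 + 4 * s / N) \<le> t\<^sup>2 * ((4 / \<kappa>) powr \<theta> * E powr \<theta> * \<delta> powr (-2 * s))"
      unfolding tq by (rule mult_left_mono) simp
    also have "\<dots> = (4 / \<kappa>) powr \<theta> * E powr \<theta> * \<delta> powr (-2 * s) * t\<^sup>2" by simp
    finally have "ennreal (t powr (2 + 4 * s / N)) \<le> ennreal ((4 / \<kappa>) powr \<theta> * E powr \<theta> * \<delta> powr (-2 * s) * t\<^sup>2)"
      by (rule ennreal_leI)
    then show ?thesis unfolding \<theta>_def[symmetric] by (simp add: add_increasing)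
  qed
qed

text \<open>The pointwise estimate is integrated over \<Omega>. The averages involve points of
  \<Omega> alone, so \<open>g\<close> integrates to the form over \<Omega> \<times> \<Omega>, and
  both summands end up with the same powers of E and \<delta>.\<close>

lemma gagliardo_nirenberg_borel:
  fixes w :: "real^'n \<Rightarrow> real"
  assumes w[measurable]: "w \<in> borel_measurable borel" and "open \<Omega>" and s: "s > 0" and \<eta>: "\<eta> > 0" and \<delta>: "\<delta> > 0" "\<delta> \<le> \<rho>"
    and cond: "\<And>x r. x \<in> \<Omega> \<Longrightarrow> 0 < r \<Longrightarrow> r \<le> \<rho> \<Longrightarrow> \<exists>y. ball y (\<eta> * r) \<subseteq> \<Omega> \<inter> ball x r"
    and E: "E > 0"
    and w2: "(\<integral>\<^sup>+y. indicator \<Omega> y * ennreal ((w y)\<^sup>2) \<partial>lborel) \<le> ennreal E"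
    and wG: "(\<integral>\<^sup>+z. indicator (\<Omega> \<times> \<Omega>) z * ennreal (gagliardo_density s w w z) \<partial>lborel) \<le> ennreal (E * \<delta> powr (-2 * s))"
  defines "N \<equiv> real CARD('n)"
  defines "\<kappa> \<equiv> unit_ball_vol N * \<eta> powr N"
  shows "(\<integral>\<^sup>+x. indicator \<Omega> x * ennreal (\<bar>w x\<bar> powr (2 + 4 * s / N)) \<partial>lborel)
    \<le> ennreal (((4 / \<kappa>) powr (1 + 2 * s / N) + (4 / \<kappa>) powr (2 * s / N)) * E powr (1 + 2 * s / N) * \<delta> powr (-2 * s))"
proof -
  have [measurable]: "\<Omega> \<in> sets borel" using \<open>open \<Omega>\<close> by simp
  have N: "N > 0" by (simp add: N_def)
  have \<kappa>: "\<kappa> > 0" using \<eta> N by (simp add: \<kappa>_def)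
  define \<theta> where "\<theta> = 2 * s / N"
  define g where "g x = (\<integral>\<^sup>+y. indicator \<Omega> y * ennreal (gagliardo_density s w w (x, y)) \<partial>lborel)" for x
  have gd[measurable]: "(\<lambda>z. indicator (\<Omega> \<times> \<Omega>) z * ennreal (gagliardo_density s w w z)) \<in> borel_measurable borel"
    using \<open>open \<Omega>\<close> by (intro borel_measurable_times_ennreal borel_measurable_indicator measurable_compose[OF _ measurable_ennreal] borel_measurable_gagliardo_density_borel w) (simp add: open_Times)
  have "(\<lambda>z. indicator \<Omega> (snd z) * ennreal (gagliardo_density s w w z)) \<in> borel_measurable (lborel \<Otimes>\<^sub>M lborel)"
  proof -
    have [measurable]: "gagliardo_density s w w \<in> borel_measurable (borel \<Otimes>\<^sub>M borel)"
      using borel_measurable_gagliardo_density_borel[OF w w] by (simp add: borel_prod)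
    show ?thesis by measurable
  qed
  from lborel.borel_measurable_nn_integral_fst[OF this]
  have gm[measurable]: "g \<in> borel_measurable lborel" unfolding g_def by simp
  have gint: "(\<integral>\<^sup>+x. indicator \<Omega> x * g x \<partial>lborel) \<le> ennreal (E * \<delta> powr (-2 * s))"
  proof -
    have "(\<integral>\<^sup>+x. indicator \<Omega> x * g x \<partial>lborel) = (\<integral>\<^sup>+x. \<integral>\<^sup>+y. indicator (\<Omega> \<times> \<Omega>) (x, y) * ennreal (gagliardo_density s w w (x, y)) \<partial>lborel \<partial>lborel)"
    proof (rule nn_integral_cong)
      fix x
      show "indicator \<Omega> x * g x = (\<integral>\<^sup>+y. indicator (\<Omega> \<times> \<Omega>) (x, y) * ennreal (gagliardo_density s w w (x, y)) \<partial>lborel)"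
        by (cases "x \<in> \<Omega>") (simp_all add: g_def indicator_times)
    qed
    also have "\<dots> = (\<integral>\<^sup>+z. indicator (\<Omega> \<times> \<Omega>) z * ennreal (gagliardo_density s w w z) \<partial>lborel)"
      by (rule nn_integral_lborel_pair[OF gd])
    finally show ?thesis using wG by simp
  qed
  define c1 c2 where "c1 = (4 / \<kappa>) powr (1 + \<theta>) * E powr \<theta>" and "c2 = (4 / \<kappa>) powr \<theta> * E powr \<theta> * \<delta> powr (-2 * s)"
  have c: "c1 \<ge> 0" "c2 \<ge> 0" by (auto simp: c1_def c2_def)
  have pt: "ennreal (\<bar>w x\<bar> powr (2 + 4 * s / N)) \<le> ennreal c1 * g x + ennreal (c2 * (w x)\<^sup>2)" if x: "x \<in> \<Omega>" for x
  proof -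
    have "ennreal (\<kappa> * r powr N * \<bar>w x\<bar>\<^sup>2) \<le> ennreal (2 * r powr (N + 2 * s)) * g x + ennreal (2 * E)"
      if r: "0 < r" "r \<le> \<delta>" for r
    proof -
      obtain y where y: "ball y (\<eta> * r) \<subseteq> \<Omega> \<inter> ball x r" using cond[OF x r(1)] r \<delta> by auto
      have eq: "\<kappa> * r powr N * \<bar>w x\<bar>\<^sup>2 = unit_ball_vol (real CARD('n)) * (\<eta> * r) ^ CARD('n) * (w x)\<^sup>2"
        using r \<eta> by (simp add: \<kappa>_def N_def powr_realpow power_mult_distrib)
      have "ennreal (\<kappa> * r powr N * \<bar>w x\<bar>\<^sup>2) \<le> ennreal (2 * r powr (N + 2 * s)) * g x
          + 2 * (\<integral>\<^sup>+y. indicator \<Omega> y * ennreal ((w y)\<^sup>2) \<partial>lborel)"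
        unfolding eq unfolding g_def N_def by (rule ball_average_bound[OF w \<open>open \<Omega>\<close> s r(1) \<eta> y])
      also have "\<dots> \<le> ennreal (2 * r powr (N + 2 * s)) * g x + 2 * ennreal E"
        using w2 by (intro add_left_mono mult_left_mono) auto
      finally show ?thesis using E by (simp add: ennreal_mult)
    qed
    from gagliardo_nirenberg_pointwise[OF _ E \<kappa> N s \<delta>(1), where g="g x" and t="\<bar>w x\<bar>", OF _ this]
    show ?thesis by (simp add: c1_def c2_def \<theta>_def)
  qed
  have "(\<integral>\<^sup>+x. indicator \<Omega> x * ennreal (\<bar>w x\<bar> powr (2 + 4 * s / N)) \<partial>lborel)
    \<le> (\<integral>\<^sup>+x. ennreal c1 * (indicator \<Omega> x * g x) + ennreal c2 * (indicator \<Omega> x * ennreal ((w x)\<^sup>2)) \<partial>lborel)"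
    by (intro nn_integral_mono) (use pt c in \<open>auto simp: indicator_def ennreal_mult\<close>)
  also have "\<dots> = ennreal c1 * (\<integral>\<^sup>+x. indicator \<Omega> x * g x \<partial>lborel) + ennreal c2 * (\<integral>\<^sup>+x. indicator \<Omega> x * ennreal ((w x)\<^sup>2) \<partial>lborel)"
    by (subst nn_integral_add) (simp_all add: nn_integral_cmult)
  also have "\<dots> \<le> ennreal c1 * ennreal (E * \<delta> powr (-2 * s)) + ennreal c2 * ennreal E"
    using gint w2 by (intro add_mono mult_left_mono) auto
  also have "\<dots> = ennreal (c1 * (E * \<delta> powr (-2 * s)) + c2 * E)"
    using c E by (simp add: ennreal_mult)
  also have "c1 * (E * \<delta> powr (-2 * s)) + c2 * E = ((4 / \<kappa>) powr (1 + \<theta>) + (4 / \<kappa>) powr \<theta>) * (E * E powr \<theta>) * \<delta> powr (-2 * s)"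
    by (simp add: c1_def c2_def algebra_simps)
  also have "E * E powr \<theta> = E powr (1 + \<theta>)" using E by (simp add: powr_add)
  finally show ?thesis by (simp add: \<theta>_def)
qed

lemma nn_integral_indicator_eq_set_integral:
  assumes "set_integrable M A f" "\<And>x. f x \<ge> (0::real)"
  shows "(\<integral>\<^sup>+x. indicator A x * ennreal (f x) \<partial>M) = ennreal (LINT x:A|M. f x)"
proof -
  have "(\<integral>\<^sup>+x. indicator A x * ennreal (f x) \<partial>M) = (\<integral>\<^sup>+x. ennreal (indicator A x *\<^sub>R f x) \<partial>M)"
    by (intro nn_integral_cong) (auto simp: indicator_def)
  also have "\<dots> = ennreal (LINT x:A|M. f x)"
    using assms unfolding set_integrable_def set_lebesgue_integral_def
    by (intro nn_integral_eq_integral) (auto simp: indicator_def)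
  finally show ?thesis .
qed

text \<open>E dominates both the L2 part and the rescaled form, as a multiple of the quadratic
  energy does. A Borel representative makes Tonelli available, and \<Omega> \<times> \<Omega> lies
  in \<open>T_set \<Omega>\<close>.\<close>

lemma gagliardo_nirenberg:
  fixes \<Omega> :: "(real^'n) set"
  assumes dom: "bounded_C11_domain \<Omega>" and s: "s > 0"
  obtains \<rho> C where "\<rho> > 0" "C > 0"
    "\<And>w \<delta> E. w \<in> Hs \<Omega> s \<Longrightarrow> 0 < \<delta> \<Longrightarrow> \<delta> \<le> \<rho> \<Longrightarrow> E > 0 \<Longrightarrow> (LINT x:\<Omega>|lebesgue. (w x)\<^sup>2) \<le> E \<Longrightarrow>
       \<delta> powr (2 * s) * gagliardo_form \<Omega> s w w \<le> E \<Longrightarrow>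
       (\<integral>\<^sup>+x. indicator \<Omega> x * ennreal (\<bar>w x\<bar> powr (2 + 4 * s / real CARD('n))) \<partial>lebesgue)
         \<le> ennreal (C * E powr (1 + 2 * s / real CARD('n)) * \<delta> powr (-2 * s))"
proof -
  obtain \<rho> \<eta> where \<rho>: "\<rho> > 0" and \<eta>: "\<eta> > 0"
    and cond: "\<And>x r. x \<in> \<Omega> \<Longrightarrow> 0 < r \<Longrightarrow> r \<le> \<rho> \<Longrightarrow> \<exists>y. ball y (\<eta> * r) \<subseteq> \<Omega> \<inter> ball x r"
    using interior_ball_condition[OF dom] by blast
  have op: "open \<Omega>" using dom by (simp add: bounded_C11_domain_def)
  define N where "N = real CARD('n)"
  define \<kappa> where "\<kappa> = unit_ball_vol N * \<eta> powr N"
  define C where "C = (4 / \<kappa>) powr (1 + 2 * s / N) + (4 / \<kappa>) powr (2 * s / N)"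
  have "\<kappa> > 0" using \<eta> by (simp add: \<kappa>_def N_def)
  then have C: "C > 0" by (simp add: C_def add_pos_pos)
  have main: "(\<integral>\<^sup>+x. indicator \<Omega> x * ennreal (\<bar>w x\<bar> powr (2 + 4 * s / real CARD('n))) \<partial>lebesgue)
         \<le> ennreal (C * E powr (1 + 2 * s / real CARD('n)) * \<delta> powr (-2 * s))"
    if w: "w \<in> Hs \<Omega> s" and \<delta>: "0 < \<delta>" "\<delta> \<le> \<rho>" and E: "E > 0" and w2: "(LINT x:\<Omega>|lebesgue. (w x)\<^sup>2) \<le> E"
      and wG: "\<delta> powr (2 * s) * gagliardo_form \<Omega> s w w \<le> E" for w \<delta> E
  proof -
    have wm: "w \<in> borel_measurable lebesgue" and wi: "set_integrable lebesgue \<Omega> (\<lambda>x. (w x)\<^sup>2)"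
      and wgi: "set_integrable lebesgue (T_set \<Omega>) (gagliardo_density s w w)"
      using w by (auto simp: Hs_def)
    obtain v where v: "v \<in> borel_measurable lborel" and ae: "AE x in lborel. w x = v x"
      using completion_ex_borel_measurable_real[OF wm] by blast
    have vb: "v \<in> borel_measurable borel" using v by simp
    have 1: "(\<integral>\<^sup>+x. indicator \<Omega> x * ennreal ((v x)\<^sup>2) \<partial>lborel) \<le> ennreal E"
    proof -
      have "(\<integral>\<^sup>+x. indicator \<Omega> x * ennreal ((v x)\<^sup>2) \<partial>lborel) = (\<integral>\<^sup>+x. indicator \<Omega> x * ennreal ((w x)\<^sup>2) \<partial>lborel)"
        using ae by (intro nn_integral_cong_AE) (auto elim: eventually_mono)
      also have "\<dots> = ennreal (LINT x:\<Omega>|lebesgue. (w x)\<^sup>2)"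
        using nn_integral_indicator_eq_set_integral[OF wi] by (simp add: nn_integral_completion)
      also have "\<dots> \<le> ennreal E" using w2 by (rule ennreal_leI)
      finally show ?thesis .
    qed
    have 2: "(\<integral>\<^sup>+z. indicator (\<Omega> \<times> \<Omega>) z * ennreal (gagliardo_density s v v z) \<partial>lborel) \<le> ennreal (E * \<delta> powr (-2 * s))"
    proof -
      have "(\<integral>\<^sup>+z. indicator (\<Omega> \<times> \<Omega>) z * ennreal (gagliardo_density s v v z) \<partial>lborel)
        = (\<integral>\<^sup>+z. indicator (\<Omega> \<times> \<Omega>) z * ennreal (gagliardo_density s v v z) \<partial>lebesgue)"
        by (simp add: nn_integral_completion)
      also have "\<dots> = (\<integral>\<^sup>+z. indicator (\<Omega> \<times> \<Omega>) z * ennreal (gagliardo_density s w w z) \<partial>lebesgue)"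
      proof (rule nn_integral_cong_AE)
        show "AE z in lebesgue. indicator (\<Omega> \<times> \<Omega>) z * ennreal (gagliardo_density s v v z)
            = indicator (\<Omega> \<times> \<Omega>) z * ennreal (gagliardo_density s w w z)"
          using AE_lebesgue_pair[OF ae]
          by eventually_elim (auto simp: gagliardo_density_def split: prod.split)
      qed
      also have "\<dots> \<le> (\<integral>\<^sup>+z. indicator (T_set \<Omega>) z * ennreal (gagliardo_density s w w z) \<partial>lebesgue)"
        by (intro nn_integral_mono mult_right_mono) (auto simp: indicator_def T_set_def)
      also have "\<dots> = ennreal (gagliardo_form \<Omega> s w w)"
        unfolding gagliardo_form_def by (rule nn_integral_indicator_eq_set_integral[OF wgi gagliardo_density_nonneg])
      also have "\<dots> \<le> ennreal (E * \<delta> powr (-2 * s))"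
        using wG \<delta> by (intro ennreal_leI) (simp add: powr_minus field_simps)
      finally show ?thesis .
    qed
    have "(\<integral>\<^sup>+x. indicator \<Omega> x * ennreal (\<bar>w x\<bar> powr (2 + 4 * s / real CARD('n))) \<partial>lebesgue)
      = (\<integral>\<^sup>+x. indicator \<Omega> x * ennreal (\<bar>v x\<bar> powr (2 + 4 * s / real CARD('n))) \<partial>lborel)"
      unfolding nn_integral_completion using ae by (intro nn_integral_cong_AE) (auto elim: eventually_mono)
    also have "\<dots> \<le> ennreal (C * E powr (1 + 2 * s / real CARD('n)) * \<delta> powr (-2 * s))"
      using gagliardo_nirenberg_borel[OF vb op s \<eta> \<delta> cond E 1 2] by (simp add: C_def \<kappa>_def N_def)
    finally show ?thesis .
  qed
  show thesis using that[OF \<rho> C main] by blast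
qed

section \<open>De Giorgi iteration\<close>

lemma set_integrable_nonneg_bound:
  fixes f h :: "'a::euclidean_space \<Rightarrow> real"
  assumes f: "set_integrable lebesgue A f" and "A \<in> sets borel" "h \<in> borel_measurable lebesgue"
    and "\<And>x. 0 \<le> h x" "\<And>x. h x \<le> f x"
  shows "set_integrable lebesgue A h"
proof (rule set_integrable_bound[OF f])
  show "set_borel_measurable lebesgue A h" using assms by (intro set_borel_measurable_lebesgue)
  have "norm (h x) \<le> norm (f x)" for x
    using assms(4,5)[of x] by simp
  then show "AE x in lebesgue. x \<in> A \<longrightarrow> norm (h x) \<le> norm (f x)" by simp
qed

text \<open>Truncation is nondecreasing and 1-Lipschitz, so for x = a - b and y the difference of
  the truncated values y^2 \<le> x y \<le> x^2. The first inequality is what testing the equation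
  with w requires, the second gives integrability; m \<ge> 0 ensures w \<le> u where w is
  positive.\<close>

lemma Hs_positive_part:
  fixes u :: "real^'n \<Rightarrow> real"
  assumes "open \<Omega>" and u: "u \<in> Hs \<Omega> s" and m: "m \<ge> 0"
  defines "w \<equiv> \<lambda>x. max 0 (u x - m)"
  shows "w \<in> Hs \<Omega> s" and "gagliardo_form \<Omega> s w w \<le> gagliardo_form \<Omega> s u w"
    and "(LINT x:\<Omega>|lebesgue. (w x)\<^sup>2) \<le> (LINT x:\<Omega>|lebesgue. u x * w x)"
proof -
  have um: "u \<in> borel_measurable lebesgue" "set_integrable lebesgue \<Omega> (\<lambda>x. (u x)\<^sup>2)"
      "set_integrable lebesgue (T_set \<Omega>) (gagliardo_density s u u)"
    using u by (auto simp: Hs_def)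
  have wm: "w \<in> borel_measurable lebesgue" using um(1) unfolding w_def by simp
  have \<Omega>b: "\<Omega> \<in> sets borel" using \<open>open \<Omega>\<close> by simp
  have real: "(max 0 (a - m) - max 0 (b - m))\<^sup>2 \<le> (a - b) * (max 0 (a - m) - max 0 (b - m))"
    "(a - b) * (max 0 (a - m) - max 0 (b - m)) \<le> (a - b)\<^sup>2" for a b :: real
  proof -
    define x y where "x = a - b" and "y = max 0 (a - m) - max 0 (b - m)"
    have "0 \<le> x \<and> 0 \<le> y \<and> y \<le> x \<or> x \<le> 0 \<and> y \<le> 0 \<and> x \<le> y"
      unfolding x_def y_def by (auto simp: max_def)
    then have "y\<^sup>2 \<le> x * y \<and> x * y \<le> x\<^sup>2"
      unfolding power2_eq_square by (auto intro: mult_right_mono mult_right_mono_neg mult_left_mono mult_left_mono_neg)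
    then show "(max 0 (a - m) - max 0 (b - m))\<^sup>2 \<le> (a - b) * (max 0 (a - m) - max 0 (b - m))"
      "(a - b) * (max 0 (a - m) - max 0 (b - m)) \<le> (a - b)\<^sup>2"
      unfolding x_def y_def by auto
  qed
  have d1: "gagliardo_density s w w z \<le> gagliardo_density s u w z" for z
    by (rule gagliardo_density_mono) (simp add: w_def real)
  have d2: "gagliardo_density s u w z \<le> gagliardo_density s u u z" for z
    using real(2)[of "u (fst z)" "u (snd z)"]
    by (cases z) (auto simp: w_def gagliardo_density_def power2_eq_square intro: divide_right_mono)
  have d0: "0 \<le> gagliardo_density s u w z" for z
    using d1 gagliardo_density_nonneg order_trans by blast
  have T: "T_set \<Omega> \<in> sets borel" using T_set_borel[OF \<open>open \<Omega>\<close>] .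
  have uw: "set_integrable lebesgue (T_set \<Omega>) (gagliardo_density s u w)"
    by (rule set_integrable_nonneg_bound[OF um(3) T borel_measurable_gagliardo_density[OF um(1) wm] d0 d2])
  have ww: "set_integrable lebesgue (T_set \<Omega>) (gagliardo_density s w w)"
    by (rule set_integrable_nonneg_bound[OF uw T borel_measurable_gagliardo_density[OF wm wm] gagliardo_density_nonneg d1])
  have r2: "(w x)\<^sup>2 \<le> u x * w x" "u x * w x \<le> (u x)\<^sup>2" for x
  proof -
    have "w x = 0 \<or> 0 \<le> w x \<and> w x \<le> u x" using m by (auto simp: w_def max_def)
    then show "(w x)\<^sup>2 \<le> u x * w x" "u x * w x \<le> (u x)\<^sup>2"
      unfolding power2_eq_square by (auto intro: mult_right_mono mult_left_mono)
  qed
  have r0: "0 \<le> u x * w x" for x using r2(1)[of x] zero_le_power2[of "w x"] by linarith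
  have uwi: "set_integrable lebesgue \<Omega> (\<lambda>x. u x * w x)"
    by (rule set_integrable_nonneg_bound[OF um(2) \<Omega>b _ r0 r2(2)]) (use um(1) wm in simp)
  have wwi: "set_integrable lebesgue \<Omega> (\<lambda>x. (w x)\<^sup>2)"
    by (rule set_integrable_nonneg_bound[OF uwi \<Omega>b _ zero_le_power2 r2(1)]) (use wm in simp)
  show "w \<in> Hs \<Omega> s" using wm wwi ww by (simp add: Hs_def)
  show "gagliardo_form \<Omega> s w w \<le> gagliardo_form \<Omega> s u w"
    unfolding gagliardo_form_def by (rule set_integral_mono[OF ww uw d1])
  show "(LINT x:\<Omega>|lebesgue. (w x)\<^sup>2) \<le> (LINT x:\<Omega>|lebesgue. u x * w x)"
    by (rule set_integral_mono[OF wwi uwi r2(1)])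
qed

text \<open>The quantity driven to 0 by the iteration; its exponent p + 1 is the one that the energy
  bound controls at level 0.\<close>

definition truncation_energy :: "(real^'n) set \<Rightarrow> real \<Rightarrow> (real^'n \<Rightarrow> real) \<Rightarrow> real \<Rightarrow> real" where
  "truncation_energy \<Omega> p u k = (LINT x:\<Omega>|lebesgue. max 0 (u x - k) powr (p + 1))"

lemma truncation_energy_integrable:
  fixes u :: "real^'n \<Rightarrow> real"
  assumes "open \<Omega>" and um: "u \<in> borel_measurable lebesgue" and p: "p > 0" and k: "k \<ge> 0"
    and up: "set_integrable lebesgue \<Omega> (\<lambda>x. \<bar>u x\<bar> powr (p + 1))"
  shows "set_integrable lebesgue \<Omega> (\<lambda>x. max 0 (u x - k) powr (p + 1))"
proof (rule set_integrable_bound[OF up])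
  show "set_borel_measurable lebesgue \<Omega> (\<lambda>x. max 0 (u x - k) powr (p + 1))"
    using um \<open>open \<Omega>\<close> by (intro set_borel_measurable_lebesgue) auto
  show "AE x in lebesgue. x \<in> \<Omega> \<longrightarrow> norm (max 0 (u x - k) powr (p + 1)) \<le> norm (\<bar>u x\<bar> powr (p + 1))"
    using k p by (intro AE_I2) (auto intro!: powr_mono2)
qed

text \<open>The equation is tested with the truncation at level k + h. Where that is positive, v = u
  - k exceeds h, so u = v + k \<le> (1 + k/h) v: the gap h lets the full power of u be bounded by
  the truncation at the lower level k.\<close>

lemma truncated_energy_le:
  fixes u :: "real^'n \<Rightarrow> real"
  assumes "open \<Omega>" and p: "p > 1" and d: "d \<ge> 0" and c: "frac_lap_const TYPE('n) s \<ge> 0"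
    and u: "weak_solution \<Omega> s p d u" and up: "set_integrable lebesgue \<Omega> (\<lambda>x. \<bar>u x\<bar> powr (p + 1))"
    and k: "k \<ge> 0" and h: "h > 0"
  shows "quad_energy \<Omega> s d (\<lambda>x. max 0 (u x - (k + h))) \<le> (1 + k / h) powr p * truncation_energy \<Omega> p u k"
proof -
  define w where "w = (\<lambda>x. max 0 (u x - (k + h)))"
  have uH: "u \<in> Hs \<Omega> s" using u by (simp add: weak_solution_def)
  then have um: "u \<in> borel_measurable lebesgue" by (simp add: Hs_def)
  have wm: "w \<in> borel_measurable lebesgue" using um unfolding w_def by simp
  have "k + h \<ge> 0" using k h by simp
  note positive_part = Hs_positive_part[OF \<open>open \<Omega>\<close> uH this]
  have W: "w \<in> Hs \<Omega> s" "gagliardo_form \<Omega> s w w \<le> gagliardo_form \<Omega> s u w"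
    "(LINT x:\<Omega>|lebesgue. (w x)\<^sup>2) \<le> (LINT x:\<Omega>|lebesgue. u x * w x)"
    using positive_part by (simp_all add: w_def)
  define c' where "c' = d * frac_lap_const TYPE('n) s / 2"
  have c': "c' \<ge> 0" using d c by (simp add: c'_def)
  have "quad_energy \<Omega> s d w \<le> c' * gagliardo_form \<Omega> s u w + (LINT x:\<Omega>|lebesgue. u x * w x)"
    unfolding quad_energy_def c'_def[symmetric] by (intro add_mono mult_left_mono W c')
  also have "\<dots> = (LINT x:\<Omega>|lebesgue. \<bar>u x\<bar> powr (p - 1) * u x * w x)"
    using u W(1) by (simp add: weak_solution_def c'_def)
  also have "\<dots> \<le> (LINT x:\<Omega>|lebesgue. (1 + k / h) powr p * max 0 (u x - k) powr (p + 1))"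
  proof -
    have pt: "0 \<le> \<bar>u x\<bar> powr (p - 1) * u x * w x \<and>
      \<bar>u x\<bar> powr (p - 1) * u x * w x \<le> (1 + k / h) powr p * max 0 (u x - k) powr (p + 1)" for x
    proof (cases "u x > k + h")
      case False
      then have "w x = 0" by (simp add: w_def)
      then show ?thesis by simp
    next
      case True
      define v where "v = u x - k"
      have v: "v > h" "w x \<le> v" "w x \<ge> 0" using True k h by (auto simp: v_def w_def)
      have upos: "u x > 0" using True k h by linarith
      have "k \<le> k / h * v" using mult_left_mono[of h v "k / h"] v h k by simp
      then have uv: "u x \<le> (1 + k / h) * v" by (simp add: v_def algebra_simps)
      have "\<bar>u x\<bar> powr (p - 1) * u x = u x powr p"
        using upos powr_add[of "u x" "p - 1" 1] by simp
      also have "\<dots> \<le> ((1 + k / h) * v) powr p" using uv upos p by (intro powr_mono2) auto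
      also have "\<dots> = (1 + k / h) powr p * v powr p" by (rule powr_mult)
      finally have "\<bar>u x\<bar> powr (p - 1) * u x \<le> (1 + k / h) powr p * v powr p" .
      from mult_mono[OF this v(2)]
      have "\<bar>u x\<bar> powr (p - 1) * u x * w x \<le> (1 + k / h) powr p * v powr p * v"
        using v h by simp
      also have "\<dots> = (1 + k / h) powr p * v powr (p + 1)"
        using v h by (simp add: powr_add)
      finally show ?thesis using v h upos by (simp add: v_def)
    qed
    have int2: "set_integrable lebesgue \<Omega> (\<lambda>x. (1 + k / h) powr p * max 0 (u x - k) powr (p + 1))"
      using truncation_energy_integrable[OF \<open>open \<Omega>\<close> um _ k up] p by simp
    have "set_integrable lebesgue \<Omega> (\<lambda>x. \<bar>u x\<bar> powr (p - 1) * u x * w x)"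
      by (rule set_integrable_nonneg_bound[OF int2]) (use pt um wm \<open>open \<Omega>\<close> in auto)
    then show ?thesis by (rule set_integral_mono[OF _ int2]) (use pt in blast)
  qed
  also have "\<dots> = (1 + k / h) powr p * truncation_energy \<Omega> p u k"
    by (simp add: truncation_energy_def)
  finally show ?thesis unfolding w_def .
qed

text \<open>The level rises by h twice: the first gap serves the energy estimate, the second gives w
  \<ge> h on the final set, so the exponent drops from q to p + 1 at the price h^(-\<sigma>), where
  \<sigma> = q - (p + 1). The power 1 + \<theta> is the superlinear gain. The positive majorant
  \<open>Y\<close> replaces a truncation energy that may vanish, since the interpolation inequality
  asks for E > 0.\<close>

lemma de_giorgi_step:
  fixes \<Omega> :: "(real^'n) set" and s p :: real
  assumes n: "CARD('n) \<ge> 2" and s: "0 < s" "s < 1" and p: "p > 1" and dom: "bounded_C11_domain \<Omega>"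
    and pq: "p + 1 < 2 + 4 * s / real CARD('n)"
  defines "\<theta> \<equiv> 2 * s / real CARD('n)" and "\<sigma> \<equiv> 1 + 4 * s / real CARD('n) - p"
  obtains \<rho> A where "\<rho> > 0" "A > 0"
    "\<And>d u k h Y. 0 < d \<Longrightarrow> d powr (1 / (2 * s)) \<le> \<rho> \<Longrightarrow> weak_solution \<Omega> s p d u \<Longrightarrow>
       set_integrable lebesgue \<Omega> (\<lambda>x. \<bar>u x\<bar> powr (p + 1)) \<Longrightarrow> k \<ge> 0 \<Longrightarrow> h > 0 \<Longrightarrow> Y > 0 \<Longrightarrow>
       truncation_energy \<Omega> p u k \<le> Y \<Longrightarrow>
       truncation_energy \<Omega> p u (k + 2 * h) \<le> A / d * h powr (- \<sigma>) * ((1 + k / h) powr p * Y) powr (1 + \<theta>)"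
proof -
  define N where "N = real CARD('n)"
  obtain \<rho> C where \<rho>: "\<rho> > 0" and C: "C > 0" and gn:
    "\<And>w \<delta> E. w \<in> Hs \<Omega> s \<Longrightarrow> 0 < \<delta> \<Longrightarrow> \<delta> \<le> \<rho> \<Longrightarrow> E > 0 \<Longrightarrow> (LINT x:\<Omega>|lebesgue. (w x)\<^sup>2) \<le> E \<Longrightarrow>
       \<delta> powr (2 * s) * gagliardo_form \<Omega> s w w \<le> E \<Longrightarrow>
       (\<integral>\<^sup>+x. indicator \<Omega> x * ennreal (\<bar>w x\<bar> powr (2 + 4 * s / N)) \<partial>lebesgue)
         \<le> ennreal (C * E powr (1 + 2 * s / N) * \<delta> powr (-2 * s))"
    using gagliardo_nirenberg[OF dom s(1)] unfolding N_def by blast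
  have op: "open \<Omega>" using dom by (simp add: bounded_C11_domain_def)
  define c where "c = frac_lap_const TYPE('n) s"
  have c: "c > 0" unfolding c_def by (rule frac_lap_const_pos[OF n s])
  \<comment> \<open>The quadratic energy weighs the form with c d / 2; 2/c converts this weight to
    d, and \<open>K \<ge> 1\<close> lets the L2 part share the bound.\<close>
  define K where "K = max 1 (2 / c)"
  have K: "K \<ge> 1" "K \<ge> 2 / c" by (auto simp: K_def)
  define A where "A = C * K powr (1 + \<theta>)"
  have A: "A > 0" using C K by (simp add: A_def)
  have \<sigma>: "\<sigma> > 0" using pq by (simp add: \<sigma>_def)
  have main: "truncation_energy \<Omega> p u (k + 2 * h) \<le> A / d * h powr (- \<sigma>) * ((1 + k / h) powr p * Y) powr (1 + \<theta>)"
    if d: "0 < d" "d powr (1 / (2 * s)) \<le> \<rho>" and u: "weak_solution \<Omega> s p d u"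
      and up: "set_integrable lebesgue \<Omega> (\<lambda>x. \<bar>u x\<bar> powr (p + 1))" and k: "k \<ge> 0" and h: "h > 0" and Y: "Y > 0"
      and UY: "truncation_energy \<Omega> p u k \<le> Y" for d u k h Y
  proof -
    define \<delta> where "\<delta> = d powr (1 / (2 * s))"
    have \<delta>0: "\<delta> > 0" using d by (simp add: \<delta>_def)
    have d\<delta>: "\<delta> powr (2 * s) = d" using d s by (simp add: \<delta>_def powr_powr)
    define w where "w = (\<lambda>x. max 0 (u x - (k + h)))"
    have uH: "u \<in> Hs \<Omega> s" using u by (simp add: weak_solution_def)
    then have um: "u \<in> borel_measurable lebesgue" by (simp add: Hs_def)
    have "k + h \<ge> 0" using k h by simp
    note W = Hs_positive_part(1)[OF op uH this, folded w_def]
    define E where "E = (1 + k / h) powr p * Y"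
    have "1 + k / h > 0" using k h by (simp add: add_pos_nonneg)
    then have E: "E > 0" using Y by (simp add: E_def)
    have "quad_energy \<Omega> s d w \<le> (1 + k / h) powr p * truncation_energy \<Omega> p u k"
      unfolding w_def using d c by (intro truncated_energy_le op p u up k h) (auto simp: c_def)
    also have "\<dots> \<le> E" unfolding E_def using UY by (rule mult_left_mono) simp
    finally have q: "quad_energy \<Omega> s d w \<le> E" .
    have G0: "gagliardo_form \<Omega> s w w \<ge> 0" by (rule gagliardo_form_nonneg)
    have S0: "(LINT x:\<Omega>|lebesgue. (w x)\<^sup>2) \<ge> 0" by (rule set_integral_sq_nonneg)
    have q': "c / 2 * (d * gagliardo_form \<Omega> s w w) + (LINT x:\<Omega>|lebesgue. (w x)\<^sup>2) \<le> E"
      using q unfolding quad_energy_def c_def[symmetric] by (simp add: mult_ac)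
    have "c / 2 * (d * gagliardo_form \<Omega> s w w) \<ge> 0" using c d G0 by simp
    then have "(LINT x:\<Omega>|lebesgue. (w x)\<^sup>2) \<le> E" using q' by linarith
    also have "E \<le> K * E" using K E by simp
    finally have b1: "(LINT x:\<Omega>|lebesgue. (w x)\<^sup>2) \<le> K * E" .
    have "c / 2 * (d * gagliardo_form \<Omega> s w w) \<le> E" using q' S0 by linarith
    then have "d * gagliardo_form \<Omega> s w w \<le> 2 / c * E" using c by (simp add: field_simps)
    also have "\<dots> \<le> K * E" using K E by (intro mult_right_mono) auto
    finally have b2: "\<delta> powr (2 * s) * gagliardo_form \<Omega> s w w \<le> K * E" by (simp add: d\<delta>)
    have KE: "K * E > 0" using K E by simp
    have "(\<integral>\<^sup>+x. indicator \<Omega> x * ennreal (\<bar>w x\<bar> powr (2 + 4 * s / N)) \<partial>lebesgue)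
         \<le> ennreal (C * (K * E) powr (1 + 2 * s / N) * \<delta> powr (-2 * s))"
      by (rule gn[OF W \<delta>0 _ KE b1 b2]) (use d in \<open>simp add: \<delta>_def\<close>)
    \<comment> \<open>\<delta>^(-2s) turns into the factor 1/d, which the energy bound at level 0
      will cancel.\<close>
    also have "C * (K * E) powr (1 + 2 * s / N) * \<delta> powr (-2 * s) = A / d * E powr (1 + \<theta>)"
      using d\<delta> by (simp add: A_def \<theta>_def N_def powr_mult powr_minus field_simps)
    finally have wq: "(\<integral>\<^sup>+x. indicator \<Omega> x * ennreal (\<bar>w x\<bar> powr (2 + 4 * s / N)) \<partial>lebesgue)
         \<le> ennreal (A / d * E powr (1 + \<theta>))" .
    have pt: "max 0 (u x - (k + 2 * h)) powr (p + 1) \<le> h powr (- \<sigma>) * \<bar>w x\<bar> powr (2 + 4 * s / N)" for x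
    proof (cases "u x > k + 2 * h")
      case False
      then have "max 0 (u x - (k + 2 * h)) = 0" by simp
      then show ?thesis by simp
    next
      case True
      then have w: "w x \<ge> h" "w x = u x - (k + h)" using h by (auto simp: w_def)
      have "max 0 (u x - (k + 2 * h)) powr (p + 1) \<le> w x powr (p + 1)"
        using True w h p by (intro powr_mono2) auto
      also have "\<dots> = w x powr (- \<sigma>) * w x powr (2 + 4 * s / N)"
        unfolding powr_add[symmetric] by (simp add: \<sigma>_def N_def add.commute)
      also have "\<dots> \<le> h powr (- \<sigma>) * w x powr (2 + 4 * s / N)"
        using w h \<sigma> by (intro mult_right_mono powr_mono2') auto
      finally show ?thesis using w h by simp
    qed
    have int: "set_integrable lebesgue \<Omega> (\<lambda>x. max 0 (u x - (k + 2 * h)) powr (p + 1))"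
      using k h p by (intro truncation_energy_integrable op um up) auto
    have "ennreal (truncation_energy \<Omega> p u (k + 2 * h))
      = (\<integral>\<^sup>+x. indicator \<Omega> x * ennreal (max 0 (u x - (k + 2 * h)) powr (p + 1)) \<partial>lebesgue)"
      unfolding truncation_energy_def by (rule nn_integral_indicator_eq_set_integral[OF int, symmetric]) simp
    also have "\<dots> \<le> (\<integral>\<^sup>+x. ennreal (h powr (- \<sigma>)) * (indicator \<Omega> x * ennreal (\<bar>w x\<bar> powr (2 + 4 * s / N))) \<partial>lebesgue)"
    proof (rule nn_integral_mono)
      fix x
      show "indicator \<Omega> x * ennreal (max 0 (u x - (k + 2 * h)) powr (p + 1))
        \<le> ennreal (h powr (- \<sigma>)) * (indicator \<Omega> x * ennreal (\<bar>w x\<bar> powr (2 + 4 * s / N)))"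
        using ennreal_leI[OF pt[of x]] by (cases "x \<in> \<Omega>") (simp_all add: ennreal_mult)
    qed
    also have "\<dots> = ennreal (h powr (- \<sigma>)) * (\<integral>\<^sup>+x. indicator \<Omega> x * ennreal (\<bar>w x\<bar> powr (2 + 4 * s / N)) \<partial>lebesgue)"
    proof (rule nn_integral_cmult)
      have [measurable]: "w \<in> borel_measurable lebesgue" using um unfolding w_def by simp
      have [measurable]: "\<Omega> \<in> sets lebesgue" using op by simp
      show "(\<lambda>x. indicator \<Omega> x * ennreal (\<bar>w x\<bar> powr (2 + 4 * s / N))) \<in> borel_measurable lebesgue"
        by measurable
    qed
    also have "\<dots> \<le> ennreal (h powr (- \<sigma>)) * ennreal (A / d * E powr (1 + \<theta>))"
      by (rule mult_left_mono[OF wq]) simp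
    also have "\<dots> = ennreal (A / d * h powr (- \<sigma>) * E powr (1 + \<theta>))"
      using A d by (simp add: ennreal_mult'[symmetric] mult_ac)
    finally show ?thesis
      using A d by (simp add: E_def)
  qed
  show thesis by (rule that[OF \<rho> A main])
qed

text \<open>The cost of step j grows like B^j, because the gaps shrink like 2^(-j). Under the ansatz
  Y0 q^j the superlinear factor supplies q^(j \<theta>) = B^(-j), whence q = B^(-1/\<theta>);
  \<open>small\<close> asks that the remaining constant be at most q.\<close>

lemma geometric_decay_iteration:
  fixes U :: "real \<Rightarrow> real"
  assumes step: "\<And>k h Y. k \<ge> 0 \<Longrightarrow> h > 0 \<Longrightarrow> Y > 0 \<Longrightarrow> U k \<le> Y \<Longrightarrow>
      U (k + 2 * h) \<le> D * h powr (- \<sigma>) * ((1 + k / h) powr p * Y) powr (1 + \<theta>)"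
    and D: "D > 0" and \<theta>: "\<theta> > 0" and M: "M > 0" and p: "p > 0" and Y0: "Y0 > 0" "U 0 \<le> Y0"
  defines "B \<equiv> 2 powr (\<sigma> + p * (1 + \<theta>))"
  defines "q \<equiv> B powr (- 1 / \<theta>)"
  assumes small: "D * Y0 powr \<theta> * 2 powr (2 * \<sigma> + 3 * p * (1 + \<theta>)) * M powr (- \<sigma>) \<le> q"
  shows "U (M * (1 - (1/2) ^ j)) \<le> Y0 * q ^ j"
proof (induction j)
  case 0
  then show ?case using Y0 by simp
next
  case (Suc j)
  \<comment> \<open>Two gaps of size M 2^(-j-2) lead from level j to level j + 1.\<close>
  define k h where "k = M * (1 - (1/2) ^ j)" and "h = M * (1/2) ^ (j + 2)"
  have B: "B > 0" by (simp add: B_def)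
  have q: "q > 0" using B by (simp add: q_def)
  have k: "k \<ge> 0" using M by (simp add: k_def power_le_one)
  have h: "h > 0" using M by (simp add: h_def)
  have kh: "k + 2 * h = M * (1 - (1/2) ^ Suc j)" by (simp add: k_def h_def algebra_simps)
  have "M / h = 2 ^ (j + 2)" using M by (simp add: h_def power_divide)
  moreover have "k / h \<le> M / h" using M h by (intro divide_right_mono) (auto simp: k_def)
  moreover have "(1::real) \<le> 2 ^ (j + 2)" by (rule one_le_power) simp
  \<comment> \<open>Adding 1 to a number at most 2^(j+2) costs one more doubling. This is the 3 in
    the exponent \<open>3 * p * (1 + \<theta>)\<close>, as the 2 in \<open>2 * \<sigma>\<close>
    comes from the gap 2^(-j-2).\<close>
  ultimately have "1 + k / h \<le> 2 ^ (j + 3)" by (simp add: power_add)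
  also have "\<dots> = 2 powr (real j + 3)" by (simp add: powr_add powr_realpow power_add)
  finally have kh3: "1 + k / h \<le> 2 powr (real j + 3)" .
  have pos: "1 + k / h > 0" using k h by (simp add: add_pos_nonneg)
  have h': "h powr (- \<sigma>) = M powr (- \<sigma>) * 2 powr (\<sigma> * (real j + 2))"
  proof -
    have "(1/2::real) ^ (j + 2) = 2 powr (- (real j + 2))"
    proof -
      have "2 powr (real j + 2) = (2::real) ^ (j + 2)" by (simp add: powr_add powr_realpow)
      then show ?thesis unfolding powr_minus by (simp add: power_one_over inverse_eq_divide)
    qed
    then have "h powr (- \<sigma>) = M powr (- \<sigma>) * (2 powr (- (real j + 2))) powr (- \<sigma>)"
      unfolding h_def by (simp add: powr_mult)
    also have "(2 powr (- (real j + 2))) powr (- \<sigma>) = 2 powr (\<sigma> * (real j + 2))"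
      unfolding powr_powr by (simp add: algebra_simps)
    finally show ?thesis .
  qed
  define Y where "Y = Y0 * q ^ j"
  have Y: "Y > 0" using Y0 q by (simp add: Y_def)
  have "U (k + 2 * h) \<le> D * h powr (- \<sigma>) * ((1 + k / h) powr p * Y) powr (1 + \<theta>)"
    by (rule step[OF k h Y]) (use Suc.IH in \<open>simp add: k_def Y_def\<close>)
  also have "\<dots> \<le> D * h powr (- \<sigma>) * (2 powr (p * (real j + 3)) * Y) powr (1 + \<theta>)"
  proof (intro mult_left_mono powr_mono2 mult_right_mono)
    have "(1 + k / h) powr p \<le> (2 powr (real j + 3)) powr p" using kh3 pos p by (intro powr_mono2) auto
    then show "(1 + k / h) powr p \<le> 2 powr (p * (real j + 3))" by (simp add: powr_powr mult.commute)
  qed (use D \<theta> Y in auto)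
  also have "\<dots> = D * M powr (- \<sigma>) * (2 powr (\<sigma> * (real j + 2)) * 2 powr (p * (real j + 3) * (1 + \<theta>))) * (Y * Y powr \<theta>)"
  proof -
    have "(2 powr (p * (real j + 3)) * Y) powr (1 + \<theta>) = 2 powr (p * (real j + 3) * (1 + \<theta>)) * (Y * Y powr \<theta>)"
      using Y unfolding powr_mult powr_powr by (simp add: powr_add[of Y])
    then show ?thesis by (simp add: h')
  qed
  also have "2 powr (\<sigma> * (real j + 2)) * 2 powr (p * (real j + 3) * (1 + \<theta>)) = 2 powr (2 * \<sigma> + 3 * p * (1 + \<theta>)) * B ^ j"
  proof -
    have "B ^ j = 2 powr ((\<sigma> + p * (1 + \<theta>)) * real j)"
      by (simp add: B_def powr_realpow[symmetric] powr_powr)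
    then show ?thesis by (simp add: powr_add[symmetric] algebra_simps)
  qed
  also have "Y powr \<theta> = Y0 powr \<theta> * inverse (B ^ j)"
  proof -
    have "q powr \<theta> = inverse B" unfolding q_def powr_powr using \<theta> B by (simp add: powr_minus)
    moreover have "(q ^ j) powr \<theta> = (q powr \<theta>) ^ j"
      using q by (simp add: powr_realpow[symmetric] powr_powr mult.commute)
    ultimately show ?thesis unfolding Y_def powr_mult by (simp add: power_inverse)
  qed
  also have "D * M powr (- \<sigma>) * (2 powr (2 * \<sigma> + 3 * p * (1 + \<theta>)) * B ^ j) * (Y * (Y0 powr \<theta> * inverse (B ^ j)))
     = (D * Y0 powr \<theta> * 2 powr (2 * \<sigma> + 3 * p * (1 + \<theta>)) * M powr (- \<sigma>)) * Y"
    using B by (simp add: field_simps)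
  also have "\<dots> \<le> q * Y" using small Y by (intro mult_right_mono) auto
  also have "\<dots> = Y0 * q ^ Suc j" by (simp add: Y_def)
  finally show ?case unfolding kh .
qed

text \<open>The starting bound Y0 = C0 d^(n/(2s)) satisfies Y0^\<theta> = C0^\<theta> d since
  \<theta> = 2s/n, and this d cancels the 1/d of the step. The limiting level \<open>M\<close> can
  therefore be chosen before d and u.\<close>

lemma least_energy_sup_bound:
  fixes \<Omega> :: "(real^'n) set" and s p C0 :: real
  assumes n: "CARD('n) \<ge> 2" and s: "0 < s" "s < 1" and p: "p > 1" and dom: "bounded_C11_domain \<Omega>"
    and pq: "p + 1 < 2 + 4 * s / real CARD('n)" and C0: "C0 > 0"
  obtains \<rho> M where "\<rho> > 0" "M > 0"
    "\<And>d u. 0 < d \<Longrightarrow> d powr (1 / (2 * s)) \<le> \<rho> \<Longrightarrow> weak_solution \<Omega> s p d u \<Longrightarrow>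
       set_integrable lebesgue \<Omega> (\<lambda>x. \<bar>u x\<bar> powr (p + 1)) \<Longrightarrow>
       power_energy \<Omega> p u \<le> C0 * d powr (real CARD('n) / (2 * s)) \<Longrightarrow>
       AE x in lebesgue. x \<in> \<Omega> \<longrightarrow> u x \<le> M"
proof -
  define N where "N = real CARD('n)"
  have N: "N > 0" by (simp add: N_def)
  define \<theta> where "\<theta> = 2 * s / N"
  define \<sigma> where "\<sigma> = 1 + 4 * s / N - p"
  have \<theta>: "\<theta> > 0" using s N by (simp add: \<theta>_def)
  have \<sigma>: "\<sigma> > 0" using pq by (simp add: \<sigma>_def N_def)
  have op: "open \<Omega>" using dom by (simp add: bounded_C11_domain_def)
  obtain \<rho> A where \<rho>: "\<rho> > 0" and A: "A > 0" and step:
    "\<And>d u k h Y. 0 < d \<Longrightarrow> d powr (1 / (2 * s)) \<le> \<rho> \<Longrightarrow> weak_solution \<Omega> s p d u \<Longrightarrow>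
       set_integrable lebesgue \<Omega> (\<lambda>x. \<bar>u x\<bar> powr (p + 1)) \<Longrightarrow> k \<ge> 0 \<Longrightarrow> h > 0 \<Longrightarrow> Y > 0 \<Longrightarrow>
       truncation_energy \<Omega> p u k \<le> Y \<Longrightarrow>
       truncation_energy \<Omega> p u (k + 2 * h) \<le> A / d * h powr (- \<sigma>) * ((1 + k / h) powr p * Y) powr (1 + \<theta>)"
    using de_giorgi_step[OF n s p dom pq] unfolding \<theta>_def \<sigma>_def N_def by blast
  define B where "B = 2 powr (\<sigma> + p * (1 + \<theta>))"
  define q where "q = B powr (- 1 / \<theta>)"
  have "B > 1" using \<sigma> p \<theta> by (simp add: B_def add_pos_pos)
  then have q: "0 < q" "q < 1" using \<theta> by (auto simp: q_def powr_less_one)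
  \<comment> \<open>\<open>L\<close> and M = L^(1/\<sigma>) are solved from the smallness condition,
    which then holds with equality.\<close>
  define L where "L = A * C0 powr \<theta> * 2 powr (2 * \<sigma> + 3 * p * (1 + \<theta>)) / q"
  have L: "L > 0" using A C0 q by (simp add: L_def)
  define M where "M = L powr (1 / \<sigma>)"
  have M: "M > 0" using L by (simp add: M_def)
  have Mpow: "M powr (- \<sigma>) = inverse L" using L \<sigma> by (simp add: M_def powr_powr powr_minus)
  have main: "AE x in lebesgue. x \<in> \<Omega> \<longrightarrow> u x \<le> M"
    if d: "0 < d" "d powr (1 / (2 * s)) \<le> \<rho>" and u: "weak_solution \<Omega> s p d u"
      and up: "set_integrable lebesgue \<Omega> (\<lambda>x. \<bar>u x\<bar> powr (p + 1))"
      and en: "power_energy \<Omega> p u \<le> C0 * d powr (real CARD('n) / (2 * s))" for d u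
  proof -
    have um: "u \<in> borel_measurable lebesgue" using u by (simp add: weak_solution_def Hs_def)
    define Y0 where "Y0 = C0 * d powr (N / (2 * s))"
    have Y0: "Y0 > 0" using C0 d by (simp add: Y0_def)
    let ?U = "truncation_energy \<Omega> p u"
    have Ui: "set_integrable lebesgue \<Omega> (\<lambda>x. max 0 (u x - k) powr (p + 1))" if "k \<ge> 0" for k
      using truncation_energy_integrable[OF op um _ that up] p by simp
    have "?U 0 \<le> power_energy \<Omega> p u"
      unfolding truncation_energy_def power_energy_def
      using p by (intro set_integral_mono Ui up powr_mono2) auto
    then have U0: "?U 0 \<le> Y0" using en by (simp add: Y0_def N_def)
    have Y\<theta>: "Y0 powr \<theta> = C0 powr \<theta> * d"
      using s N d by (simp add: Y0_def powr_mult powr_powr \<theta>_def)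
    have small: "A / d * Y0 powr \<theta> * 2 powr (2 * \<sigma> + 3 * p * (1 + \<theta>)) * M powr (- \<sigma>) \<le> q"
    proof -
      have "A / d * Y0 powr \<theta> * 2 powr (2 * \<sigma> + 3 * p * (1 + \<theta>)) * M powr (- \<sigma>) = q * (L * inverse L)"
        unfolding Y\<theta> Mpow using d q by (simp add: L_def)
      also have "\<dots> = q" using L by simp
      finally show ?thesis by simp
    qed
    have decay: "?U (M * (1 - (1/2) ^ j)) \<le> Y0 * q ^ j" for j
      unfolding q_def B_def
      by (rule geometric_decay_iteration[OF step[OF d u up] _ \<theta> M _ Y0 U0 small[unfolded q_def B_def]])
         (use A d p in auto)
    \<comment> \<open>All levels stay below \<open>M\<close> and the truncation energy decreases in
      the level, so its value at \<open>M\<close> lies below every term of a null sequence.\<close>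
    have "?U M \<le> Y0 * q ^ j" for j
    proof -
      define k where "k = M * (1 - (1/2) ^ j)"
      have k: "0 \<le> k" "k \<le> M" using M by (simp_all add: k_def power_le_one)
      have "?U M \<le> ?U k"
        unfolding truncation_energy_def
        using M p k by (intro set_integral_mono Ui powr_mono2 max.mono) auto
      then have "?U M \<le> ?U (M * (1 - (1/2) ^ j))" by (simp only: k_def)
      then show ?thesis using decay[of j] by simp
    qed
    moreover have "(\<lambda>j. Y0 * q ^ j) \<longlonglongrightarrow> Y0 * 0"
      using q by (intro tendsto_mult_left LIMSEQ_realpow_zero) auto
    ultimately have "?U M \<le> 0" by (intro LIMSEQ_le_const[of _ "Y0 * 0" "?U M", simplified]) auto
    moreover have "?U M \<ge> 0"
      unfolding truncation_energy_def set_lebesgue_integral_def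
      by (intro Bochner_Integration.integral_nonneg) (simp add: indicator_def)
    ultimately have "?U M = 0" by simp
    then have "AE x in lebesgue. indicator \<Omega> x *\<^sub>R max 0 (u x - M) powr (p + 1) = 0"
      using Ui[of M] M integral_nonneg_eq_0_iff_AE[of lebesgue "\<lambda>x. indicator \<Omega> x *\<^sub>R max 0 (u x - M) powr (p + 1)"]
      unfolding truncation_energy_def set_lebesgue_integral_def set_integrable_def by auto
    then show ?thesis
      by eventually_elim (auto simp: indicator_def max_def split: if_splits)
  qed
  show thesis by (rule that[OF \<rho> M main])
qed

theorem theorem1p2:
  fixes s p :: real and \<Omega> :: "(real^'n) set"
  assumes "0 < s" and "s < 1"
    and "real CARD('n) > max 1 (2 * s)"
    and "1 < p" and "p < (real CARD('n) + s) / (real CARD('n) - s)"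
    and "bounded_C11_domain \<Omega>"
  shows "\<exists>d0>0. \<exists>C0>0. \<exists>C1>0. \<forall>d. 0 < d \<and> d < d0 \<longrightarrow>
    (\<forall>e u. mp_endpoint \<Omega> s p d e \<and> weak_solution \<Omega> s p d u \<and> least_energy_solution \<Omega> s p d e u \<longrightarrow>
       d * (frac_lap_const TYPE('n) s / 2) * gagliardo_form \<Omega> s u u + (LINT x:\<Omega>|lebesgue. (u x)\<^sup>2)
         = (LINT x:\<Omega>|lebesgue. u x powr (p + 1)) \<and>
       (LINT x:\<Omega>|lebesgue. u x powr (p + 1)) \<le> C0 * d powr (real CARD('n) / (2 * s)) \<and>
       esssup (restrict_space lebesgue \<Omega>) (\<lambda>x. ereal (u x)) \<le> ereal C1)"
proof -
  note s = assms(1,2) and p = assms(4) and dom = assms(6)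
  define N where "N = real CARD('n)"
  have N: "N > 1" "N > 2 * s" using assms(3) by (auto simp: N_def)
  have n: "CARD('n) \<ge> 2" using N(1) by (simp add: N_def)
  have \<Omega>: "open \<Omega>" "\<Omega> \<noteq> {}" using dom by (auto simp: bounded_C11_domain_def)
  have pq: "p + 1 < 2 + 4 * s / real CARD('n)"
  proof -
    have Ns: "N - s > 0" using N s by linarith
    have "2 * s / (N - s) \<le> 4 * s / N"
      using N Ns s by (simp add: divide_le_eq pos_le_divide_eq field_simps)
    moreover have "(N + s) / (N - s) = 1 + 2 * s / (N - s)" using Ns by (simp add: field_simps)
    ultimately show ?thesis using assms(5) unfolding N_def by linarith
  qed
  have c: "frac_lap_const TYPE('n) s \<ge> 0" using frac_lap_const_pos[OF n s] by simp
  obtain d0 C0 where d0: "d0 > 0" and C0: "C0 > 0" and energy: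
    "\<And>d e u. 0 < d \<Longrightarrow> d < d0 \<Longrightarrow> mp_endpoint \<Omega> s p d e \<Longrightarrow> weak_solution \<Omega> s p d u \<Longrightarrow>
      least_energy_solution \<Omega> s p d e u \<Longrightarrow> power_energy \<Omega> p u \<le> C0 * d powr (real CARD('n) / (2 * s))"
    using least_energy_bound[OF n s p \<Omega>] by blast
  \<comment> \<open>\<open>C0\<close> is fixed first, since \<open>M\<close> depends on it.\<close>
  obtain \<rho> M where \<rho>: "\<rho> > 0" and M: "M > 0" and sup:
    "\<And>d u. 0 < d \<Longrightarrow> d powr (1 / (2 * s)) \<le> \<rho> \<Longrightarrow> weak_solution \<Omega> s p d u \<Longrightarrow>
       set_integrable lebesgue \<Omega> (\<lambda>x. \<bar>u x\<bar> powr (p + 1)) \<Longrightarrow>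
       power_energy \<Omega> p u \<le> C0 * d powr (real CARD('n) / (2 * s)) \<Longrightarrow>
       AE x in lebesgue. x \<in> \<Omega> \<longrightarrow> u x \<le> M"
    using least_energy_sup_bound[OF n s p dom pq C0] by blast
  show ?thesis
  \<comment> \<open>The second bound on d guarantees that \<delta> = d^(1/(2s)) is an admissible
    radius for the averaging.\<close>
  proof (rule exI[of _ "min d0 (\<rho> powr (2 * s))"], intro conjI, use d0 \<rho> in simp,
      rule exI[of _ C0], intro conjI, rule C0, rule exI[of _ M], intro conjI, rule M, intro allI impI)
    fix d e u
    assume d: "0 < d \<and> d < min d0 (\<rho> powr (2 * s))"
      and A: "mp_endpoint \<Omega> s p d e \<and> weak_solution \<Omega> s p d u \<and> least_energy_solution \<Omega> s p d e u"
    have d': "0 < d" "d < d0" "d \<ge> 0" using d by auto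
    have e: "mp_endpoint \<Omega> s p d e" and u: "weak_solution \<Omega> s p d u" and les: "least_energy_solution \<Omega> s p d e u"
      using A by auto
    have pos: "AE x in lebesgue. x \<in> \<Omega> \<longrightarrow> u x > 0" using les by (simp add: least_energy_solution_def)
    note P = weak_solution_power_energy[OF \<Omega> d'(3) c u pos]
    note En = energy[OF d'(1,2) e u les]
    have "d powr (1 / (2 * s)) \<le> (\<rho> powr (2 * s)) powr (1 / (2 * s))"
      using d s by (intro powr_mono2) auto
    also have "\<dots> = \<rho>" using \<rho> s by (simp add: powr_powr)
    finally have "AE x in lebesgue. x \<in> \<Omega> \<longrightarrow> u x \<le> M"
      by (rule sup[OF d'(1) _ u P(3) En])
    then have ae: "AE x in restrict_space lebesgue \<Omega>. ereal (u x) \<le> ereal M"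
      using \<Omega>(1) by (subst AE_restrict_space_iff) auto
    have "u \<in> borel_measurable lebesgue" using u by (simp add: weak_solution_def Hs_def)
    then have "(\<lambda>x. ereal (u x)) \<in> borel_measurable (restrict_space lebesgue \<Omega>)"
      by (intro borel_measurable_ereal measurable_restrict_space1)
    then have "esssup (restrict_space lebesgue \<Omega>) (\<lambda>x. ereal (u x)) \<le> ereal M"
      using ae by (rule esssup_I)
    then show "d * (frac_lap_const TYPE('n) s / 2) * gagliardo_form \<Omega> s u u + (LINT x:\<Omega>|lebesgue. (u x)\<^sup>2)
         = (LINT x:\<Omega>|lebesgue. u x powr (p + 1)) \<and>
       (LINT x:\<Omega>|lebesgue. u x powr (p + 1)) \<le> C0 * d powr (real CARD('n) / (2 * s)) \<and>
       esssup (restrict_space lebesgue \<Omega>) (\<lambda>x. ereal (u x)) \<le> ereal M"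
      using P En by (simp add: quad_energy_def)
  qed
qed

end
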